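(* Let $w>0$. (1) If $n,k\to\infty$ (with $1\le k\le n$) in such a way that $k/\sqrt n\to w$, then for any $\varepsilon>0$ $$\mathrm{Prob}\left\{\sup_{x\in\mathbb{R}}\left|\frac{f^{\tau_k^n}(x\sqrt n)}{\sqrt n}-g_w(x)\right|>\varepsilon\right\}\to0 .$$ (2) If $n,k\to\infty$ (with $1\le k\le n$) in such a way that $(n-k)/\sqrt n\to w$, then for any $\varepsilon>0$ $$\mathrm{Prob}\left\{\sup_{x\in\mathbb{R}}\left|\frac{f^{\tau_k^n}(x\sqrt n)}{\sqrt n}-g_w(-x)\right|>\varepsilon\right\}\to0 .$$ Here $g_w$ is the deterministic limit function in Biane's theorem for the characters $\sigma_k^n$ (see context).
   Context: $\mathfrak{S}_n$ is the group of permutations of $\{1,\dots,n\}$, $e$ its identity, and $\ell_n(g)$ is the number of cycles of $g$ (fixed points included). For an integer $k\ge1$ put $\sigma_k^n(g)=k^{\ell_n(g)}$, and for $k=1,\dots,n$ define $\tau_k^n=\sum_{j=0}^{k-1}(-1)^j\binom{n+1}{j}\sigma^n_{k-j}$. Both $\sigma_k^n$ and $\tau_k^n$ are known to be characters (central positive definite functions) of $\mathfrak{S}_n$. Let $\mathbb{Y}_n$ be the set of Young diagrams with $n$ boxes (partitions of $n$), and let $\chi^\lambda$ be the irreducible character of $\mathfrak{S}_n$ labelled by $\lambda\in\mathbb{Y}_n$ in the standard way ($(n)$ is the trivial representation). For a nonzero character $\chi=\sum_{\lambda\in\mathbb{Y}_n}c(\lambda)\chi^\lambda$ of $\mathfrak{S}_n$,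 the numbers $P(\lambda)=c(\lambda)\chi^\lambda(e)/\chi(e)$ form a probability distribution on $\mathbb{Y}_n$. To $\lambda\in\mathbb{Y}_n$ one associates the piecewise linear function $f_\lambda:\mathbb{R}\to\mathbb{R}$ with slopes $\pm1$ whose graph is the upper boundary of the diagram drawn in rotated ("Russian") form, continued by $|x|$: the box in row $i$ and column $j$ is drawn as the square $\{(v-u,\,u+v): i-1\le u\le i,\ j-1\le v\le j\}$, and $f_\lambda(x)$ is the maximum of $|x|$ and of all $y$ such that $(x,y)$ lies in one of the squares of $\lambda$. The random function $f^\chi$ is $f_\lambda$ with $\lambda$ distributed according to $P$. Biane's theorem (known): for every $w>0$ there is a deterministic function $g_w:\mathbb{R}\to\mathbb{R}$ such that, whenever $n,k\to\infty$ with $k/\sqrt n\to w$, for any $\varepsilon>0$ one has $\mathrm{Prob}\{\sup_x|f^{\sigma_k^n}(x\sqrt n)/\sqrt n-g_w(x)|>\varepsilon\}\to0$. This property determines $g_w$ uniquely. *)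

theory Defs
  imports
    Complex_Main
    "HOL-Library.Extended_Real"
    "HOL-Library.Function_Algebras"
    "HOL-Combinatorics.Permutations"
    "HOL-Combinatorics.Orbits"
begin

section \<open>Young diagrams\<close>

definition young_diagrams :: "nat \<Rightarrow> nat list set" where
  "young_diagrams n = {la. sorted_wrt (\<ge>) la \<and> 0 \<notin> set la \<and> sum_list la = n}"

text \<open>Boxes are pairs (row, column), both counted from 1.\<close>

definition boxes :: "nat list \<Rightarrow> (nat \<times> nat) set" where
  "boxes la = {(i, j). 1 \<le> i \<and> i \<le> length la \<and> 1 \<le> j \<and> j \<le> la ! (i - 1)}"

definition box_square :: "nat \<Rightarrow> nat \<Rightarrow> (real \<times> real) set" where
  "box_square i j = {(v - u, u + v) | u v.
     real i - 1 \<le> u \<and> u \<le> real i \<and> real j - 1 \<le> v \<and> v \<le> real j}"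

text \<open>The supremum is a maximum, since there are finitely many compact squares.\<close>

definition profile :: "nat list \<Rightarrow> real \<Rightarrow> real" where
  "profile la x = Sup (insert \<bar>x\<bar> {y. \<exists>(i, j) \<in> boxes la. (x, y) \<in> box_square i j})"


section \<open>Irreducible characters of the symmetric group\<close>

text \<open>
  The group algebra of the symmetric group on \<open>{1..n}\<close> is realised as the space of complex
  functions vanishing off the permutations of \<open>{1..n}\<close>, with convolution as its product.
\<close>

definition group_algebra :: "nat \<Rightarrow> ((nat \<Rightarrow> nat) \<Rightarrow> complex) set" where
  "group_algebra n = {a. \<forall>g. \<not> g permutes {1..n} \<longrightarrow> a g = 0}"

definition convolution ::
  "nat \<Rightarrow> ((nat \<Rightarrow> nat) \<Rightarrow> complex) \<Rightarrow> ((nat \<Rightarrow> nat) \<Rightarrow> complex) \<Rightarrow> (nat \<Rightarrow> nat) \<Rightarrow> complex" where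
  "convolution n a b g = (\<Sum>h | h permutes {1..n}. a h * b (inv h \<circ> g))"

definition left_translation ::
  "(nat \<Rightarrow> nat) \<Rightarrow> ((nat \<Rightarrow> nat) \<Rightarrow> complex) \<Rightarrow> (nat \<Rightarrow> nat) \<Rightarrow> complex" where
  "left_translation g a = (\<lambda>x. a (inv g \<circ> x))"

text \<open>The tableau whose rows are filled consecutively from left to right, top to bottom.\<close>

definition tableau :: "nat list \<Rightarrow> nat \<Rightarrow> nat \<Rightarrow> nat" where
  "tableau la i j = sum_list (take (i - 1) la) + j"

definition row_group :: "nat list \<Rightarrow> (nat \<Rightarrow> nat) set" where
  "row_group la = {p. p permutes {1..sum_list la} \<and>
     (\<forall>(i, j) \<in> boxes la. \<exists>j'. (i, j') \<in> boxes la \<and> p (tableau la i j) = tableau la i j')}"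

definition column_group :: "nat list \<Rightarrow> (nat \<Rightarrow> nat) set" where
  "column_group la = {q. q permutes {1..sum_list la} \<and>
     (\<forall>(i, j) \<in> boxes la. \<exists>i'. (i', j) \<in> boxes la \<and> q (tableau la i j) = tableau la i' j)}"

text \<open>
  The Young symmetrizer, i.e. the element \<open>(\<Sum>p. p) (\<Sum>q. sign q \<cdot> q)\<close> of the group algebra,
  \<open>p\<close> ranging over the row group and \<open>q\<close> over the column group.
\<close>

definition young_symmetrizer :: "nat list \<Rightarrow> (nat \<Rightarrow> nat) \<Rightarrow> complex" where
  "young_symmetrizer la x =
     (\<Sum>(p, q) \<in> {(p, q). p \<in> row_group la \<and> q \<in> column_group la \<and> p \<circ> q = x}. of_int (sign q))"

text \<open>
  The irreducible module of the diagram \<open>la\<close>: the left ideal of the group algebra generated by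
  the Young symmetrizer. With rows symmetrized and columns antisymmetrized, one-row diagrams give
  the trivial and one-column diagrams the sign representation.
\<close>

definition irr_module :: "nat list \<Rightarrow> ((nat \<Rightarrow> nat) \<Rightarrow> complex) set" where
  "irr_module la =
     (\<lambda>a. convolution (sum_list la) a (young_symmetrizer la)) ` group_algebra (sum_list la)"

interpretation funs: vector_space "\<lambda>(c::complex) (f::'a \<Rightarrow> complex) x. c * f x"
  by unfold_locales (auto simp: fun_eq_iff algebra_simps)

text \<open>
  Trace of an operator \<open>T\<close> on a finite-dimensional invariant subspace \<open>V\<close>: the sum of the
  diagonal coefficients with respect to any basis \<open>B\<close> of \<open>V\<close>.
\<close>

definition trace_on :: "('a \<Rightarrow> complex) set \<Rightarrow> (('a \<Rightarrow> complex) \<Rightarrow> 'a \<Rightarrow> complex) \<Rightarrow> complex" where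
  "trace_on V T = (let B = (SOME B. funs.independent B \<and> funs.span B = V)
                   in \<Sum>b\<in>B. funs.representation B (T b) b)"

definition irr_char :: "nat list \<Rightarrow> (nat \<Rightarrow> nat) \<Rightarrow> complex" where
  "irr_char la g = trace_on (irr_module la) (left_translation g)"


section \<open>The measure on Young diagrams defined by a character\<close>

definition irr_coeff :: "nat \<Rightarrow> ((nat \<Rightarrow> nat) \<Rightarrow> complex) \<Rightarrow> nat list \<Rightarrow> complex" where
  "irr_coeff n chi = (THE c. (\<forall>la. la \<notin> young_diagrams n \<longrightarrow> c la = 0) \<and>
     (\<forall>g. g permutes {1..n} \<longrightarrow> chi g = (\<Sum>la \<in> young_diagrams n. c la * irr_char la g)))"

text \<open>For a nonzero character all the numbers under \<open>Re\<close> are real.\<close>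

definition diagram_prob :: "nat \<Rightarrow> ((nat \<Rightarrow> nat) \<Rightarrow> complex) \<Rightarrow> nat list \<Rightarrow> real" where
  "diagram_prob n chi la = Re (irr_coeff n chi la * irr_char la id / chi id)"

definition event_prob ::
  "nat \<Rightarrow> ((nat \<Rightarrow> nat) \<Rightarrow> complex) \<Rightarrow> (nat list \<Rightarrow> bool) \<Rightarrow> real" where
  "event_prob n chi E = (\<Sum>la | la \<in> young_diagrams n \<and> E la. diagram_prob n chi la)"

text \<open>
  The supremum is taken in the extended reals because no boundedness of the difference with
  \<open>g\<close> is assumed.
\<close>

definition deviation_prob ::
  "nat \<Rightarrow> ((nat \<Rightarrow> nat) \<Rightarrow> complex) \<Rightarrow> (real \<Rightarrow> real) \<Rightarrow> real \<Rightarrow> real" where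
  "deviation_prob n chi g \<epsilon> = event_prob n chi (\<lambda>la.
     (SUP x. ereal \<bar>profile la (x * sqrt (real n)) / sqrt (real n) - g x\<bar>) > ereal \<epsilon>)"


section \<open>The characters and the limit shape\<close>

text \<open>
  The orbits of the points of \<open>{1..n}\<close> are the cycles of \<open>g\<close>, fixed points included.
\<close>

definition num_cycles :: "nat \<Rightarrow> (nat \<Rightarrow> nat) \<Rightarrow> nat" where
  "num_cycles n g = card (orbit g ` {1..n})"

definition sigma_char :: "nat \<Rightarrow> nat \<Rightarrow> (nat \<Rightarrow> nat) \<Rightarrow> complex" where
  "sigma_char n k g = of_nat k ^ num_cycles n g"

definition tau_char :: "nat \<Rightarrow> nat \<Rightarrow> (nat \<Rightarrow> nat) \<Rightarrow> complex" where
  "tau_char n k g = (\<Sum>j<k. (-1) ^ j * of_nat ((n + 1) choose j) * sigma_char n (k - j) g)"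

text \<open>
  \<open>biane_limit w g\<close> says that \<open>g\<close> has the property which, by Biane's theorem, exactly one
  function has.
\<close>

definition biane_limit :: "real \<Rightarrow> (real \<Rightarrow> real) \<Rightarrow> bool" where
  "biane_limit w g \<longleftrightarrow> (\<forall>n k :: nat \<Rightarrow> nat.
     filterlim n at_top sequentially \<longrightarrow> filterlim k at_top sequentially \<longrightarrow>
     (\<lambda>i. real (k i) / sqrt (real (n i))) \<longlonglongrightarrow> w \<longrightarrow>
     (\<forall>\<epsilon>>0. (\<lambda>i. deviation_prob (n i) (sigma_char (n i) (k i)) g \<epsilon>) \<longlonglongrightarrow> 0))"

end

theory Submission
  imports Defs "HOL-Combinatorics.Cycles"
begin

text \<open>
  Write \<open>c\<close> for the Young symmetrizer of \<open>la\<close>. The sum \<open>z\<close> of all conjugates of \<open>c\<close> is, up to a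
  positive factor, both the character of \<open>la\<close> and its central idempotent, so the probability of
  \<open>la\<close> under a character \<open>chi\<close> is proportional to the value of the convolution \<open>chi z\<close> at the
  identity, an expression which is linear in \<open>chi\<close>, and nonnegative for \<open>sigma_char\<close>.
  If \<open>k\<close> is of order \<open>sqrt n\<close>, the terms with \<open>j > 0\<close> in the definition of \<open>tau_char\<close> are
  exponentially small compared with \<open>sigma_char n k\<close>, which proves the first half.
  The second half follows from the identity \<open>tau_char n k = sign * tau_char n (n + 1 - k)\<close>, since
  multiplication by the sign conjugates the diagrams, that is, reflects their profiles.
\<close>

text \<open>\<open>irr_coeff\<close> is a definite description over expansions in traces on left
  ideals, so existence and uniqueness of the expansion have to be established before any probability
  can be computed. Orthogonality of the elements \<open>z\<close> yields independence, hence
  uniqueness. The scalars in \<open>c c = s c\<close> and \<open>z z = t z\<close> are never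
  evaluated: they cancel, and it is enough that they are positive and, for \<open>z\<close>, the
  same for conjugate diagrams. Positivity has one source: the value at the identity of
  \<open>a\<close> times its adjoint \<open>star n a\<close> is a sum of squares.

  The passage from \<open>sigma_char\<close> to \<open>tau_char\<close> is an estimate valid for
  every event, so Biane's theorem enters as a black box. The term with index \<open>j\<close> is at
  most \<open>q ^ j * k ^ n\<close> with \<open>q = (n + 1) exp (- n / k)\<close>, which behaves
  like \<open>n exp (- sqrt n / w)\<close>. The symmetry of \<open>tau_char\<close> is the vanishing
  of the difference of order \<open>n + 1\<close> of a power of degree at most \<open>n\<close>; the
  \<open>1\<close> in \<open>n + 1 - k\<close> disappears after division by
  \<open>sqrt n\<close>.\<close>

declare One_nat_def [simp del]

section \<open>The group algebra of the symmetric group\<close>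

abbreviation perms :: "nat \<Rightarrow> (nat \<Rightarrow> nat) set" where
  "perms n \<equiv> {p. p permutes {1..n}}"

definition delta :: "(nat \<Rightarrow> nat) \<Rightarrow> (nat \<Rightarrow> nat) \<Rightarrow> complex" where
  "delta g = (\<lambda>x. if x = g then 1 else 0)"

text \<open>The adjoint for the standard Hermitian product on functions: convolution by
  \<open>star n a\<close> is adjoint to convolution by \<open>a\<close>. The guard keeps the result
  in the group algebra, since \<open>inv g\<close> is arbitrary when \<open>g\<close> is not
  bijective.\<close>

definition star :: "nat \<Rightarrow> ((nat \<Rightarrow> nat) \<Rightarrow> complex) \<Rightarrow> (nat \<Rightarrow> nat) \<Rightarrow> complex" where
  "star n a g = (if g permutes {1..n} then cnj (a (inv g)) else 0)"

lemma finite_perms: "finite (perms n)"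
  by (simp add: finite_permutations)

lemma perms_comp_iff:
  assumes "h permutes S"
  shows "h \<circ> g permutes S \<longleftrightarrow> g permutes S" "g \<circ> h permutes S \<longleftrightarrow> g permutes S"
proof -
  have "inv h \<circ> (h \<circ> g) = g" "(g \<circ> h) \<circ> inv h = g"
    using permutes_inverses[OF assms] by (simp_all add: fun_eq_iff)
  then show "h \<circ> g permutes S \<longleftrightarrow> g permutes S" "g \<circ> h permutes S \<longleftrightarrow> g permutes S"
    using permutes_compose permutes_inv[OF assms] assms by metis+
qed

lemma inv_comp_perm:
  assumes "g permutes S" "h permutes S"
  shows "inv (g \<circ> h) = inv h \<circ> inv g"
  using assms by (simp add: o_inv_distrib permutes_bij)

lemma perm_cancel:
  assumes "h permutes S"
  shows "inv h \<circ> (h \<circ> x) = x" "h \<circ> (inv h \<circ> x) = x"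
    "y \<circ> h \<circ> inv h = y" "y \<circ> inv h \<circ> h = y" "inv (inv h) = h"
  using permutes_inv_o[OF assms] permutes_inv_inv[OF assms]
  by (simp_all add: fun_eq_iff permutes_inverses[OF assms])

lemma sum_perms_left:
  assumes "q permutes {1..n}"
  shows "(\<Sum>h\<in>perms n. f (q \<circ> h)) = (\<Sum>h\<in>perms n. f h)"
  using setum_permutations_compose_left[OF assms, of f] by simp

lemma sum_perms_right:
  assumes "q permutes {1..n}"
  shows "(\<Sum>h\<in>perms n. f (h \<circ> q)) = (\<Sum>h\<in>perms n. f h)"
  using sum_permutations_compose_right[OF assms, of f] by simp

lemma sum_perms_inv: "(\<Sum>h\<in>perms n. f (inv h)) = (\<Sum>h\<in>perms n. f h)"
  using sum_permutations_inverse[of f "{1..n}"] by simp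

lemma convolution_alt:
  assumes "g permutes {1..n}"
  shows "convolution n a b g = (\<Sum>h\<in>perms n. a (g \<circ> inv h) * b h)"
proof -
  have "convolution n a b g = (\<Sum>h\<in>perms n. a (g \<circ> inv h) * b (inv (g \<circ> inv h) \<circ> g))"
    unfolding convolution_def
    using sum_perms_inv[of "\<lambda>h. a (g \<circ> h) * b (inv (g \<circ> h) \<circ> g)" n]
      sum_perms_left[OF assms, of "\<lambda>h. a h * b (inv h \<circ> g)"] by simp
  also have "\<dots> = (\<Sum>h\<in>perms n. a (g \<circ> inv h) * b h)"
    using assms
    by (intro sum.cong) (simp_all add: inv_comp_perm permutes_inv perm_cancel o_assoc[symmetric]
        permutes_inv_o)
  finally show ?thesis .
qed

text \<open>The summation variable runs over permutations only, so \<open>inv h \<circ> g\<close>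
  leaves the support of \<open>b\<close> as soon as \<open>g\<close> is not a permutation; the
  support of the product is governed by the right factor.\<close>

lemma convolution_in:
  assumes "b \<in> group_algebra n"
  shows "convolution n a b \<in> group_algebra n"
  using assms
  by (auto simp: group_algebra_def convolution_def perms_comp_iff permutes_inv intro!: sum.neutral)

lemma convolution_assoc:
  "convolution n (convolution n a b) c = convolution n a (convolution n b c)"
proof
  fix g
  have "convolution n (convolution n a b) c g =
      (\<Sum>k\<in>perms n. \<Sum>h\<in>perms n. a k * b (inv k \<circ> h) * c (inv h \<circ> g))"
    unfolding convolution_def sum_distrib_right by (rule sum.swap)
  also have "\<dots> = (\<Sum>k\<in>perms n. \<Sum>h\<in>perms n. a k * b h * c (inv h \<circ> (inv k \<circ> g)))"
  proof (rule sum.cong[OF refl])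
    fix k assume "k \<in> perms n"
    then have k: "k permutes {1..n}" by simp
    have "(\<Sum>h\<in>perms n. a k * b (inv k \<circ> h) * c (inv h \<circ> g)) =
      (\<Sum>h\<in>perms n. a k * b (inv k \<circ> (k \<circ> h)) * c (inv (k \<circ> h) \<circ> g))"
      by (rule sum_perms_left[OF k, symmetric])
    also have "\<dots> = (\<Sum>h\<in>perms n. a k * b h * c (inv h \<circ> (inv k \<circ> g)))"
      by (intro sum.cong) (auto simp: inv_comp_perm[OF k] perm_cancel[OF k] o_assoc[symmetric])
    finally show "(\<Sum>h\<in>perms n. a k * b (inv k \<circ> h) * c (inv h \<circ> g)) =
      (\<Sum>h\<in>perms n. a k * b h * c (inv h \<circ> (inv k \<circ> g)))" .
  qed
  also have "\<dots> = convolution n a (convolution n b c) g"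
    unfolding convolution_def by (simp add: sum_distrib_left mult.assoc)
  finally show "convolution n (convolution n a b) c g = convolution n a (convolution n b c) g" .
qed

lemma convolution_scale_left: "convolution n (\<lambda>x. s * a x) b = (\<lambda>x. s * convolution n a b x)"
  by (simp add: convolution_def fun_eq_iff sum_distrib_left mult.assoc)

lemma convolution_scale_right: "convolution n a (\<lambda>x. s * b x) = (\<lambda>x. s * convolution n a b x)"
  by (simp add: convolution_def fun_eq_iff sum_distrib_left mult_ac)

lemma convolution_sum_left:
  "convolution n (\<lambda>x. \<Sum>i\<in>I. f i x) b = (\<lambda>x. \<Sum>i\<in>I. convolution n (f i) b x)"
  unfolding convolution_def sum_distrib_right by (intro ext sum.swap)

lemma convolution_sum_right:
  "convolution n a (\<lambda>x. \<Sum>i\<in>I. f i x) = (\<lambda>x. \<Sum>i\<in>I. convolution n a (f i) x)"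
  unfolding convolution_def sum_distrib_left by (intro ext sum.swap)

lemma convolution_zero [simp]:
  "convolution n (\<lambda>x. 0) b = (\<lambda>x. 0)" "convolution n a (\<lambda>x. 0) = (\<lambda>x. 0)"
  by (simp_all add: convolution_def fun_eq_iff)

lemma delta_in: "g permutes {1..n} \<Longrightarrow> delta g \<in> group_algebra n"
  by (auto simp: delta_def group_algebra_def)

lemma delta_convolution:
  assumes "g permutes {1..n}"
  shows "convolution n (delta g) a = left_translation g a"
proof
  fix x
  have "convolution n (delta g) a x = (\<Sum>h\<in>perms n. if h = g then a (inv g \<circ> x) else 0)"
    unfolding convolution_def delta_def by (intro sum.cong) auto
  then show "convolution n (delta g) a x = left_translation g a x"
    using assms by (simp add: finite_perms left_translation_def)
qed

lemma convolution_delta: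
  assumes "g permutes {1..n}" "a \<in> group_algebra n"
  shows "convolution n a (delta g) = (\<lambda>x. a (x \<circ> inv g))"
proof
  fix x
  show "convolution n a (delta g) x = a (x \<circ> inv g)"
  proof (cases "x permutes {1..n}")
    case True
    have "convolution n a (delta g) x = (\<Sum>h\<in>perms n. if h = g then a (x \<circ> inv g) else 0)"
      unfolding convolution_alt[OF True] delta_def by (intro sum.cong) auto
    then show ?thesis
      using assms by (simp add: finite_perms)
  next
    case False
    then have "\<not> x \<circ> inv g permutes {1..n}"
      using assms(1) by (simp add: perms_comp_iff permutes_inv)
    then show ?thesis
      using assms False convolution_in[OF delta_in[OF assms(1)], of a]
      by (simp add: group_algebra_def)
  qed
qed

lemma delta_delta:
  assumes "g permutes {1..n}" "h permutes {1..n}"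
  shows "convolution n (delta g) (delta h) = delta (g \<circ> h)"
proof
  fix x
  have "inv g \<circ> x = h \<longleftrightarrow> x = g \<circ> h"
    using perm_cancel(1,2)[OF assms(1)] by metis
  then show "convolution n (delta g) (delta h) x = delta (g \<circ> h) x"
    unfolding delta_convolution[OF assms(1)] by (simp add: left_translation_def delta_def)
qed

lemma convolution_delta_id:
  assumes "a \<in> group_algebra n"
  shows "convolution n a (delta id) = a" "convolution n (delta id) a = a"
  using assms by (simp_all add: convolution_delta delta_convolution permutes_id left_translation_def)

lemma delta_expansion:
  assumes "a \<in> group_algebra n"
  shows "a = (\<lambda>x. \<Sum>g\<in>perms n. a g * delta g x)"
proof
  fix x
  have "(\<Sum>g\<in>perms n. a g * delta g x) = (\<Sum>g\<in>perms n. if g = x then a x else 0)"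
    unfolding delta_def by (intro sum.cong) auto
  then show "a x = (\<Sum>g\<in>perms n. a g * delta g x)"
    using assms by (auto simp: finite_perms group_algebra_def)
qed

text \<open>Bilinearity reduces claims about products with an arbitrary middle factor to the case of
  a single permutation, where the combinatorics of tableaux applies.\<close>

lemma convolution_expand_middle:
  assumes "y \<in> group_algebra n"
  shows "convolution n a (convolution n y b) =
    (\<lambda>x. \<Sum>g\<in>perms n. y g * convolution n a (convolution n (delta g) b) x)"
  by (subst delta_expansion[OF assms])
    (simp only: convolution_sum_left convolution_sum_right convolution_scale_left convolution_scale_right)

section \<open>The involution of the group algebra and positivity at the identity\<close>

lemma star_in: "star n a \<in> group_algebra n"
  by (simp add: star_def group_algebra_def)

lemma star_star: "a \<in> group_algebra n \<Longrightarrow> star n (star n a) = a"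
  by (auto simp: star_def group_algebra_def fun_eq_iff permutes_inv perm_cancel)

lemma star_convolution:
  "star n (convolution n a b) = convolution n (star n b) (star n a)"
proof
  fix g
  show "star n (convolution n a b) g = convolution n (star n b) (star n a) g"
  proof (cases "g permutes {1..n}")
    case True
    have "convolution n (star n b) (star n a) g =
        (\<Sum>h\<in>perms n. cnj (b (inv h)) * cnj (a (inv (inv h \<circ> g))))"
      unfolding convolution_def star_def
      by (intro sum.cong) (auto simp: True perms_comp_iff permutes_inv)
    also have "\<dots> = (\<Sum>h\<in>perms n. cnj (b (inv (g \<circ> h))) * cnj (a (inv (inv (g \<circ> h) \<circ> g))))"
      by (rule sum_perms_left[OF True, symmetric])
    also have "\<dots> = (\<Sum>h\<in>perms n. cnj (a h * b (inv h \<circ> inv g)))"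
      by (intro sum.cong)
        (auto simp: inv_comp_perm[OF True] perm_cancel permutes_inv_o[OF True] o_assoc[symmetric])
    also have "\<dots> = star n (convolution n a b) g"
      using True by (simp add: star_def convolution_def)
    finally show ?thesis ..
  next
    case False
    then have "convolution n (star n b) (star n a) g = 0"
      using convolution_in[OF star_in] by (simp add: group_algebra_def)
    then show ?thesis
      using False by (simp add: star_def)
  qed
qed

lemma convolution_star_id:
  "convolution n a (star n a) id = complex_of_real (\<Sum>h\<in>perms n. (cmod (a h))\<^sup>2)"
  unfolding convolution_def of_real_sum
  by (intro sum.cong) (auto simp: star_def permutes_inv perm_cancel complex_norm_square[symmetric])

lemma convolution_star_pos:
  assumes "h permutes {1..n}" "a h \<noteq> 0"
  shows "Re (convolution n a (star n a) id) > 0"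
proof -
  have "(\<Sum>h\<in>perms n. (cmod (a h))\<^sup>2) > 0"
    using assms by (intro sum_pos2[of _ h]) (auto simp: finite_perms)
  then show ?thesis
    by (simp add: convolution_star_id)
qed

section \<open>Young diagrams and tableaux\<close>

lemma boxes_iff: "(i, j) \<in> boxes la \<longleftrightarrow> 1 \<le> i \<and> i \<le> length la \<and> 1 \<le> j \<and> j \<le> la ! (i - 1)"
  by (simp add: boxes_def)

lemma boxes_Sigma: "boxes la = Sigma {1..length la} (\<lambda>i. {1..la ! (i - 1)})"
  by (auto simp: boxes_def)

lemma finite_boxes [simp]: "finite (boxes la)"
  by (simp add: boxes_Sigma)

lemma card_boxes: "card (boxes la) = sum_list la"
proof -
  have "card (boxes la) = (\<Sum>i\<in>{1..length la}. la ! (i - 1))"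
    by (simp add: boxes_Sigma)
  also have "\<dots> = (\<Sum>i<length la. la ! i)"
    using sum.atLeast1_atMost_eq[of "\<lambda>i. la ! (i - 1)" "length la"] by (simp add: One_nat_def)
  finally show ?thesis
    by (simp add: sum_list_sum_nth lessThan_atLeast0)
qed

lemma sum_list_take_mono:
  fixes la :: "nat list"
  assumes "i \<le> i'"
  shows "sum_list (take i la) \<le> sum_list (take i' la)"
proof -
  have "take i' la = take i la @ take (i' - i) (drop i la)"
    using assms by (metis le_add_diff_inverse take_add)
  then show ?thesis by simp
qed

lemma tableau_le:
  assumes "(i, j) \<in> boxes la"
  shows "tableau la i j \<le> sum_list (take i la)"
proof -
  obtain k where k: "i = Suc k" "k < length la" "j \<le> la ! k"
    using assms by (cases i) (auto simp: boxes_iff)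
  then show ?thesis
    by (simp add: tableau_def take_Suc_conv_app_nth)
qed

lemma inj_on_tableau: "inj_on (\<lambda>(i, j). tableau la i j) (boxes la)"
proof -
  \<comment> \<open>In reading order every entry of an earlier row is smaller, so equal entries lie
    in the same row.\<close>
  have less: "tableau la i j < tableau la i' j'"
    if "(i, j) \<in> boxes la" "(i', j') \<in> boxes la" "i < i'" for i j i' j'
  proof -
    have "tableau la i j \<le> sum_list (take i la)"
      using that(1) by (rule tableau_le)
    also have "\<dots> \<le> sum_list (take (i' - 1) la)"
      using that(3) by (intro sum_list_take_mono) simp
    also have "\<dots> < tableau la i' j'"
      using that(2) by (simp add: tableau_def boxes_iff)
    finally show ?thesis .
  qed
  have "i = i' \<and> j = j'"
    if "(i, j) \<in> boxes la" "(i', j') \<in> boxes la" "tableau la i j = tableau la i' j'" for i j i' j'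
    using less[OF that(1,2)] less[OF that(2,1)] that(3)
    by (cases i i' rule: linorder_cases) (auto simp: tableau_def)
  then show ?thesis
    by (auto simp: inj_on_def)
qed

lemma bij_tableau: "bij_betw (\<lambda>(i, j). tableau la i j) (boxes la) {1..sum_list la}"
  unfolding bij_betw_def
proof
  show "inj_on (\<lambda>(i, j). tableau la i j) (boxes la)"
    by (rule inj_on_tableau)
  \<comment> \<open>Taking \<open>max i (length la)\<close> rows meets the premise of monotonicity
    trivially and still returns the whole list.\<close>
  have "tableau la i j \<in> {1..sum_list la}" if "(i, j) \<in> boxes la" for i j
    using tableau_le[OF that] sum_list_take_mono[of i "max i (length la)" la] that
    by (auto simp: tableau_def boxes_iff)
  then show "(\<lambda>(i, j). tableau la i j) ` boxes la = {1..sum_list la}"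
    by (intro card_subset_eq) (auto simp: card_image[OF inj_on_tableau] card_boxes)
qed

section \<open>The position of an entry, and row and column groups as stabilizers\<close>

definition box_of :: "nat list \<Rightarrow> nat \<Rightarrow> nat \<times> nat" where
  "box_of la = inv_into (boxes la) (\<lambda>(i, j). tableau la i j)"

definition row_of :: "nat list \<Rightarrow> nat \<Rightarrow> nat" where
  "row_of la x = fst (box_of la x)"

definition col_of :: "nat list \<Rightarrow> nat \<Rightarrow> nat" where
  "col_of la x = snd (box_of la x)"

lemma bij_box_of: "bij_betw (box_of la) {1..sum_list la} (boxes la)"
  unfolding box_of_def by (rule bij_betw_inv_into[OF bij_tableau])

lemma row_col_in_boxes:
  "x \<in> {1..sum_list la} \<Longrightarrow> (row_of la x, col_of la x) \<in> boxes la"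
  using bij_betwE[OF bij_box_of] by (simp add: row_of_def col_of_def)

lemma tableau_row_col:
  "x \<in> {1..sum_list la} \<Longrightarrow> tableau la (row_of la x) (col_of la x) = x"
  using bij_betw_inv_into_right[OF bij_tableau, of x la]
  by (simp add: row_of_def col_of_def box_of_def case_prod_beta)

lemma row_col_tableau:
  assumes "(i, j) \<in> boxes la"
  shows "tableau la i j \<in> {1..sum_list la}" "row_of la (tableau la i j) = i" "col_of la (tableau la i j) = j"
  using bij_betw_inv_into_left[OF bij_tableau assms] bij_betwE[OF bij_tableau] assms
  by (force simp: row_of_def col_of_def box_of_def)+

text \<open>Row and column groups both have this form, with the row or the column of an entry as its
  colour. The group laws, and membership of transpositions of equally coloured points, are thus
  proved once for both.\<close>

definition colour_stabilizer :: "nat \<Rightarrow> (nat \<Rightarrow> 'a) \<Rightarrow> (nat \<Rightarrow> nat) set" where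
  "colour_stabilizer n f = {p. p permutes {1..n} \<and> (\<forall>x\<in>{1..n}. f (p x) = f x)}"

lemma row_group_stabilizer: "row_group la = colour_stabilizer (sum_list la) (row_of la)"
proof -
  have "(\<forall>(i, j)\<in>boxes la. \<exists>j'. (i, j') \<in> boxes la \<and> p (tableau la i j) = tableau la i j') \<longleftrightarrow>
    (\<forall>x\<in>{1..sum_list la}. row_of la (p x) = row_of la x)" (is "?A = ?B")
    if p: "p permutes {1..sum_list la}" for p
  proof
    assume ?A
    show ?B
    proof
      fix x assume x: "x \<in> {1..sum_list la}"
      then obtain j' where "(row_of la x, j') \<in> boxes la" "p x = tableau la (row_of la x) j'"
        using \<open>?A\<close> row_col_in_boxes[OF x] tableau_row_col[OF x] by fastforce
      then show "row_of la (p x) = row_of la x"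
        by (simp add: row_col_tableau)
    qed
  next
    assume B: ?B
    have "\<exists>j'. (i, j') \<in> boxes la \<and> p (tableau la i j) = tableau la i j'" if ij: "(i, j) \<in> boxes la" for i j
    proof -
      let ?x = "tableau la i j"
      have px: "p ?x \<in> {1..sum_list la}"
        using permutes_in_image[OF p] row_col_tableau(1)[OF ij] by blast
      have "row_of la (p ?x) = i"
        using B row_col_tableau[OF ij] by simp
      then show ?thesis
        using row_col_in_boxes[OF px] tableau_row_col[OF px] by metis
    qed
    then show ?A by blast
  qed
  then show ?thesis
    unfolding row_group_def colour_stabilizer_def by blast
qed

lemma column_group_stabilizer: "column_group la = colour_stabilizer (sum_list la) (col_of la)"
proof -
  have "(\<forall>(i, j)\<in>boxes la. \<exists>i'. (i', j) \<in> boxes la \<and> p (tableau la i j) = tableau la i' j) \<longleftrightarrow>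
    (\<forall>x\<in>{1..sum_list la}. col_of la (p x) = col_of la x)" (is "?A = ?B")
    if p: "p permutes {1..sum_list la}" for p
  proof
    assume ?A
    show ?B
    proof
      fix x assume x: "x \<in> {1..sum_list la}"
      then obtain i' where "(i', col_of la x) \<in> boxes la" "p x = tableau la i' (col_of la x)"
        using \<open>?A\<close> row_col_in_boxes[OF x] tableau_row_col[OF x] by fastforce
      then show "col_of la (p x) = col_of la x"
        by (simp add: row_col_tableau)
    qed
  next
    assume B: ?B
    have "\<exists>i'. (i', j) \<in> boxes la \<and> p (tableau la i j) = tableau la i' j" if ij: "(i, j) \<in> boxes la" for i j
    proof -
      let ?x = "tableau la i j"
      have px: "p ?x \<in> {1..sum_list la}"
        using permutes_in_image[OF p] row_col_tableau(1)[OF ij] by blast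
      have "col_of la (p ?x) = j"
        using B row_col_tableau[OF ij] by simp
      then show ?thesis
        using row_col_in_boxes[OF px] tableau_row_col[OF px] by metis
    qed
    then show ?A by blast
  qed
  then show ?thesis
    unfolding column_group_def colour_stabilizer_def by blast
qed

lemma stabilizer_perm: "p \<in> colour_stabilizer n f \<Longrightarrow> p permutes {1..n}"
  by (simp add: colour_stabilizer_def)

lemma stabilizer_id: "id \<in> colour_stabilizer n f"
  by (simp add: colour_stabilizer_def permutes_id)

lemma stabilizer_comp:
  assumes "p \<in> colour_stabilizer n f" "q \<in> colour_stabilizer n f"
  shows "p \<circ> q \<in> colour_stabilizer n f"
  using assms permutes_in_image[OF stabilizer_perm[OF assms(2)]]
  by (auto simp: colour_stabilizer_def permutes_compose)

lemma stabilizer_inv: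
  assumes "p \<in> colour_stabilizer n f"
  shows "inv p \<in> colour_stabilizer n f"
proof -
  have p: "p permutes {1..n}"
    using assms by (rule stabilizer_perm)
  have "f (inv p x) = f x" if "x \<in> {1..n}" for x
  proof -
    have "inv p x \<in> {1..n}"
      using permutes_in_image[OF permutes_inv[OF p]] that by blast
    then have "f (p (inv p x)) = f (inv p x)"
      using assms by (simp add: colour_stabilizer_def)
    then show ?thesis
      by (simp add: permutes_inverses[OF p])
  qed
  then show ?thesis
    using p by (simp add: colour_stabilizer_def permutes_inv)
qed

lemma stabilizer_transpose:
  assumes "x \<in> {1..n}" "y \<in> {1..n}" "f x = f y"
  shows "transpose x y \<in> colour_stabilizer n f"
  using assms by (auto simp: colour_stabilizer_def permutes_swap_id transpose_def)

lemma row_column_group_id: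
  assumes "p \<in> row_group la" "p \<in> column_group la"
  shows "p = id"
proof
  fix x
  have p: "p permutes {1..sum_list la}"
    using assms(1) by (simp add: row_group_stabilizer stabilizer_perm)
  show "p x = id x"
  proof (cases "x \<in> {1..sum_list la}")
    case True
    then have "p x \<in> {1..sum_list la}"
      using permutes_in_image[OF p] by blast
    moreover have "row_of la (p x) = row_of la x" "col_of la (p x) = col_of la x"
      using assms True by (simp_all add: row_group_stabilizer column_group_stabilizer colour_stabilizer_def)
    ultimately show ?thesis
      using tableau_row_col True by (metis id_apply)
  qed (use permutes_not_in[OF p] in auto)
qed

text \<open>Extended by zero outside the list, so that membership of a box and the partial sums of
  rows can be stated without bounds on the row index.\<close>

definition row_length :: "nat list \<Rightarrow> nat \<Rightarrow> nat" where
  "row_length la i = (if 1 \<le> i \<and> i \<le> length la then la ! (i - 1) else 0)"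

lemma boxes_row_length: "(i, j) \<in> boxes la \<longleftrightarrow> 1 \<le> j \<and> j \<le> row_length la i"
  by (auto simp: boxes_iff row_length_def)

text \<open>Diagrams have no zero parts, so the length of the list can be recovered from the rows of
  positive length.\<close>

lemma row_length_eqD:
  assumes "la \<in> young_diagrams n" "mu \<in> young_diagrams m" "\<And>i. row_length la i = row_length mu i"
  shows "la = mu"
proof -
  have pos: "i \<le> length la \<longleftrightarrow> row_length la i > 0" if "la \<in> young_diagrams n" "i \<ge> 1" for la n i
  proof -
    have "i \<le> length la \<longrightarrow> la ! (i - 1) \<in> set la"
      using that(2) by (auto intro!: nth_mem)
    then have "i \<le> length la \<longrightarrow> la ! (i - 1) \<noteq> 0"
      using that(1) by (auto simp: young_diagrams_def intro!: gr0I)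
    then show ?thesis
      using that(2) by (simp add: row_length_def)
  qed
  have le: "length la \<le> length mu"
    if "la \<in> young_diagrams n" "mu \<in> young_diagrams m" "\<And>i. row_length la i = row_length mu i" for la mu n m
  proof (cases "length la = 0")
    case False
    then show ?thesis
      using pos[OF that(1), of "length la"] pos[OF that(2), of "length la"] that(3)[of "length la"]
      by linarith
  qed simp
  have len: "length la = length mu"
    using assms by (intro antisym le) auto
  show ?thesis
  proof (rule nth_equalityI[OF len])
    fix i assume "i < length la"
    then show "la ! i = mu ! i"
      using assms(3)[of "Suc i"] len by (simp add: row_length_def)
  qed
qed

lemma boxes_eqD:
  assumes "la \<in> young_diagrams n" "mu \<in> young_diagrams m" "boxes la = boxes mu"
  shows "la = mu"
proof (rule row_length_eqD[OF assms(1,2)])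
  fix i
  have "{j. (i, j) \<in> boxes la} = {1..row_length la i}" for la
    by (auto simp: boxes_row_length)
  then show "row_length la i = row_length mu i"
    using assms(3) by (metis card_atLeastAtMost diff_Suc_1 One_nat_def)
qed

lemma boxes_up:
  assumes "la \<in> young_diagrams n" "(i, j) \<in> boxes la" "1 \<le> i'" "i' \<le> i"
  shows "(i', j) \<in> boxes la"
proof -
  have "la ! (i - 1) \<le> la ! (i' - 1)"
  proof (cases "i' = i")
    case False
    then have "i' - 1 < i - 1" "i - 1 < length la"
      using assms by (auto simp: boxes_iff)
    then show ?thesis
      using assms(1) sorted_wrt_nth_less[of "(\<ge>)" la "i' - 1" "i - 1"] by (simp add: young_diagrams_def)
  qed simp
  then show ?thesis
    using assms by (simp add: boxes_iff)
qed

definition col_length :: "nat list \<Rightarrow> nat \<Rightarrow> nat" where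
  "col_length la j = card {i. (i, j) \<in> boxes la}"

lemma down_closed_eq_atLeastAtMost:
  assumes "finite A" "\<And>i i'. i \<in> A \<Longrightarrow> 1 \<le> i' \<Longrightarrow> i' \<le> i \<Longrightarrow> i' \<in> A" "0 \<notin> A"
  shows "A = {1..card A}"
proof (cases "A = {}")
  case False
  have "A = {1..Max A}"
    using assms(2)[OF Max_in[OF assms(1) False]] Max_ge[OF assms(1)] assms(3)
    by (auto simp: Suc_le_eq intro!: gr0I) (metis not_gr_zero One_nat_def Suc_leI)
  then show ?thesis
    by (metis card_atLeastAtMost diff_Suc_1 One_nat_def)
qed simp

lemma column_eq:
  assumes "la \<in> young_diagrams n"
  shows "{i. (i, j) \<in> boxes la} = {1..col_length la j}"
  unfolding col_length_def
proof (rule down_closed_eq_atLeastAtMost)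
  have "{i. (i, j) \<in> boxes la} \<subseteq> {1..length la}"
    by (auto simp: boxes_iff)
  then show "finite {i. (i, j) \<in> boxes la}"
    by (rule finite_subset) simp
qed (use boxes_up[OF assms] in \<open>auto simp: boxes_iff[of 0]\<close>)

section \<open>Dominance and straightening\<close>

definition column_count :: "(nat \<times> nat) set \<Rightarrow> nat \<Rightarrow> nat \<Rightarrow> nat" where
  "column_count X i j = card {a. (a, j) \<in> X \<and> a \<le> i}"

lemma column_count_Suc:
  "column_count X (Suc i) j = column_count X i j + (if (Suc i, j) \<in> X then 1 else 0)"
proof -
  have "{a. (a, j) \<in> X \<and> a \<le> Suc i} =
      (if (Suc i, j) \<in> X then insert (Suc i) {a. (a, j) \<in> X \<and> a \<le> i} else {a. (a, j) \<in> X \<and> a \<le> i})"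
    by (auto simp: le_Suc_eq)
  then show ?thesis
    by (simp add: column_count_def)
qed

lemma card_rows_le:
  fixes X :: "(nat \<times> nat) set"
  assumes "finite X" "finite J" "snd ` X \<subseteq> J"
  shows "card {(a, j). (a, j) \<in> X \<and> a \<le> i} = (\<Sum>j\<in>J. column_count X i j)"
proof -
  have "bij_betw prod.swap (Sigma J (\<lambda>j. {a. (a, j) \<in> X \<and> a \<le> i})) {(a, j). (a, j) \<in> X \<and> a \<le> i}"
    using assms(3) by (intro bij_betw_byWitness[where f' = prod.swap]) force+
  then have "card {(a, j). (a, j) \<in> X \<and> a \<le> i} = card (Sigma J (\<lambda>j. {a. (a, j) \<in> X \<and> a \<le> i}))"
    by (simp add: bij_betw_same_card)
  also have "\<dots> = (\<Sum>j\<in>J. column_count X i j)"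
    using assms(2) by (simp add: column_count_def)
  finally show ?thesis .
qed

text \<open>\<open>D\<close> arises from \<open>X\<close> by pushing the entries of each column to the top.\<close>

lemma
  fixes D X :: "(nat \<times> nat) set" and h :: "nat \<Rightarrow> nat"
  assumes fin: "finite D" "finite X"
    and D: "\<And>j. {i. (i, j) \<in> D} = {1..h j}"
    and X: "\<And>j. card {i. (i, j) \<in> X} = h j" "\<And>i j. (i, j) \<in> X \<Longrightarrow> 1 \<le> i"
  shows push_up_le: "card {(a, j). (a, j) \<in> X \<and> a \<le> i} \<le> card {(a, j). (a, j) \<in> D \<and> a \<le> i}"
    and push_up_eq: "(\<And>i. card {(a, j). (a, j) \<in> X \<and> a \<le> i} = card {(a, j). (a, j) \<in> D \<and> a \<le> i}) \<Longrightarrow> X = D"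
proof -
  define J where "J = snd ` D \<union> snd ` X"
  have J: "finite J" "snd ` D \<subseteq> J" "snd ` X \<subseteq> J"
    using fin by (auto simp: J_def)
  \<comment> \<open>A column of \<open>X\<close> has \<open>h j\<close> entries in all, and at most
    \<open>i\<close> of them fit into the rows up to \<open>i\<close>; \<open>D\<close> attains the
    minimum of the two numbers.\<close>
  have le: "column_count X i j \<le> column_count D i j" for i j
  proof -
    have "finite {i. (i, j) \<in> X}"
      using finite_vimageI[OF fin(2), of "\<lambda>i. (i, j)"] by (simp add: vimage_def inj_on_def)
    then have "column_count X i j \<le> h j"
      unfolding column_count_def X(1)[symmetric] by (intro card_mono) auto
    moreover have "column_count X i j \<le> card {1..i}"
      unfolding column_count_def using X(2) by (intro card_mono) auto
    moreover have "{a. (a, j) \<in> D \<and> a \<le> i} = {1..min i (h j)}"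
      using D[of j] by (simp add: set_eq_iff) blast
    then have "column_count D i j = min i (h j)"
      by (simp add: column_count_def)
    ultimately show ?thesis
      by simp
  qed
  show "card {(a, j). (a, j) \<in> X \<and> a \<le> i} \<le> card {(a, j). (a, j) \<in> D \<and> a \<le> i}"
    unfolding card_rows_le[OF fin(2) J(1,3)] card_rows_le[OF fin(1) J(1,2)] by (intro sum_mono le)
  assume eq: "\<And>i. card {(a, j). (a, j) \<in> X \<and> a \<le> i} = card {(a, j). (a, j) \<in> D \<and> a \<le> i}"
  \<comment> \<open>Termwise inequalities with equal sums are equalities. Consecutive values of
    \<open>i\<close> then tell which boxes belong to the set.\<close>
  have cc: "column_count X i j = column_count D i j" if "j \<in> J" for i j
    using sum_mono_inv[OF eq[unfolded card_rows_le[OF fin(2) J(1,3)] card_rows_le[OF fin(1) J(1,2)]]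
        le that J(1)] .
  have "(i, j) \<in> X \<longleftrightarrow> (i, j) \<in> D" for i j
  proof (cases "j \<in> J \<and> i \<ge> 1")
    case True
    then obtain i' where i': "i = Suc i'"
      by (cases i) auto
    then show ?thesis
      using cc[of j i] cc[of j i'] True by (auto simp: column_count_Suc split: if_splits)
  next
    case False
    have "(i, j) \<in> D \<Longrightarrow> i \<ge> 1"
      using D[of j] by auto
    then show ?thesis
      using False X(2)[of i j] J(2,3) by force
  qed
  then show "X = D" by auto
qed

text \<open>The sum of the first \<open>i\<close> rows, so that comparison for all \<open>i\<close>
  is the dominance order. The form as a cardinality is the one in which pushing up columns compares
  two sets of boxes.\<close>

definition dominance_sum :: "nat list \<Rightarrow> nat \<Rightarrow> nat" where
  "dominance_sum la i = card {(a, j). (a, j) \<in> boxes la \<and> a \<le> i}"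

lemma dominance_sum_Suc: "dominance_sum la (Suc i) = dominance_sum la i + row_length la (Suc i)"
proof -
  have "{(a, j). (a, j) \<in> boxes la \<and> a \<le> Suc i} =
      {(a, j). (a, j) \<in> boxes la \<and> a \<le> i} \<union> (\<lambda>j. (Suc i, j)) ` {1..row_length la (Suc i)}"
    by (auto simp: le_Suc_eq boxes_row_length)
  moreover have "finite {(a, j). (a, j) \<in> boxes la \<and> a \<le> i}"
    by (rule finite_subset[OF _ finite_boxes[of la]]) auto
  ultimately have "dominance_sum la (Suc i) =
      dominance_sum la i + card ((\<lambda>j. (Suc i, j)) ` {1..row_length la (Suc i)})"
    unfolding dominance_sum_def by (simp only:) (subst card_Un_disjoint; auto)
  then show ?thesis
    by (simp add: card_image inj_on_def)
qed

lemma dominance_sum_eqD: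
  assumes "la \<in> young_diagrams n" "mu \<in> young_diagrams m" "\<And>i. dominance_sum la i = dominance_sum mu i"
  shows "la = mu"
proof (rule row_length_eqD[OF assms(1,2)])
  fix i
  show "row_length la i = row_length mu i"
    using dominance_sum_Suc[of la "i - 1"] dominance_sum_Suc[of mu "i - 1"] assms(3)
    by (cases i) (auto simp: row_length_def)
qed

lemma bij_row_col: "bij_betw (\<lambda>x. (row_of la x, col_of la x)) {1..sum_list la} (boxes la)"
  using bij_box_of[of la] by (simp add: row_of_def col_of_def)

section \<open>Rows of one tableau against columns of a translate of another\<close>

context
  fixes n la mu g
  assumes la: "la \<in> young_diagrams n" and mu: "mu \<in> young_diagrams n" and g: "g permutes {1..n}"
    and inj: "inj_on (\<lambda>x. (row_of la x, col_of mu (inv g x))) {1..n}"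
begin

text \<open>The row of \<open>x\<close> is taken in the tableau of \<open>la\<close>, its column in
  the tableau of \<open>mu\<close> with every entry \<open>y\<close> replaced by \<open>g y\<close>.
  Injectivity says that no two entries share both a row of the former and a column of the
  latter.\<close>

private abbreviation (input) mixed :: "nat \<Rightarrow> nat \<times> nat" where
  "mixed x \<equiv> (row_of la x, col_of mu (inv g x))"

private lemma mixed_size: "sum_list la = n" "sum_list mu = n"
  using la mu by (auto simp: young_diagrams_def)

private lemma mixed_col: "card {i. (i, j) \<in> mixed ` {1..n}} = card {i. (i, j) \<in> boxes mu}"
proof -
  have "bij_betw (row_of la) {x\<in>{1..n}. col_of mu (inv g x) = j} {i. (i, j) \<in> mixed ` {1..n}}"
  proof (rule bij_betw_imageI)
    show "inj_on (row_of la) {x\<in>{1..n}. col_of mu (inv g x) = j}"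
    proof (rule inj_onI)
      fix x y
      assume "x \<in> {x\<in>{1..n}. col_of mu (inv g x) = j}" "y \<in> {x\<in>{1..n}. col_of mu (inv g x) = j}"
        "row_of la x = row_of la y"
      then show "x = y"
        using inj_onD[OF inj, of x y] by simp
    qed
  qed blast
  moreover have "bij_betw (inv g) {x\<in>{1..n}. col_of mu (inv g x) = j} {x\<in>{1..n}. col_of mu x = j}"
    using permutes_in_image[OF permutes_inv[OF g]] permutes_in_image[OF g]
    by (intro bij_betw_byWitness[where f' = g]) (auto simp: permutes_inverses[OF g])
  moreover have "bij_betw (row_of mu) {x\<in>{1..n}. col_of mu x = j} {i. (i, j) \<in> boxes mu}"
  proof (rule bij_betw_imageI)
    show "inj_on (row_of mu) {x\<in>{1..n}. col_of mu x = j}"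
    proof (rule inj_onI)
      fix x y
      assume "x \<in> {x\<in>{1..n}. col_of mu x = j}" "y \<in> {x\<in>{1..n}. col_of mu x = j}"
        "row_of mu x = row_of mu y"
      then show "x = y"
        using inj_onD[OF bij_betw_imp_inj_on[OF bij_row_col[of mu]], of x y] by (simp add: mixed_size)
    qed
    show "row_of mu ` {x\<in>{1..n}. col_of mu x = j} = {i. (i, j) \<in> boxes mu}"
      unfolding bij_betw_imp_surj_on[OF bij_row_col[of mu], symmetric] mixed_size by blast
  qed
  ultimately show ?thesis
    by (auto dest!: bij_betw_same_card)
qed

private lemma mixed_row: "card {(a, j). (a, j) \<in> mixed ` {1..n} \<and> a \<le> i} = dominance_sum la i"
proof -
  have "bij_betw mixed {x\<in>{1..n}. row_of la x \<le> i} {(a, j). (a, j) \<in> mixed ` {1..n} \<and> a \<le> i}"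
    by (rule bij_betw_imageI[OF inj_on_subset[OF inj]]) blast+
  moreover have "bij_betw (\<lambda>x. (row_of la x, col_of la x)) {x\<in>{1..n}. row_of la x \<le> i}
      {(a, j). (a, j) \<in> boxes la \<and> a \<le> i}"
  proof (rule bij_betw_imageI)
    show "inj_on (\<lambda>x. (row_of la x, col_of la x)) {x\<in>{1..n}. row_of la x \<le> i}"
      by (rule inj_on_subset[OF bij_betw_imp_inj_on[OF bij_row_col[of la]]]) (use mixed_size in auto)
    show "(\<lambda>x. (row_of la x, col_of la x)) ` {x\<in>{1..n}. row_of la x \<le> i} =
        {(a, j). (a, j) \<in> boxes la \<and> a \<le> i}"
      unfolding bij_betw_imp_surj_on[OF bij_row_col[of la], symmetric] mixed_size by blast
  qed
  ultimately show ?thesis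
    unfolding dominance_sum_def by (auto dest!: bij_betw_same_card)
qed

private lemma mixed_row_pos: "(i, j) \<in> mixed ` {1..n} \<Longrightarrow> 1 \<le> i"
  using row_col_in_boxes[of _ la] unfolding mixed_size by (auto simp: boxes_iff)

text \<open>The image of \<open>mixed\<close> has as many entries in the first rows as
  \<open>la\<close>, and columns of the same lengths as \<open>mu\<close>. Pushing its columns to
  the top gives \<open>boxes mu\<close> and can only increase the counts in the first rows.\<close>

lemma dominance_if_mixed_inj: "dominance_sum la i \<le> dominance_sum mu i"
  unfolding mixed_row[symmetric] unfolding dominance_sum_def
proof (rule push_up_le[where h = "col_length mu"])
  show "{i. (i, j) \<in> boxes mu} = {1..col_length mu j}" for j
    by (rule column_eq[OF mu])
  show "card {i. (i, j) \<in> mixed ` {1..n}} = col_length mu j" for j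
    using mixed_col[of j] by (simp only: col_length_def)
  show "1 \<le> i" if "(i, j) \<in> mixed ` {1..n}" for i j
    using that by (rule mixed_row_pos)
qed simp_all

text \<open>For equal shapes the row counts agree before and after pushing up, so nothing moves and
  the image is the diagram itself. Sending each \<open>x\<close> within its row to the column that
  it has in the translated tableau defines \<open>p\<close> in the row group;
  \<open>p \<circ> g\<close> preserves columns, and
  \<open>g = inv p \<circ> (p \<circ> g)\<close>.\<close>

lemma factorization_if_mixed_inj:
  assumes "la = mu"
  shows "\<exists>p\<in>row_group la. \<exists>q\<in>column_group la. g = p \<circ> q"
proof -
  have eq: "mixed ` {1..n} = boxes la"
  proof (rule push_up_eq[where h = "col_length la"])
    show "{i. (i, j) \<in> boxes la} = {1..col_length la j}" for j
      by (rule column_eq[OF la])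
    show "card {i. (i, j) \<in> mixed ` {1..n}} = col_length la j" for j
      using mixed_col[of j] by (simp only: col_length_def assms)
    show "card {(a, j). (a, j) \<in> mixed ` {1..n} \<and> a \<le> i} =
        card {(a, j). (a, j) \<in> boxes la \<and> a \<le> i}" for i
      using mixed_row[of i] by (simp only: dominance_sum_def)
    show "1 \<le> i" if "(i, j) \<in> mixed ` {1..n}" for i j
      using that by (rule mixed_row_pos)
  qed simp_all
  define p where "p x = (if x \<in> {1..n} then tableau la (row_of la x) (col_of la (inv g x)) else x)" for x
  have box: "(row_of la x, col_of la (inv g x)) \<in> boxes la" if "x \<in> {1..n}" for x
    using imageI[OF that, of mixed] unfolding eq by (simp add: assms)
  have p_props: "p x \<in> {1..n}" "row_of la (p x) = row_of la x" "col_of la (p x) = col_of la (inv g x)"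
    if "x \<in> {1..n}" for x
    using row_col_tableau[OF box[OF that]] that by (simp_all add: p_def mixed_size)
  have "inj_on p {1..n}"
  proof (rule inj_onI)
    fix x y assume "x \<in> {1..n}" "y \<in> {1..n}" "p x = p y"
    then show "x = y"
      using p_props[of x] p_props[of y] inj_onD[OF inj, of x y] by (simp add: assms)
  qed
  moreover have "p ` {1..n} \<subseteq> {1..n}"
    using p_props by auto
  ultimately have "bij_betw p {1..n} {1..n}"
    by (simp add: bij_betw_def endo_inj_surj)
  then have p: "p permutes {1..n}"
    by (rule bij_imp_permutes) (auto simp: p_def)
  have p_row: "p \<in> row_group la"
    using p p_props by (simp add: row_group_stabilizer colour_stabilizer_def mixed_size)
  have "col_of la (p (g x)) = col_of la x" if "x \<in> {1..n}" for x
    using p_props(3)[of "g x"] permutes_in_image[OF g] that by (simp add: permutes_inverses[OF g])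
  then have "p \<circ> g \<in> column_group la"
    using p g by (simp add: column_group_stabilizer colour_stabilizer_def mixed_size permutes_compose)
  moreover have "inv p \<in> row_group la"
    using p_row by (simp add: row_group_stabilizer stabilizer_inv)
  moreover have "g = inv p \<circ> (p \<circ> g)"
    by (simp add: perm_cancel[OF p])
  ultimately show ?thesis by blast
qed

end

text \<open>\<open>t\<close> is the transposition of two entries with the same mixed coordinates.\<close>

lemma transposition_if_mixed_not_inj:
  assumes "la \<in> young_diagrams n" "mu \<in> young_diagrams n" and g: "g permutes {1..n}"
    and "\<not> inj_on (\<lambda>x. (row_of la x, col_of mu (inv g x))) {1..n}"
  shows "\<exists>t\<in>row_group la. \<exists>s\<in>column_group mu. t \<circ> g = g \<circ> s \<and> sign s = -1"
proof -
  have size: "sum_list la = n" "sum_list mu = n"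
    using assms(1,2) by (auto simp: young_diagrams_def)
  obtain x y where xy: "x \<in> {1..n}" "y \<in> {1..n}" "x \<noteq> y" "row_of la x = row_of la y"
    "col_of mu (inv g x) = col_of mu (inv g y)"
    using assms(4) by (auto simp: inj_on_def)
  let ?t = "transpose x y" and ?s = "transpose (inv g x) (inv g y)"
  have "inv g x \<in> {1..n}" "inv g y \<in> {1..n}"
    using xy permutes_in_image[OF permutes_inv[OF g]] by blast+
  then have "?t \<in> row_group la" "?s \<in> column_group mu"
    using xy by (simp_all add: row_group_stabilizer column_group_stabilizer size stabilizer_transpose)
  moreover have "?t \<circ> g = g \<circ> ?s"
    by (rule transpose_comp_eq[OF permutes_bij[OF g]])
  moreover have "inv g x \<noteq> inv g y"
    using xy(3) permutes_inv_eq[OF g] permutes_inverses[OF g] by metis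
  then have "sign ?s = -1"
    by (simp add: sign_swap_id)
  ultimately show ?thesis by blast
qed

section \<open>Class functions\<close>

definition class_function :: "nat \<Rightarrow> ((nat \<Rightarrow> nat) \<Rightarrow> complex) \<Rightarrow> bool" where
  "class_function n f \<longleftrightarrow> f \<in> group_algebra n \<and>
     (\<forall>x g. x permutes {1..n} \<longrightarrow> f (inv x \<circ> g \<circ> x) = f g)"

text \<open>Up to the factor \<open>fact n\<close> the projection onto the class functions. The sum
  runs over all conjugating elements rather than over the conjugacy class, which keeps substitutions
  in the summation index simple.\<close>

definition class_sum :: "nat \<Rightarrow> ((nat \<Rightarrow> nat) \<Rightarrow> complex) \<Rightarrow> (nat \<Rightarrow> nat) \<Rightarrow> complex" where
  "class_sum n a g = (\<Sum>x\<in>perms n. a (inv x \<circ> g \<circ> x))"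

lemma conj_permutes_iff:
  assumes "x permutes S"
  shows "inv x \<circ> g \<circ> x permutes S \<longleftrightarrow> g permutes S"
  using assms by (simp add: perms_comp_iff permutes_inv)

lemma class_function_conj:
  assumes "class_function n f" "x permutes {1..n}"
  shows "f (inv x \<circ> g \<circ> x) = f g"
  using assms by (auto simp: class_function_def)

lemma class_function_in: "class_function n f \<Longrightarrow> f \<in> group_algebra n"
  by (simp add: class_function_def)

lemma class_function_central:
  assumes f: "class_function n f" and a: "a \<in> group_algebra n"
  shows "convolution n f a = convolution n a f"
proof
  fix g
  show "convolution n f a g = convolution n a f g"
  proof (cases "g permutes {1..n}")
    case True
    have "f (g \<circ> inv h) = f (inv h \<circ> g)" if "h permutes {1..n}" for h
      using class_function_conj[OF f that, of "g \<circ> inv h"] by (simp add: o_assoc perm_cancel[OF that])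
    then show ?thesis
      unfolding convolution_alt[OF True, of f] by (simp add: convolution_def mult.commute)
  next
    case False
    then show ?thesis
      using convolution_in[OF a, of f] convolution_in[OF class_function_in[OF f], of a]
      by (simp add: group_algebra_def)
  qed
qed

lemma class_function_class_sum:
  assumes "a \<in> group_algebra n"
  shows "class_function n (class_sum n a)"
proof -
  have "class_sum n a \<in> group_algebra n"
    using assms by (auto simp: group_algebra_def class_sum_def conj_permutes_iff intro!: sum.neutral)
  moreover have "class_sum n a (inv y \<circ> g \<circ> y) = class_sum n a g" if y: "y permutes {1..n}" for y g
  proof -
    have "class_sum n a (inv y \<circ> g \<circ> y) = (\<Sum>x\<in>perms n. a (inv (y \<circ> x) \<circ> g \<circ> (y \<circ> x)))"
      unfolding class_sum_def by (intro sum.cong) (auto simp: inv_comp_perm[OF y] o_assoc)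
    also have "\<dots> = class_sum n a g"
      unfolding class_sum_def by (rule sum_perms_left[OF y])
    finally show ?thesis .
  qed
  ultimately show ?thesis
    by (simp add: class_function_def)
qed

lemma class_sum_scale: "class_sum n (\<lambda>x. s * a x) = (\<lambda>x. s * class_sum n a x)"
  by (simp add: class_sum_def fun_eq_iff sum_distrib_left)

lemma class_sum_id: "class_sum n a id = fact n * a id"
proof -
  have "class_sum n a id = (\<Sum>x\<in>perms n. a id)"
    unfolding class_sum_def by (intro sum.cong) (auto simp: permutes_inv_o)
  then show ?thesis
    by (simp add: card_permutations[of "{1..n}" n])
qed

text \<open>The trace property: if \<open>a\<close> is a single permutation, then \<open>a b\<close>
  and \<open>b a\<close> are conjugate, and the sum over all conjugates cannot tell them apart. It
  permits exchanging the row and the column factor of a Young symmetrizer.\<close>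

lemma class_sum_commute: "class_sum n (convolution n a b) = class_sum n (convolution n b a)" if "a \<in> group_algebra n" "b \<in> group_algebra n"
proof
  fix g
  show "class_sum n (convolution n a b) g = class_sum n (convolution n b a) g"
  proof (cases "g permutes {1..n}")
    case True
    have "class_sum n (convolution n a b) g =
        (\<Sum>h\<in>perms n. \<Sum>x\<in>perms n. a h * b (inv h \<circ> (inv x \<circ> g \<circ> x)))"
      unfolding class_sum_def convolution_def by (rule sum.swap)
    also have "\<dots> = (\<Sum>h\<in>perms n. \<Sum>x\<in>perms n. b (inv x \<circ> g \<circ> x \<circ> inv h) * a h)"
    proof (rule sum.cong[OF refl])
      fix h assume "h \<in> perms n"
      then have h: "h permutes {1..n}" by simp
      have "(\<Sum>x\<in>perms n. a h * b (inv h \<circ> (inv x \<circ> g \<circ> x))) =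
          (\<Sum>x\<in>perms n. a h * b (inv h \<circ> (inv (x \<circ> inv h) \<circ> g \<circ> (x \<circ> inv h))))"
        by (rule sum_perms_right[OF permutes_inv[OF h], symmetric])
      also have "\<dots> = (\<Sum>x\<in>perms n. b (inv x \<circ> g \<circ> x \<circ> inv h) * a h)"
        by (intro sum.cong)
          (auto simp: inv_comp_perm[OF _ permutes_inv[OF h]] perm_cancel[OF h] o_assoc[symmetric] mult.commute)
      finally show "(\<Sum>x\<in>perms n. a h * b (inv h \<circ> (inv x \<circ> g \<circ> x))) =
          (\<Sum>x\<in>perms n. b (inv x \<circ> g \<circ> x \<circ> inv h) * a h)" .
    qed
    also have "\<dots> = (\<Sum>x\<in>perms n. \<Sum>h\<in>perms n. b (inv x \<circ> g \<circ> x \<circ> inv h) * a h)"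
      by (rule sum.swap)
    also have "\<dots> = class_sum n (convolution n b a) g"
      unfolding class_sum_def
    proof (rule sum.cong[OF refl])
      fix x assume "x \<in> perms n"
      then show "(\<Sum>h\<in>perms n. b (inv x \<circ> g \<circ> x \<circ> inv h) * a h) = convolution n b a (inv x \<circ> g \<circ> x)"
        using convolution_alt[of "inv x \<circ> g \<circ> x" n b a] conj_permutes_iff[of x] True by simp
    qed
    finally show ?thesis .
  next
    case False
    then show ?thesis
      using class_function_class_sum[OF convolution_in[OF that(2)]]
        class_function_class_sum[OF convolution_in[OF that(1)]]
      by (simp add: class_function_def group_algebra_def)
  qed
qed

text \<open>A class function is fixed by conjugation, so it can be pulled out of the sum over
  conjugates.\<close>

lemma class_sum_convolution:
  assumes f: "class_function n f"
  shows "class_sum n (convolution n a f) = convolution n (class_sum n a) f"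
proof
  fix g
  have "convolution n (class_sum n a) f g =
      (\<Sum>x\<in>perms n. \<Sum>h\<in>perms n. a (inv x \<circ> h \<circ> x) * f (inv h \<circ> g))"
    unfolding class_sum_def convolution_def sum_distrib_right by (rule sum.swap)
  also have "\<dots> = (\<Sum>x\<in>perms n. convolution n a f (inv x \<circ> g \<circ> x))"
  proof (rule sum.cong[OF refl])
    fix x assume "x \<in> perms n"
    then have x: "x permutes {1..n}" by simp
    have "(\<Sum>h\<in>perms n. a (inv x \<circ> h \<circ> x) * f (inv h \<circ> g)) =
        (\<Sum>h\<in>perms n. a (inv x \<circ> (x \<circ> h) \<circ> x) * f (inv (x \<circ> h) \<circ> g))"
      by (rule sum_perms_left[OF x, symmetric])
    also have "\<dots> = (\<Sum>h\<in>perms n. a (inv x \<circ> (x \<circ> (h \<circ> inv x)) \<circ> x) * f (inv (x \<circ> (h \<circ> inv x)) \<circ> g))"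
      by (rule sum_perms_right[OF permutes_inv[OF x], symmetric])
    also have "\<dots> = (\<Sum>h\<in>perms n. a h * f (inv h \<circ> (inv x \<circ> g \<circ> x)))"
    proof (rule sum.cong[OF refl])
      fix h assume "h \<in> perms n"
      then have h: "h permutes {1..n}" by simp
      have "inv (x \<circ> (h \<circ> inv x)) \<circ> g = x \<circ> (inv h \<circ> (inv x \<circ> g))"
        using h x by (simp add: inv_comp_perm permutes_inv permutes_compose perm_cancel o_assoc[symmetric])
      then have "f (inv (x \<circ> (h \<circ> inv x)) \<circ> g) = f (inv x \<circ> (x \<circ> (inv h \<circ> (inv x \<circ> g))) \<circ> x)"
        by (simp only: class_function_conj[OF f x])
      moreover have "inv x \<circ> (x \<circ> (inv h \<circ> (inv x \<circ> g))) \<circ> x = inv h \<circ> (inv x \<circ> g \<circ> x)"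
        by (simp add: fun_eq_iff permutes_inverses[OF x])
      ultimately show "a (inv x \<circ> (x \<circ> (h \<circ> inv x)) \<circ> x) * f (inv (x \<circ> (h \<circ> inv x)) \<circ> g) =
          a h * f (inv h \<circ> (inv x \<circ> g \<circ> x))"
        by (simp add: perm_cancel[OF x])
    qed
    also have "\<dots> = convolution n a f (inv x \<circ> g \<circ> x)"
      by (simp add: convolution_def)
    finally show "(\<Sum>h\<in>perms n. a (inv x \<circ> h \<circ> x) * f (inv h \<circ> g)) = convolution n a f (inv x \<circ> g \<circ> x)" .
  qed
  finally show "class_sum n (convolution n a f) g = convolution n (class_sum n a) f g"
    by (simp add: class_sum_def)
qed

text \<open>Written as a product, each conjugate becomes accessible to associativity and to the
  vanishing of products of symmetrizers.\<close>

lemma class_sum_delta: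
  assumes "a \<in> group_algebra n"
  shows "class_sum n a = (\<lambda>g. \<Sum>x\<in>perms n. convolution n (delta x) (convolution n a (delta (inv x))) g)"
proof -
  have "convolution n (delta x) (convolution n a (delta (inv x))) = (\<lambda>g. a (inv x \<circ> g \<circ> x))"
    if "x permutes {1..n}" for x
    using that by (simp add: delta_convolution convolution_delta[OF permutes_inv[OF that] assms]
        left_translation_def perm_cancel)
  then show ?thesis
    by (simp add: class_sum_def fun_eq_iff)
qed

lemma star_class_sum: "star n (class_sum n a) = class_sum n (star n a)"
proof
  fix g
  have "cnj (a (inv x \<circ> inv g \<circ> x)) = star n a (inv x \<circ> g \<circ> x)"
    if "x permutes {1..n}" "g permutes {1..n}" for x
  proof -
    have "inv (inv x \<circ> g \<circ> x) = inv x \<circ> (inv g \<circ> inv (inv x))"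
      using that by (simp only: inv_comp_perm[of _ "{1..n}"] permutes_inv permutes_compose)
    then show ?thesis
      using that by (simp add: star_def perms_comp_iff permutes_inv perm_cancel o_assoc)
  qed
  then show "star n (class_sum n a) g = class_sum n (star n a) g"
    by (auto simp: star_def[of n "class_sum n a"] class_sum_def) (simp add: star_def conj_permutes_iff)
qed

section \<open>Young symmetrizers\<close>

definition row_sym :: "nat list \<Rightarrow> (nat \<Rightarrow> nat) \<Rightarrow> complex" where
  "row_sym la g = (if g \<in> row_group la then 1 else 0)"

definition col_alt :: "nat list \<Rightarrow> (nat \<Rightarrow> nat) \<Rightarrow> complex" where
  "col_alt la g = (if g \<in> column_group la then of_int (sign g) else 0)"

lemma row_group_perm: "p \<in> row_group la \<Longrightarrow> p permutes {1..sum_list la}"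
  by (simp add: row_group_def)

lemma column_group_perm: "p \<in> column_group la \<Longrightarrow> p permutes {1..sum_list la}"
  by (simp add: column_group_def)

lemma perm_permutation: "p permutes {1..n::nat} \<Longrightarrow> permutation p"
  by (rule permutes_imp_permutation) auto

lemma row_group_comp_iff:
  assumes "p \<in> row_group la"
  shows "p \<circ> x \<in> row_group la \<longleftrightarrow> x \<in> row_group la" "x \<circ> p \<in> row_group la \<longleftrightarrow> x \<in> row_group la"
  using assms stabilizer_comp[of p _ _ x] stabilizer_comp[of x _ _ p]
    stabilizer_comp[of "inv p" _ _ "p \<circ> x"] stabilizer_comp[of "x \<circ> p" _ _ "inv p"] stabilizer_inv
    perm_cancel[OF row_group_perm[OF assms]]
  unfolding row_group_stabilizer by metis+

lemma column_group_comp_iff: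
  assumes "p \<in> column_group la"
  shows "p \<circ> x \<in> column_group la \<longleftrightarrow> x \<in> column_group la" "x \<circ> p \<in> column_group la \<longleftrightarrow> x \<in> column_group la"
  using assms stabilizer_comp[of p _ _ x] stabilizer_comp[of x _ _ p]
    stabilizer_comp[of "inv p" _ _ "p \<circ> x"] stabilizer_comp[of "x \<circ> p" _ _ "inv p"] stabilizer_inv
    perm_cancel[OF column_group_perm[OF assms]]
  unfolding column_group_stabilizer by metis+

lemma row_group_inv: "p \<in> row_group la \<Longrightarrow> inv p \<in> row_group la"
  unfolding row_group_stabilizer by (rule stabilizer_inv)

lemma column_group_inv: "p \<in> column_group la \<Longrightarrow> inv p \<in> column_group la"
  unfolding column_group_stabilizer by (rule stabilizer_inv)

lemma row_group_id: "id \<in> row_group la"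
  unfolding row_group_stabilizer by (rule stabilizer_id)

lemma column_group_id: "id \<in> column_group la"
  unfolding column_group_stabilizer by (rule stabilizer_id)

lemma sign_mult_self: "of_int (sign p) * of_int (sign p) = (1::complex)"
  by (simp add: sign_def)

context
  fixes la :: "nat list" and n :: nat
  assumes n: "sum_list la = n"
begin

lemma row_sym_in: "row_sym la \<in> group_algebra n"
  using row_group_perm n by (auto simp: row_sym_def group_algebra_def)

lemma col_alt_in: "col_alt la \<in> group_algebra n"
  using column_group_perm n by (auto simp: col_alt_def group_algebra_def)

lemma row_sym_delta: "p \<in> row_group la \<Longrightarrow> convolution n (row_sym la) (delta p) = row_sym la"
  using convolution_delta[OF _ row_sym_in, of p] row_group_perm[of p] n row_group_comp_iff[OF row_group_inv]
  by (auto simp: row_sym_def fun_eq_iff)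

lemma delta_col_alt:
  assumes "q \<in> column_group la"
  shows "convolution n (delta q) (col_alt la) = (\<lambda>x. of_int (sign q) * col_alt la x)"
proof
  fix x
  have q: "q permutes {1..n}"
    using column_group_perm[OF assms] n by simp
  have "col_alt la (inv q \<circ> x) = of_int (sign q) * col_alt la x"
  proof (cases "x \<in> column_group la")
    case True
    then have "x permutes {1..n}"
      using column_group_perm[of x la] n by simp
    then have "sign (inv q \<circ> x) = sign q * sign x"
      by (simp add: sign_compose sign_inverse perm_permutation[OF q] perm_permutation[OF permutes_inv[OF q]]
          perm_permutation[of x])
    then show ?thesis
      using True by (simp add: col_alt_def column_group_comp_iff[OF column_group_inv[OF assms]])
  qed (simp add: col_alt_def column_group_comp_iff[OF column_group_inv[OF assms]])
  then show "convolution n (delta q) (col_alt la) x = of_int (sign q) * col_alt la x"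
    by (simp add: delta_convolution[OF q] left_translation_def)
qed

lemma row_sym_square: "convolution n (row_sym la) (row_sym la) = (\<lambda>x. of_nat (card (row_group la)) * row_sym la x)"
proof
  fix x
  have "convolution n (row_sym la) (row_sym la) x = (\<Sum>h\<in>row_group la. row_sym la x)"
    unfolding convolution_def
    by (rule sum.mono_neutral_cong_right)
      (use row_group_perm n finite_perms in \<open>auto simp: row_sym_def row_group_comp_iff row_group_inv\<close>)
  then show "convolution n (row_sym la) (row_sym la) x = of_nat (card (row_group la)) * row_sym la x"
    by simp
qed

lemma col_alt_square: "convolution n (col_alt la) (col_alt la) = (\<lambda>x. of_nat (card (column_group la)) * col_alt la x)"
proof
  fix x
  have "convolution n (col_alt la) (col_alt la) x = (\<Sum>h\<in>column_group la. col_alt la x)"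
    unfolding convolution_def
  proof (rule sum.mono_neutral_cong_right)
    fix h assume h: "h \<in> column_group la"
    then have "h permutes {1..n}"
      using column_group_perm[of h la] n by simp
    then have "col_alt la (inv h \<circ> x) = of_int (sign h) * col_alt la x"
      using fun_cong[OF delta_col_alt[OF h], of x] by (simp add: delta_convolution left_translation_def)
    then show "col_alt la h * col_alt la (inv h \<circ> x) = col_alt la x"
      using h sign_mult_self[of h] by (simp add: col_alt_def)
  qed (use column_group_perm n finite_perms in \<open>auto simp: col_alt_def\<close>)
  then show "convolution n (col_alt la) (col_alt la) x = of_nat (card (column_group la)) * col_alt la x"
    by simp
qed

lemma star_row_sym: "star n (row_sym la) = row_sym la"
proof
  fix g
  have "inv g \<in> row_group la \<longleftrightarrow> g \<in> row_group la" if "g permutes {1..n}"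
    using row_group_inv[of g la] row_group_inv[of "inv g" la] perm_cancel(5)[OF that] by auto
  then show "star n (row_sym la) g = row_sym la g"
    using row_group_perm[of g la] n by (auto simp: star_def row_sym_def)
qed

lemma star_col_alt: "star n (col_alt la) = col_alt la"
proof
  fix g
  have "inv g \<in> column_group la \<longleftrightarrow> g \<in> column_group la" if "g permutes {1..n}"
    using column_group_inv[of g la] column_group_inv[of "inv g" la] perm_cancel(5)[OF that] by auto
  then show "star n (col_alt la) g = col_alt la g"
    using column_group_perm[of g la] n
    by (auto simp: star_def col_alt_def sign_inverse perm_permutation)
qed

lemma young_symmetrizer_convolution:
  "young_symmetrizer la = convolution n (row_sym la) (col_alt la)"
proof
  fix x
  have "convolution n (row_sym la) (col_alt la) x =
      (\<Sum>h | h \<in> row_group la \<and> inv h \<circ> x \<in> column_group la. of_int (sign (inv h \<circ> x)))"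
    unfolding convolution_def
    by (rule sum.mono_neutral_cong_right)
      (use row_group_perm n finite_perms in \<open>auto simp: row_sym_def col_alt_def\<close>)
  also have "\<dots> = young_symmetrizer la x"
    unfolding young_symmetrizer_def
    by (rule sum.reindex_bij_witness[where i = fst and j = "\<lambda>h. (h, inv h \<circ> x)"])
      (auto simp: perm_cancel[OF row_group_perm])
  finally show "young_symmetrizer la x = convolution n (row_sym la) (col_alt la) x" ..
qed

lemma young_symmetrizer_in: "young_symmetrizer la \<in> group_algebra n"
  unfolding young_symmetrizer_convolution by (rule convolution_in[OF col_alt_in])

text \<open>Only \<open>h = id\<close> contributes, because the row and the column group intersect
  trivially. This value shows that the symmetrizer does not vanish and fixes the normalisation of
  everything built from it.\<close>

lemma young_symmetrizer_id: "young_symmetrizer la id = 1"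
proof -
  have "row_sym la h * col_alt la (inv h) = (if h = id then 1 else 0)" for h
  proof (cases "h \<in> row_group la \<and> inv h \<in> column_group la")
    case True
    then have "h = id"
      using row_column_group_id[of h la] column_group_inv[of "inv h" la] perm_cancel(5)[OF row_group_perm, of h la]
      by auto
    then show ?thesis
      by (simp add: row_sym_def col_alt_def row_group_id column_group_id sign_id)
  qed (use row_group_id column_group_id in \<open>auto simp: row_sym_def col_alt_def\<close>)
  then show ?thesis
    unfolding young_symmetrizer_convolution convolution_def
    by (simp add: finite_perms permutes_id)
qed

end

text \<open>The transposition \<open>t\<close> is absorbed by \<open>row_sym la\<close>; carried
  across \<open>g\<close> it becomes \<open>s\<close>, which \<open>col_alt mu\<close> turns into
  the factor -1. The product is therefore its own negative.\<close>

lemma convolution_row_col_zero_if_not_inj: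
  assumes la: "la \<in> young_diagrams n" and mu: "mu \<in> young_diagrams n" and g: "g permutes {1..n}"
    and "\<not> inj_on (\<lambda>x. (row_of la x, col_of mu (inv g x))) {1..n}"
  shows "convolution n (row_sym la) (convolution n (delta g) (col_alt mu)) = (\<lambda>x. 0)"
    (is "?L = _")
proof -
  have size: "sum_list la = n" "sum_list mu = n"
    using la mu by (auto simp: young_diagrams_def)
  obtain t s where ts: "t \<in> row_group la" "s \<in> column_group mu" "t \<circ> g = g \<circ> s" "sign s = -1"
    using transposition_if_mixed_not_inj[OF assms] by blast
  have t: "t permutes {1..n}" and s: "s permutes {1..n}"
    using row_group_perm[OF ts(1)] column_group_perm[OF ts(2)] size by simp_all
  have "?L = convolution n (convolution n (row_sym la) (delta t)) (convolution n (delta g) (col_alt mu))"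
    by (simp add: row_sym_delta[OF size(1) ts(1)])
  also have "\<dots> = convolution n (row_sym la) (convolution n (convolution n (delta t) (delta g)) (col_alt mu))"
    by (simp only: convolution_assoc)
  also have "convolution n (delta t) (delta g) = convolution n (delta g) (delta s)"
    by (simp add: delta_delta t g s ts(3))
  also have "convolution n (row_sym la) (convolution n \<dots> (col_alt mu)) = (\<lambda>x. - ?L x)"
    using ts(4) convolution_scale_right[of n _ "-1"]
    by (simp add: convolution_assoc delta_col_alt[OF size(2) ts(2)])
  finally show ?thesis
    by (auto simp: fun_eq_iff)
qed

text \<open>Failure of dominance at a single \<open>i\<close> excludes injective mixed coordinates
  for every \<open>g\<close>, so every permutation in the expansion of the middle factor contributes
  zero.\<close>

lemma convolution_row_col_zero:
  assumes "la \<in> young_diagrams n" "mu \<in> young_diagrams n" "x \<in> group_algebra n"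
    and "\<not> dominance_sum la i \<le> dominance_sum mu i"
  shows "convolution n (row_sym la) (convolution n x (col_alt mu)) = (\<lambda>x. 0)"
proof -
  have "convolution n (row_sym la) (convolution n (delta g) (col_alt mu)) = (\<lambda>x. 0)" if "g permutes {1..n}" for g
    using convolution_row_col_zero_if_not_inj[OF assms(1,2) that]
      dominance_if_mixed_inj[OF assms(1,2) that, of i] assms(4) by blast
  then show ?thesis
    unfolding convolution_expand_middle[OF assms(3)] by simp
qed

text \<open>For a single permutation in the middle there are two cases: either the mixed coordinates
  collide and the product is zero, or the permutation factors as \<open>p \<circ> q\<close> and the
  two outer factors absorb \<open>p\<close> and \<open>q\<close> up to
  \<open>sign q\<close>.\<close>

lemma convolution_row_col_scalar:
  assumes la: "la \<in> young_diagrams n" and "x \<in> group_algebra n"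
  shows "\<exists>s. convolution n (row_sym la) (convolution n x (col_alt la)) = (\<lambda>y. s * young_symmetrizer la y)"
proof -
  have size: "sum_list la = n"
    using la by (auto simp: young_diagrams_def)
  have "\<exists>s. convolution n (row_sym la) (convolution n (delta g) (col_alt la)) = (\<lambda>y. s * young_symmetrizer la y)"
    if g: "g permutes {1..n}" for g
  proof (cases "inj_on (\<lambda>x. (row_of la x, col_of la (inv g x))) {1..n}")
    case True
    obtain p q where pq: "p \<in> row_group la" "q \<in> column_group la" "g = p \<circ> q"
      using factorization_if_mixed_inj[OF la la g True] by blast
    have p: "p permutes {1..n}" and q: "q permutes {1..n}"
      using row_group_perm[OF pq(1)] column_group_perm[OF pq(2)] size by simp_all
    have "convolution n (row_sym la) (convolution n (delta g) (col_alt la)) =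
        convolution n (convolution n (row_sym la) (delta p)) (convolution n (delta q) (col_alt la))"
      unfolding pq(3) delta_delta[OF p q, symmetric] by (simp only: convolution_assoc)
    also have "\<dots> = (\<lambda>y. of_int (sign q) * young_symmetrizer la y)"
      by (simp add: row_sym_delta[OF size pq(1)] delta_col_alt[OF size pq(2)] convolution_scale_right
          young_symmetrizer_convolution[OF size])
    finally show ?thesis by blast
  next
    case False
    then show ?thesis
      using convolution_row_col_zero_if_not_inj[OF la la g] by (intro exI[of _ 0]) simp
  qed
  then obtain s where s: "convolution n (row_sym la) (convolution n (delta g) (col_alt la)) =
      (\<lambda>y. s g * young_symmetrizer la y)" if "g permutes {1..n}" for g
    by metis
  have "convolution n (row_sym la) (convolution n x (col_alt la)) =
      (\<lambda>y. (\<Sum>g\<in>perms n. x g * s g) * young_symmetrizer la y)"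
    unfolding convolution_expand_middle[OF assms(2)]
    by (auto simp: s sum_distrib_right mult.assoc intro!: sum.cong)
  then show ?thesis by blast
qed

text \<open>A nonzero product forces \<open>la\<close> to be dominated by \<open>mu\<close> because of the factors
  \<open>row_sym la\<close> and \<open>col_alt mu\<close>, and \<open>mu\<close> by \<open>la\<close> because of the other two.\<close>

lemma young_symmetrizer_orthogonal:
  assumes la: "la \<in> young_diagrams n" and mu: "mu \<in> young_diagrams n" and "la \<noteq> mu"
    and x: "x \<in> group_algebra n"
  shows "convolution n (young_symmetrizer la) (convolution n x (young_symmetrizer mu)) = (\<lambda>x. 0)"
proof -
  have size: "sum_list la = n" "sum_list mu = n"
    using la mu by (auto simp: young_diagrams_def)
  let ?m = "convolution n (col_alt la) (convolution n x (row_sym mu))"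
  have m: "?m \<in> group_algebra n"
    by (intro convolution_in row_sym_in size)
  have eq: "convolution n (young_symmetrizer la) (convolution n x (young_symmetrizer mu)) =
      convolution n (row_sym la) (convolution n ?m (col_alt mu))"
    unfolding young_symmetrizer_convolution[OF size(1)] young_symmetrizer_convolution[OF size(2)]
    by (simp only: convolution_assoc)
  obtain i where "dominance_sum la i \<noteq> dominance_sum mu i"
    using dominance_sum_eqD[OF la mu] \<open>la \<noteq> mu\<close> by blast
  then consider "\<not> dominance_sum la i \<le> dominance_sum mu i" | "\<not> dominance_sum mu i \<le> dominance_sum la i"
    by linarith
  then show ?thesis
  proof cases
    case 1
    then show ?thesis
      unfolding eq by (intro convolution_row_col_zero[OF la mu m])
  next
    case 2
    \<comment> \<open>The adjoint reverses the order of the factors, which brings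
      \<open>row_sym mu\<close> to the left of \<open>col_alt la\<close>, the arrangement in which
      dominance of \<open>la\<close> over \<open>mu\<close> is tested.\<close>
    have "star n ?m = convolution n (row_sym mu) (convolution n (star n x) (col_alt la))"
      by (simp add: star_convolution star_row_sym[OF size(2)] star_col_alt[OF size(1)] convolution_assoc)
    also have "\<dots> = (\<lambda>x. 0)"
      by (rule convolution_row_col_zero[OF mu la star_in 2])
    finally have "?m = star n (\<lambda>x. 0)"
      using star_star[OF m] by simp
    then have "?m = (\<lambda>x. 0)"
      by (simp add: star_def fun_eq_iff)
    then show ?thesis
      unfolding eq by simp
  qed
qed

text \<open>The outermost factors of the product are \<open>row_sym la\<close> and
  \<open>col_alt la\<close>, so the scalar statement for these applies to everything in between. It
  says that the symmetrizer is, up to scaling, a primitive idempotent once its square is known to be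
  nonzero.\<close>

lemma young_symmetrizer_scalar:
  assumes la: "la \<in> young_diagrams n" and x: "x \<in> group_algebra n"
  shows "\<exists>s. convolution n (young_symmetrizer la) (convolution n x (young_symmetrizer la)) =
    (\<lambda>y. s * young_symmetrizer la y)"
proof -
  have size: "sum_list la = n"
    using la by (auto simp: young_diagrams_def)
  have "convolution n (young_symmetrizer la) (convolution n x (young_symmetrizer la)) =
      convolution n (row_sym la) (convolution n
        (convolution n (col_alt la) (convolution n x (row_sym la))) (col_alt la))"
    unfolding young_symmetrizer_convolution[OF size] by (simp only: convolution_assoc)
  then show ?thesis
    using convolution_row_col_scalar[OF la, of "convolution n (col_alt la) (convolution n x (row_sym la))"]
    by (simp add: convolution_in row_sym_in[OF size])
qed

text \<open>With \<open>a = row_sym la\<close>, \<open>b = col_alt la\<close> and \<open>c = a b\<close>, the element \<open>e = a b a\<close> is self-adjoint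
  and \<open>c c = s c\<close> gives \<open>e e = (card (row_group la) * s) e\<close>; now compare the values at the identity.\<close>

lemma young_symmetrizer_square:
  assumes la: "la \<in> young_diagrams n"
  shows "\<exists>s>0. convolution n (young_symmetrizer la) (young_symmetrizer la) =
    (\<lambda>y. complex_of_real s * young_symmetrizer la y)"
proof -
  have size: "sum_list la = n"
    using la by (auto simp: young_diagrams_def)
  define a where "a = row_sym la"
  define b where "b = col_alt la"
  define c where "c = young_symmetrizer la"
  define e where "e = convolution n c a"
  note cab = young_symmetrizer_convolution[OF size, folded a_def b_def c_def]
  have fin: "finite (row_group la)" "finite (column_group la)"
    using row_group_perm column_group_perm size
    by (auto intro!: finite_subset[OF _ finite_perms[of n]])
  define P Q where "P = real (card (row_group la))" and "Q = real (card (column_group la))"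
  have PQ: "P > 0" "Q > 0"
    using fin row_group_id column_group_id by (auto simp: P_def Q_def card_gt_0_iff)
  have star: "star n a = a" "star n b = b"
    using star_row_sym[OF size] star_col_alt[OF size] by (simp_all add: a_def b_def)
  have aa: "convolution n a (convolution n a x) = (\<lambda>y. of_real P * convolution n a x y)" for x
    unfolding convolution_assoc[symmetric]
    by (simp add: a_def row_sym_square[OF size] convolution_scale_left P_def)
  have bb: "convolution n b (convolution n b x) = (\<lambda>y. of_real Q * convolution n b x y)" for x
    unfolding convolution_assoc[symmetric]
    by (simp add: b_def col_alt_square[OF size] convolution_scale_left Q_def)
  obtain s where s: "convolution n c c = (\<lambda>y. s * c y)"
    using young_symmetrizer_scalar[OF la delta_in[OF permutes_id]] young_symmetrizer_in[OF size]
    by (auto simp: c_def convolution_delta_id)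
  have star_e: "star n e = e"
    by (simp add: e_def cab star_convolution star convolution_assoc)
  \<comment> \<open>\<open>c\<close> times its adjoint is \<open>a b b a\<close>, that is
    \<open>Q e\<close>; hence \<open>e id\<close> is a sum of squares divided by \<open>Q\<close>,
    and positive because \<open>c id = 1\<close>.\<close>
  have "convolution n c (star n c) = (\<lambda>y. of_real Q * e y)"
    by (simp add: e_def cab star_convolution star convolution_assoc bb convolution_scale_right)
  then have "of_real Q * e id = convolution n c (star n c) id"
    by simp
  also have "\<dots> = complex_of_real (\<Sum>h\<in>perms n. (cmod (c h))\<^sup>2)"
    by (rule convolution_star_id)
  finally have e_id: "e id = complex_of_real ((\<Sum>h\<in>perms n. (cmod (c h))\<^sup>2) / Q)"
    using PQ by (simp add: field_simps)
  have "Re (convolution n c (star n c) id) > 0"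
    using young_symmetrizer_id[OF size] by (intro convolution_star_pos[OF permutes_id]) (simp add: c_def)
  then have e_pos: "(\<Sum>h\<in>perms n. (cmod (c h))\<^sup>2) / Q > 0"
    using PQ by (simp add: convolution_star_id)
  have "convolution n e e = (\<lambda>y. of_real P * convolution n (convolution n c c) a y)"
    by (simp add: e_def cab convolution_assoc aa convolution_scale_right)
  then have "convolution n e e id = of_real P * s * e id"
    by (simp only: s convolution_scale_left e_def mult.assoc)
  then have "convolution n e (star n e) id = of_real P * s * e id"
    by (simp only: star_e)
  moreover have e_nz: "e id \<noteq> 0"
    unfolding e_id of_real_eq_0_iff using e_pos by linarith
  ultimately have "s = convolution n e (star n e) id / (of_real P * e id)"
    using PQ by (simp add: field_simps)
  also have "\<dots> = complex_of_real ((\<Sum>h\<in>perms n. (cmod (e h))\<^sup>2) / (P * ((\<Sum>h\<in>perms n. (cmod (c h))\<^sup>2) / Q)))"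
    by (simp add: convolution_star_id e_id)
  finally have s_eq: "s = complex_of_real ((\<Sum>h\<in>perms n. (cmod (e h))\<^sup>2) / (P * ((\<Sum>h\<in>perms n. (cmod (c h))\<^sup>2) / Q)))" .
  from e_nz have "(\<Sum>h\<in>perms n. (cmod (e h))\<^sup>2) > 0"
    using convolution_star_pos[OF permutes_id, of e n] by (simp add: convolution_star_id)
  then have "(\<Sum>h\<in>perms n. (cmod (e h))\<^sup>2) / (P * ((\<Sum>h\<in>perms n. (cmod (c h))\<^sup>2) / Q)) > 0"
    by (rule divide_pos_pos[OF _ mult_pos_pos[OF PQ(1) e_pos]])
  then show ?thesis
    using s unfolding s_eq c_def by blast
qed

section \<open>The central elements attached to diagrams\<close>

definition central_elt :: "nat list \<Rightarrow> (nat \<Rightarrow> nat) \<Rightarrow> complex" where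
  "central_elt la = class_sum (sum_list la) (young_symmetrizer la)"

lemma class_function_central_elt: "sum_list la = n \<Longrightarrow> class_function n (central_elt la)"
  by (simp add: central_elt_def class_function_class_sum young_symmetrizer_in)

lemma central_elt_id: "sum_list la = n \<Longrightarrow> central_elt la id = fact n"
  by (simp add: central_elt_def class_sum_id young_symmetrizer_id)

text \<open>The adjoint swaps the row and the column factor, and the sum over conjugates does not
  see their order.\<close>

lemma star_central_elt:
  assumes "sum_list la = n"
  shows "star n (central_elt la) = central_elt la"
  unfolding central_elt_def assms star_class_sum young_symmetrizer_convolution[OF assms]
    star_convolution star_row_sym[OF assms] star_col_alt[OF assms]
  by (rule class_sum_commute[OF col_alt_in[OF assms] row_sym_in[OF assms]])

text \<open>The symmetrizer of \<open>la\<close> annihilates each conjugate of that of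
  \<open>mu\<close>, hence their sum; summing over the conjugates of the left factor finishes, as
  the right one is already central.\<close>

lemma central_elt_orthogonal:
  assumes la: "la \<in> young_diagrams n" and mu: "mu \<in> young_diagrams n" and "la \<noteq> mu"
  shows "convolution n (central_elt la) (central_elt mu) = (\<lambda>x. 0)"
proof -
  have size: "sum_list la = n" "sum_list mu = n"
    using la mu by (auto simp: young_diagrams_def)
  let ?c = young_symmetrizer
  have "convolution n (?c la) (convolution n (delta x) (convolution n (?c mu) (delta (inv x)))) = (\<lambda>g. 0)"
    if "x permutes {1..n}" for x
  proof -
    have "convolution n (?c la) (convolution n (delta x) (convolution n (?c mu) (delta (inv x)))) =
        convolution n (convolution n (?c la) (convolution n (delta x) (?c mu))) (delta (inv x))"
      by (simp only: convolution_assoc)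
    then show ?thesis
      by (simp add: young_symmetrizer_orthogonal[OF assms delta_in[OF that]])
  qed
  then have "convolution n (?c la) (central_elt mu) = (\<lambda>x. 0)"
    by (simp add: central_elt_def size class_sum_delta[OF young_symmetrizer_in] convolution_sum_right)
  then have "class_sum n (convolution n (?c la) (central_elt mu)) = (\<lambda>x. 0)"
    by (simp add: class_sum_def fun_eq_iff)
  then show ?thesis
    by (simp add: class_sum_convolution[OF class_function_central_elt[OF size(2)]] central_elt_def[of la] size)
qed

text \<open>Since \<open>z\<close> is central, \<open>c z c = c c z\<close>, so \<open>z\<close>
  multiplies \<open>c\<close> by a scalar, and summing over conjugates carries this over to
  \<open>z z\<close>. As \<open>z\<close> is self-adjoint with \<open>z id = fact n\<close>, the
  scalar is the sum of the squares of \<open>z\<close> divided by \<open>fact n\<close>.\<close>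

lemma central_elt_square:
  assumes la: "la \<in> young_diagrams n"
  shows "\<exists>s>0. convolution n (central_elt la) (central_elt la) = (\<lambda>x. complex_of_real s * central_elt la x)"
proof -
  have size: "sum_list la = n"
    using la by (auto simp: young_diagrams_def)
  let ?c = "young_symmetrizer la" and ?z = "central_elt la"
  note c_in = young_symmetrizer_in[OF size]
  note z_class = class_function_central_elt[OF size]
  obtain s where s: "s > 0" "convolution n ?c ?c = (\<lambda>y. complex_of_real s * ?c y)"
    using young_symmetrizer_square[OF la] by blast
  obtain t where t: "convolution n ?c (convolution n ?z ?c) = (\<lambda>y. t * ?c y)"
    using young_symmetrizer_scalar[OF la class_function_in[OF z_class]] by blast
  have "convolution n ?c (convolution n ?z ?c) = convolution n (convolution n ?c ?c) ?z"
    by (simp add: class_function_central[OF z_class c_in] convolution_assoc)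
  then have "(\<lambda>y. t * ?c y) = (\<lambda>y. complex_of_real s * convolution n ?c ?z y)"
    by (simp add: t s(2) convolution_scale_left)
  then have cz: "convolution n ?c ?z = (\<lambda>y. t / complex_of_real s * ?c y)"
    using s(1) by (auto simp: fun_eq_iff field_simps)
  have zz: "convolution n ?z ?z = (\<lambda>x. t / complex_of_real s * ?z x)"
    using class_sum_convolution[OF z_class, of ?c] unfolding cz class_sum_scale
    by (simp add: central_elt_def size)
  have "convolution n ?z (star n ?z) id = t / complex_of_real s * fact n"
    unfolding star_central_elt[OF size] zz by (simp add: central_elt_id[OF size])
  then have ts: "t / complex_of_real s = complex_of_real ((\<Sum>h\<in>perms n. (cmod (?z h))\<^sup>2) / fact n)"
    unfolding convolution_star_id by (simp add: field_simps)
  have "Re (convolution n ?z (star n ?z) id) > 0"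
    by (rule convolution_star_pos[OF permutes_id]) (simp add: central_elt_id[OF size])
  then have "(\<Sum>h\<in>perms n. (cmod (?z h))\<^sup>2) / fact n > 0"
    by (simp add: convolution_star_id)
  then show ?thesis
    using zz unfolding ts by blast
qed

section \<open>Irreducible characters\<close>

lemma sum_fun_apply: "(\<Sum>i\<in>I. f i) x = (\<Sum>i\<in>I. f i x)"
  by (induction I rule: infinite_finite_induct) auto

lemma group_algebra_span: "group_algebra n \<subseteq> funs.span (delta ` perms n)"
proof
  fix a assume "a \<in> group_algebra n"
  then have "a = (\<Sum>g\<in>perms n. (\<lambda>x. a g * delta g x))"
    by (subst delta_expansion) (auto simp: fun_eq_iff sum_fun_apply)
  also have "\<dots> \<in> funs.span (delta ` perms n)"
    by (intro funs.span_sum funs.span_scale funs.span_base) auto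
  finally show "a \<in> funs.span (delta ` perms n)" .
qed

lemma convolution_add_left: "convolution n (a + b) c = convolution n a c + convolution n b c"
  by (simp add: convolution_def fun_eq_iff algebra_simps sum.distrib)

lemma subspace_left_ideal: "funs.subspace ((\<lambda>a. convolution n a p) ` group_algebra n)"
proof (rule funs.subspaceI)
  show "0 \<in> (\<lambda>a. convolution n a p) ` group_algebra n"
    by (rule image_eqI[of _ _ "\<lambda>x. 0"]) (simp_all add: group_algebra_def zero_fun_def)
next
  fix u v assume "u \<in> (\<lambda>a. convolution n a p) ` group_algebra n" "v \<in> (\<lambda>a. convolution n a p) ` group_algebra n"
  then obtain a b where "a \<in> group_algebra n" "b \<in> group_algebra n" "u = convolution n a p" "v = convolution n b p"
    by blast
  then show "u + v \<in> (\<lambda>a. convolution n a p) ` group_algebra n"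
    by (intro image_eqI[of _ _ "a + b"]) (simp_all add: group_algebra_def convolution_add_left)
next
  fix s u assume "u \<in> (\<lambda>a. convolution n a p) ` group_algebra n"
  then obtain a where "a \<in> group_algebra n" "u = convolution n a p"
    by blast
  then show "(\<lambda>x. s * u x) \<in> (\<lambda>a. convolution n a p) ` group_algebra n"
    by (intro image_eqI[of _ _ "\<lambda>x. s * a x"]) (simp_all add: group_algebra_def convolution_scale_left)
qed

text \<open>The trace on the left ideal of an idempotent \<open>p\<close> is the trace on the whole algebra of the
  composition with the projection \<open>a \<mapsto> a p\<close>.\<close>

lemma trace_on_left_ideal:
  assumes p: "p \<in> group_algebra n" "convolution n p p = p" and g: "g permutes {1..n}"
  shows "trace_on ((\<lambda>a. convolution n a p) ` group_algebra n) (left_translation g) = class_sum n p (inv g)"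
proof -
  define V where "V = (\<lambda>a. convolution n a p) ` group_algebra n"
  define B where "B = (SOME B. funs.independent B \<and> funs.span B = V)"
  define rep where "rep = funs.representation B"
  have "\<exists>B. funs.independent B \<and> funs.span B = V"
    using funs.maximal_independent_subset[of V] funs.span_subspace[OF _ _ subspace_left_ideal] unfolding V_def
    by metis
  then have B: "funs.independent B" "funs.span B = V"
    unfolding B_def by (metis (mono_tags, lifting) someI_ex)+
  have V: "V \<subseteq> group_algebra n"
    using convolution_in[OF p(1)] by (auto simp: V_def)
  have fin: "finite B"
    using funs.independent_span_bound[OF _ B(1), of "delta ` perms n"] funs.span_superset[of B] B(2) V
      group_algebra_span finite_perms by blast
  have expand: "v = (\<lambda>x. \<Sum>b\<in>B. rep v b * b x)" if "v \<in> V" for v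
    using funs.sum_representation_eq[OF B(1), of v B] that fin B(2)
    by (auto simp: rep_def fun_eq_iff sum_fun_apply)
  have fixed: "convolution n v p = v" if "v \<in> V" for v
    using that by (auto simp: V_def convolution_assoc p(2))
  have delta_V: "convolution n (delta x) p \<in> V" if "x permutes {1..n}" for x
    using delta_in[OF that] by (auto simp: V_def)
  \<comment> \<open>The summand at \<open>x\<close> is the coefficient of \<open>delta x\<close> in
    the image of \<open>delta x\<close> under \<open>a \<mapsto> g a p\<close>, so the sum is the
    trace in the basis of permutations.\<close>
  have "class_sum n p (inv g) = (\<Sum>x\<in>perms n. convolution n (delta g) (convolution n (delta x) p) x)"
    unfolding class_sum_def
    by (intro sum.cong) (auto simp: delta_convolution[OF g] delta_convolution left_translation_def o_assoc)
  also have "\<dots> = (\<Sum>x\<in>perms n. \<Sum>b\<in>B. rep (convolution n (delta x) p) b * convolution n (delta g) b x)"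
  proof (rule sum.cong[OF refl])
    fix x assume "x \<in> perms n"
    then have "convolution n (delta x) p \<in> V"
      using delta_V by simp
    from arg_cong[OF expand[OF this], of "\<lambda>v. convolution n (delta g) v x"]
    show "convolution n (delta g) (convolution n (delta x) p) x =
        (\<Sum>b\<in>B. rep (convolution n (delta x) p) b * convolution n (delta g) b x)"
      unfolding convolution_sum_right convolution_scale_right .
  qed
  \<comment> \<open>Exchanging the sums is the identity tr (X Y) = tr (Y X), for the projection onto
    \<open>V\<close> and the translation of \<open>V\<close> into the whole algebra.\<close>
  also have "\<dots> = (\<Sum>b\<in>B. \<Sum>x\<in>perms n. rep (convolution n (delta x) p) b * convolution n (delta g) b x)"
    by (rule sum.swap)
  also have "\<dots> = (\<Sum>b\<in>B. rep (left_translation g b) b)"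
  proof (rule sum.cong[OF refl])
    fix b assume "b \<in> B"
    then have b: "b \<in> V"
      using funs.span_base B(2) by blast
    let ?T = "convolution n (delta g) b"
    have T: "?T \<in> group_algebra n"
      using b V convolution_in by blast
    have "?T = convolution n ?T p"
      by (simp add: convolution_assoc fixed[OF b])
    also have "\<dots> = (\<Sum>x\<in>perms n. (\<lambda>y. ?T x * convolution n (delta x) p y))"
      by (subst delta_expansion[OF T])
        (simp add: convolution_sum_left convolution_scale_left fun_eq_iff sum_fun_apply)
    finally have "rep ?T b = rep (\<Sum>x\<in>perms n. (\<lambda>y. ?T x * convolution n (delta x) p y)) b"
      by simp
    also have "\<dots> = (\<Sum>x\<in>perms n. ?T x * rep (convolution n (delta x) p) b)"
      unfolding rep_def
      by (subst funs.representation_sum[OF B(1)])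
        (auto simp: sum_fun_apply B funs.representation_scale delta_V
          intro!: funs.subspace_scale[OF subspace_left_ideal[of n p, folded V_def]])
    finally show "(\<Sum>x\<in>perms n. rep (convolution n (delta x) p) b * ?T x) = rep (left_translation g b) b"
      by (simp add: delta_convolution[OF g] mult.commute)
  qed
  also have "\<dots> = trace_on V (left_translation g)"
    by (simp add: trace_on_def B_def[symmetric] rep_def)
  finally show ?thesis
    by (simp add: V_def)
qed

lemma cnj_young_symmetrizer: "cnj (young_symmetrizer la x) = young_symmetrizer la x"
  by (simp add: young_symmetrizer_def case_prod_beta)

lemma cnj_central_elt: "cnj (central_elt la g) = central_elt la g"
  by (simp add: central_elt_def class_sum_def cnj_young_symmetrizer)

text \<open>The element is self-adjoint and real-valued. This removes the inverse which the trace on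
  a left ideal introduces.\<close>

lemma central_elt_inv:
  assumes "sum_list la = n" "g permutes {1..n}"
  shows "central_elt la (inv g) = central_elt la g"
  using fun_cong[OF star_central_elt[OF assms(1)], of g] assms(2) by (simp add: star_def cnj_central_elt)

text \<open>Dividing the symmetrizer by the scalar of its square makes it idempotent and leaves the
  left ideal unchanged, so the trace formula for idempotents applies to
  \<open>irr_module la\<close>.\<close>

lemma irr_char_central_elt:
  assumes la: "la \<in> young_diagrams n"
  shows "\<exists>s>0. \<forall>g. g permutes {1..n} \<longrightarrow> irr_char la g = central_elt la g / complex_of_real s"
proof -
  have size: "sum_list la = n"
    using la by (auto simp: young_diagrams_def)
  let ?c = "young_symmetrizer la"
  obtain s where s: "s > 0" "convolution n ?c ?c = (\<lambda>y. complex_of_real s * ?c y)"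
    using young_symmetrizer_square[OF la] by blast
  define p where "p = (\<lambda>x. 1 / complex_of_real s * ?c x)"
  have p_in: "p \<in> group_algebra n"
    using young_symmetrizer_in[OF size] by (simp add: p_def group_algebra_def)
  have pp: "convolution n p p = p"
    unfolding p_def convolution_scale_left convolution_scale_right s(2)
    using s(1) by (simp add: fun_eq_iff)
  have scaled: "convolution n a ?c = convolution n (\<lambda>x. complex_of_real s * a x) p"
    "convolution n a p = convolution n (\<lambda>x. 1 / complex_of_real s * a x) ?c" for a
    unfolding p_def convolution_scale_left convolution_scale_right
    using s(1) by (simp_all add: fun_eq_iff)
  have "irr_module la = (\<lambda>a. convolution n a p) ` group_algebra n"
    unfolding irr_module_def size
  proof (intro equalityI image_subsetI)
    fix a assume a: "a \<in> group_algebra n"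
    show "convolution n a ?c \<in> (\<lambda>a. convolution n a p) ` group_algebra n"
      using a unfolding scaled(1) by (intro imageI) (simp add: group_algebra_def)
    show "convolution n a p \<in> (\<lambda>a. convolution n a ?c) ` group_algebra n"
      using a unfolding scaled(2) by (intro imageI) (simp add: group_algebra_def)
  qed
  then have "irr_char la g = class_sum n p (inv g)" if "g permutes {1..n}" for g
    using trace_on_left_ideal[OF p_in pp that] by (simp add: irr_char_def)
  moreover have "class_sum n p (inv g) = central_elt la g / complex_of_real s" if "g permutes {1..n}" for g
    using central_elt_inv[OF size that] unfolding p_def class_sum_scale central_elt_def size by simp
  ultimately show ?thesis
    using s(1) by auto
qed

section \<open>Cycle types and conjugacy\<close>

lemma bij_betw_if_image_mset_eq:
  assumes "finite A" "finite B" and eq: "image_mset f (mset_set A) = image_mset f' (mset_set B)"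
  shows "\<exists>p. bij_betw p A B \<and> (\<forall>a\<in>A. f' (p a) = f a)"
proof -
  have "\<exists>p. bij_betw p {a\<in>A. f a = c} {b\<in>B. f' b = c}" for c
  proof (rule finite_same_card_bij)
    have "count (image_mset f (mset_set A)) c = count (image_mset f' (mset_set B)) c"
      by (simp add: eq)
    then show "card {a\<in>A. f a = c} = card {b\<in>B. f' b = c}"
      using assms(1,2) by (simp add: count_image_mset_eq_card_vimage)
  qed (use assms in auto)
  then obtain p where p: "\<And>c. bij_betw (p c) {a\<in>A. f a = c} {b\<in>B. f' b = c}"
    by metis
  have val: "p (f a) a \<in> B \<and> f' (p (f a) a) = f a" if "a \<in> A" for a
    using bij_betwE[OF p[of "f a"]] that by auto
  have "bij_betw (\<lambda>a. p (f a) a) A B"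
  proof (rule bij_betw_imageI)
    show "inj_on (\<lambda>a. p (f a) a) A"
    proof (rule inj_onI)
      fix a a' assume a: "a \<in> A" "a' \<in> A" "p (f a) a = p (f a') a'"
      then have "f a = f a'"
        using val by metis
      then show "a = a'"
        using inj_onD[OF bij_betw_imp_inj_on[OF p[of "f a"]], of a a'] a by simp
    qed
    show "(\<lambda>a. p (f a) a) ` A = B"
    proof (intro equalityI subsetI)
      fix b assume "b \<in> B"
      then have "b \<in> p (f' b) ` {a\<in>A. f a = f' b}"
        using bij_betw_imp_surj_on[OF p[of "f' b"]] by simp
      then show "b \<in> (\<lambda>a. p (f a) a) ` A"
        by force
    qed (use val in auto)
  qed
  then show ?thesis
    using val by (intro exI[of _ "\<lambda>a. p (f a) a"]) simp
qed

lemma orbit_funpow: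
  assumes "permutation f"
  shows "(f ^^ i) a \<in> orbit f a"
  using orbit_altdef_permutation[OF assms] by blast

text \<open>The size of the orbit is the least positive power of \<open>f\<close> fixing
  \<open>a\<close>, and the powers fixing \<open>a\<close> are its multiples.\<close>

lemma funpow_eq_iff_card_orbit:
  assumes f: "permutation f"
  shows "(f ^^ i) a = (f ^^ j) a \<longleftrightarrow> i mod card (orbit f a) = j mod card (orbit f a)"
proof -
  have "orbit f a = set (support f a)"
    by (auto simp only: orbit_altdef_permutation[OF f] support_set[OF f])
  then have card: "card (orbit f a) = least_power f a"
    using distinct_card[of "support f a"] cycle_of_permutation[OF f, of a] by simp
  have "(f ^^ i) a = (f ^^ j) a \<longleftrightarrow> i mod card (orbit f a) = j mod card (orbit f a)" if "i \<le> j" for i j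
  proof -
    have "(f ^^ i) a = (f ^^ j) a \<longleftrightarrow> (f ^^ (j - i)) a = a"
    proof
      assume "(f ^^ (j - i)) a = a"
      then show "(f ^^ i) a = (f ^^ j) a"
        using that funpow_add[of i "j - i" f] by simp
    qed (use f that in \<open>auto intro: funpow_diff simp: permutation bij_is_inj\<close>)
    also have "\<dots> \<longleftrightarrow> card (orbit f a) dvd j - i"
      by (simp add: least_power_dvd[OF f] card)
    also have "\<dots> \<longleftrightarrow> j mod card (orbit f a) = i mod card (orbit f a)"
      using that by (simp add: mod_eq_dvd_iff_nat)
    finally show ?thesis
      by auto
  qed
  then show ?thesis
    by (metis nat_le_linear)
qed

definition orbit_sizes :: "nat \<Rightarrow> (nat \<Rightarrow> nat) \<Rightarrow> nat multiset" where
  "orbit_sizes n g = image_mset card (mset_set (orbit g ` {1..n}))"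

text \<open>The cycle lengths in decreasing order, as \<open>young_diagrams\<close> demands. Its
  purpose is to bound the number of conjugacy classes by the number of diagrams.\<close>

definition cycle_type :: "nat \<Rightarrow> (nat \<Rightarrow> nat) \<Rightarrow> nat list" where
  "cycle_type n g = rev (sorted_list_of_multiset (orbit_sizes n g))"

lemma orbit_eqI':
  assumes "permutation g" "y \<in> orbit g x"
  shows "orbit g y = orbit g x"
  using orbit_cyclic_eq3[OF cyclic_on_orbit'[OF assms(1)] assms(2)] .

lemma orbits_disjoint:
  assumes "permutation g" "orbit g x \<noteq> orbit g y"
  shows "orbit g x \<inter> orbit g y = {}"
  using orbit_eqI'[OF assms(1)] assms(2) by blast

lemma cycle_type_in:
  assumes g: "g permutes {1..n}"
  shows "cycle_type n g \<in> young_diagrams n"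
proof -
  have perm: "permutation g"
    by (rule perm_permutation[OF g])
  have fin: "finite (orbit g x)" for x
    by (rule finite_orbit[OF permutation_self_in_orbit[OF perm]])
  have "sum_list (cycle_type n g) = sum_mset (orbit_sizes n g)"
    by (simp add: cycle_type_def flip: sum_mset_sum_list)
  also have "\<dots> = (\<Sum>C\<in>orbit g ` {1..n}. card C)"
    by (simp add: orbit_sizes_def sum_unfold_sum_mset)
  also have "\<dots> = card (\<Union> (orbit g ` {1..n}))"
    using fin orbits_disjoint[OF perm]
    by (intro card_Union_disjoint[symmetric]) (auto simp: pairwise_def disjnt_def)
  also have "\<Union> (orbit g ` {1..n}) = {1..n}"
    using permutes_orbit_subset[OF g] permutation_self_in_orbit[OF perm] by blast
  finally have "sum_list (cycle_type n g) = n"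
    by simp
  moreover have "0 \<notin> set (cycle_type n g)"
    using fin orbit_nonempty[of g] by (auto simp: cycle_type_def orbit_sizes_def card_eq_0_iff)
  moreover have "sorted_wrt (\<ge>) (cycle_type n g)"
    by (simp add: cycle_type_def sorted_wrt_rev)
  ultimately show ?thesis
    by (simp add: young_diagrams_def)
qed

text \<open>Match the cycles of \<open>h\<close> with cycles of \<open>g\<close> of equal length,
  choose a base point in each, and send the image of a base point under a power of \<open>h\<close>
  to the image of its partner under the same power of \<open>g\<close>.\<close>

lemma conjugate_if_cycle_type_eq:
  assumes g: "g permutes {1..n}" and h: "h permutes {1..n}" and "cycle_type n g = cycle_type n h"
  shows "\<exists>x. x permutes {1..n} \<and> inv x \<circ> g \<circ> x = h"
proof -
  have pg: "permutation g" and ph: "permutation h"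
    using g h by (simp_all add: perm_permutation)
  have "orbit_sizes n h = orbit_sizes n g"
    using assms(3) unfolding cycle_type_def by (metis mset_sorted_list_of_multiset rev_rev_ident)
  then obtain \<beta> where \<beta>: "bij_betw \<beta> (orbit h ` {1..n}) (orbit g ` {1..n})"
    "\<And>C. C \<in> orbit h ` {1..n} \<Longrightarrow> card (\<beta> C) = card C"
    using bij_betw_if_image_mset_eq[of "orbit h ` {1..n}" "orbit g ` {1..n}" card card]
    by (auto simp: orbit_sizes_def)
  have \<beta>_orbit: "\<beta> (orbit h x) \<in> orbit g ` {1..n}" if "x \<in> {1..n}" for x
    by (rule bij_betw_apply[OF \<beta>(1) imageI[OF that]])
  \<comment> \<open>Both base points are chosen from a set that depends on \<open>x\<close> only
    through its cycle, so all points of a cycle share them.\<close>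
  define r where "r x = (SOME y. y \<in> orbit h x)" for x
  define r' where "r' x = (SOME y. y \<in> \<beta> (orbit h x))" for x
  have r: "r x \<in> orbit h x" for x
    unfolding r_def by (rule someI_ex) (use orbit_nonempty[of h x] in blast)
  have r_orbit: "orbit h (r x) = orbit h x" for x
    by (rule orbit_eqI'[OF ph r])
  have r'_orbit: "orbit g (r' x) = \<beta> (orbit h x)" if x: "x \<in> {1..n}" for x
  proof -
    obtain z where z: "\<beta> (orbit h x) = orbit g z"
      using \<beta>_orbit[OF x] by blast
    have "r' x \<in> orbit g z"
      unfolding r'_def z by (rule someI_ex) (use orbit_nonempty[of g z] in blast)
    then show ?thesis
      using orbit_eqI'[OF pg] z by simp
  qed
  have r'_in: "(g ^^ i) (r' x) \<in> \<beta> (orbit h x)" if "x \<in> {1..n}" for x i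
    using orbit_funpow[OF pg] r'_orbit[OF that] by blast
  have pow_iff: "(h ^^ i) (r x) = (h ^^ j) (r x) \<longleftrightarrow> (g ^^ i) (r' x) = (g ^^ j) (r' x)"
    if "x \<in> {1..n}" for x i j
    unfolding funpow_eq_iff_card_orbit[OF ph] funpow_eq_iff_card_orbit[OF pg]
    using \<beta>(2)[of "orbit h x"] that by (simp add: r_orbit r'_orbit)
  have same: "r x = r y \<and> r' x = r' y" if "orbit h x = orbit h y" for x y
    using that by (simp add: r_def r'_def)
  \<comment> \<open>Some exponent leading from the base point to \<open>x\<close>. Two admissible
    exponents differ by a multiple of the common cycle length, so \<open>pow_iff\<close> makes the
    choice harmless.\<close>
  define d where "d x = (SOME i. (h ^^ i) (r x) = x)" for x
  have d: "(h ^^ d x) (r x) = x" for x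
  proof -
    have "x \<in> orbit h (r x)"
      using permutation_self_in_orbit[OF ph] r_orbit by blast
    then have "\<exists>i. (h ^^ i) (r x) = x"
      unfolding orbit_altdef_permutation[OF ph] mem_Collect_eq by metis
    then show ?thesis
      unfolding d_def by (rule someI_ex)
  qed
  define \<phi> where "\<phi> x = (if x \<in> {1..n} then (g ^^ d x) (r' x) else x)" for x
  have \<phi>_in: "\<phi> x \<in> \<beta> (orbit h x)" if "x \<in> {1..n}" for x
    using r'_in[OF that] that by (simp add: \<phi>_def)
  have "inj_on \<phi> {1..n}"
  proof (rule inj_onI)
    fix x y assume xy: "x \<in> {1..n}" "y \<in> {1..n}" "\<phi> x = \<phi> y"
    obtain z z' where z: "\<beta> (orbit h x) = orbit g z" "\<beta> (orbit h y) = orbit g z'"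
      using \<beta>_orbit[OF xy(1)] \<beta>_orbit[OF xy(2)] by blast
    then have "orbit g z = orbit g z'"
      using \<phi>_in[OF xy(1)] \<phi>_in[OF xy(2)] xy(3) orbits_disjoint[OF pg, of z z'] by auto
    then have "orbit h x = orbit h y"
      using z inj_onD[OF bij_betw_imp_inj_on[OF \<beta>(1)], of "orbit h x" "orbit h y"] xy by simp
    from same[OF this] have "(g ^^ d x) (r' x) = (g ^^ d y) (r' x)" "r y = r x"
      using xy by (simp_all add: \<phi>_def)
    then have "(h ^^ d x) (r x) = (h ^^ d y) (r y)"
      using pow_iff[OF xy(1)] by simp
    then show "x = y"
      by (simp add: d)
  qed
  moreover have "\<phi> ` {1..n} \<subseteq> {1..n}"
  proof (rule image_subsetI)
    fix x assume x: "x \<in> {1..n}"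
    obtain z where "z \<in> {1..n}" "\<beta> (orbit h x) = orbit g z"
      using \<beta>_orbit[OF x] by blast
    then show "\<phi> x \<in> {1..n}"
      using \<phi>_in[OF x] permutes_orbit_subset[OF g] by blast
  qed
  ultimately have "bij_betw \<phi> {1..n} {1..n}"
    by (simp add: bij_betw_def endo_inj_surj)
  then have \<phi>: "\<phi> permutes {1..n}"
    by (rule bij_imp_permutes) (auto simp: \<phi>_def)
  have "g (\<phi> x) = \<phi> (h x)" for x
  proof (cases "x \<in> {1..n}")
    case True
    then have hx: "h x \<in> {1..n}"
      using permutes_in_image[OF h] by blast
    have "orbit h (h x) = orbit h x"
      by (rule permutation_orbit_step[OF ph])
    note s = same[OF this]
    have "(h ^^ Suc (d x)) (r x) = (h ^^ d (h x)) (r x)"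
      using d[of x] d[of "h x"] s by simp
    then have "(g ^^ Suc (d x)) (r' x) = (g ^^ d (h x)) (r' x)"
      using pow_iff[OF True] by blast
    then show ?thesis
      using True hx s by (simp add: \<phi>_def)
  next
    case False
    then show ?thesis
      using permutes_not_in[OF g] permutes_not_in[OF h] by (auto simp: \<phi>_def)
  qed
  then have "inv \<phi> \<circ> g \<circ> \<phi> = h"
    by (simp add: fun_eq_iff permutes_inverses[OF \<phi>])
  then show ?thesis
    using \<phi> by blast
qed

section \<open>Expansion of class functions in irreducible characters\<close>

lemma finite_young_diagrams: "finite (young_diagrams n)"
proof (rule finite_subset)
  have "length la \<le> sum_list la" if "0 \<notin> set la" for la :: "nat list"
    using that by (induction la) auto
  then show "young_diagrams n \<subseteq> {la. set la \<subseteq> {..n} \<and> length la \<le> n}"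
    using member_le_sum_list by (fastforce simp: young_diagrams_def)
  show "finite {la. set la \<subseteq> {..n} \<and> length la \<le> n}"
    by (rule finite_lists_length_le) simp
qed

lemma young_diagrams_size: "la \<in> young_diagrams n \<Longrightarrow> sum_list la = n"
  by (simp add: young_diagrams_def)

text \<open>The factor in \<open>z z = t z\<close>, read off at the identity, where \<open>z\<close>
  is \<open>fact n\<close>. An explicit expression, unlike a chosen witness, can be compared for a
  diagram and its conjugate.\<close>

definition central_scale :: "nat list \<Rightarrow> real" where
  "central_scale la = Re (convolution (sum_list la) (central_elt la) (central_elt la) id) / fact (sum_list la)"

lemma central_scale:
  assumes "la \<in> young_diagrams n"
  shows central_scale_pos: "central_scale la > 0"
    and central_elt_central_elt: "convolution n (central_elt la) (central_elt la) =
      (\<lambda>x. complex_of_real (central_scale la) * central_elt la x)"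
proof -
  obtain s where s: "s > 0" "convolution n (central_elt la) (central_elt la) =
      (\<lambda>x. complex_of_real s * central_elt la x)"
    using central_elt_square[OF assms] by blast
  have "Re (complex_of_real s * fact n) = s * fact n"
    by (metis Re_complex_of_real of_real_fact of_real_mult)
  then have "central_scale la = s"
    by (simp add: central_scale_def young_diagrams_size[OF assms] s(2)
        central_elt_id[OF young_diagrams_size[OF assms]])
  then show "central_scale la > 0" "convolution n (central_elt la) (central_elt la) =
      (\<lambda>x. complex_of_real (central_scale la) * central_elt la x)"
    using s by simp_all
qed

text \<open>Normalised so as to be the contribution of \<open>la\<close> to the value of
  \<open>f\<close> at the identity; division by that value gives the probability.\<close>

definition character_weight :: "nat \<Rightarrow> ((nat \<Rightarrow> nat) \<Rightarrow> complex) \<Rightarrow> nat list \<Rightarrow> complex" where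
  "character_weight n f la = convolution n f (central_elt la) id / complex_of_real (central_scale la)"

lemma character_weight_cong:
  assumes "\<And>g. g permutes {1..n} \<Longrightarrow> f g = f' g"
  shows "character_weight n f la = character_weight n f' la"
  using assms by (simp add: character_weight_def convolution_def)

lemma character_weight_sum:
  assumes la: "la \<in> young_diagrams n"
  shows "character_weight n (\<lambda>g. \<Sum>mu\<in>young_diagrams n. c mu * central_elt mu g) la = c la * fact n"
proof -
  have "convolution n (\<lambda>g. \<Sum>mu\<in>young_diagrams n. c mu * central_elt mu g) (central_elt la) id =
      (\<Sum>mu\<in>young_diagrams n. c mu * convolution n (central_elt mu) (central_elt la) id)"
    by (simp add: convolution_sum_left convolution_scale_left)
  also have "\<dots> = (\<Sum>mu\<in>young_diagrams n. if mu = la then c la * (complex_of_real (central_scale la) * fact n) else 0)"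
    by (intro sum.cong)
      (auto simp: central_elt_orthogonal la central_elt_central_elt central_elt_id[OF young_diagrams_size[OF la]])
  also have "\<dots> = c la * (complex_of_real (central_scale la) * fact n)"
    using la by (simp add: finite_young_diagrams)
  finally show ?thesis
    using central_scale_pos[OF la] by (simp add: character_weight_def)
qed

text \<open>The elements \<open>central_elt la\<close> are linearly independent, and the space of class functions is
  spanned by the indicators of the conjugacy classes, whose number is at most that of the diagrams.\<close>

lemma class_function_span:
  assumes f: "class_function n f"
  shows "\<exists>c. f = (\<lambda>g. \<Sum>la\<in>young_diagrams n. c la * central_elt la g)"
proof -
  let ?Y = "young_diagrams n"
  define Z where "Z = central_elt ` ?Y"
  have inj: "inj_on central_elt ?Y"
  proof (rule inj_onI, rule ccontr)
    fix la mu assume *: "la \<in> ?Y" "mu \<in> ?Y" "central_elt la = central_elt mu" "la \<noteq> mu"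
    then have "convolution n (central_elt la) (central_elt la) id = 0"
      using central_elt_orthogonal[of la n mu] by simp
    then show False
      using central_scale_pos[OF *(1)] central_elt_id[OF young_diagrams_size[OF *(1)]]
      by (simp add: central_elt_central_elt[OF *(1)])
  qed
  have fin: "finite Z" and card: "card Z = card ?Y"
    using inj by (auto simp: Z_def finite_young_diagrams card_image)
  have sum_Z: "(\<Sum>v\<in>Z. (\<lambda>x. u v * v x)) = (\<lambda>g. \<Sum>la\<in>?Y. u (central_elt la) * central_elt la g)" for u
    unfolding Z_def by (simp add: sum.reindex[OF inj] fun_eq_iff sum_fun_apply)
  have indep: "funs.independent Z"
  proof (rule funs.independent_if_scalars_zero[OF fin])
    fix u v assume u: "(\<Sum>v\<in>Z. (\<lambda>x. u v * v x)) = 0" and "v \<in> Z"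
    then obtain la where la: "la \<in> ?Y" "v = central_elt la"
      by (auto simp: Z_def)
    have "u (central_elt la) * fact n = character_weight n (\<lambda>x. 0) la"
      using character_weight_sum[OF la(1), of "\<lambda>la. u (central_elt la)"] u
      unfolding sum_Z by (simp add: zero_fun_def)
    then show "u v = 0"
      by (simp add: la(2) character_weight_def)
  qed
  define ind where "ind la g = (if g permutes {1..n} \<and> cycle_type n g = la then 1 else 0 :: complex)" for la g
  have span: "h \<in> funs.span (ind ` ?Y)" if h: "class_function n h" for h
  proof -
    \<comment> \<open>The value of \<open>h\<close> on the class of cycle type \<open>la\<close>.
      Should no permutation have this type, the value is arbitrary, but then \<open>ind la\<close>
      vanishes.\<close>
    define v where "v la = h (SOME g. g permutes {1..n} \<and> cycle_type n g = la)" for la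
    have "h g = (\<Sum>la\<in>?Y. v la * ind la g)" for g
    proof (cases "g permutes {1..n}")
      case True
      let ?g = "SOME g'. g' permutes {1..n} \<and> cycle_type n g' = cycle_type n g"
      have "?g permutes {1..n} \<and> cycle_type n ?g = cycle_type n g"
        by (rule someI[of "\<lambda>g'. g' permutes {1..n} \<and> cycle_type n g' = cycle_type n g" g]) (simp add: True)
      then obtain x where "x permutes {1..n}" "inv x \<circ> ?g \<circ> x = g"
        using conjugate_if_cycle_type_eq[of ?g n g] True by blast
      then have "h g = v (cycle_type n g)"
        using class_function_conj[OF h, of x ?g] by (simp add: v_def)
      also have "\<dots> = (\<Sum>la\<in>?Y. if la = cycle_type n g then v (cycle_type n g) else 0)"
        using cycle_type_in[OF True] by (simp add: finite_young_diagrams)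
      also have "\<dots> = (\<Sum>la\<in>?Y. v la * ind la g)"
        using True by (intro sum.cong) (auto simp: ind_def)
      finally show ?thesis .
    next
      case False
      then show ?thesis
        using class_function_in[OF h] by (simp add: ind_def group_algebra_def)
    qed
    then have "h = (\<Sum>la\<in>?Y. (\<lambda>x. v la * ind la x))"
      by (simp add: fun_eq_iff sum_fun_apply)
    also have "\<dots> \<in> funs.span (ind ` ?Y)"
      by (intro funs.span_sum funs.span_scale funs.span_base) auto
    finally show ?thesis .
  qed
  \<comment> \<open>Otherwise \<open>insert f Z\<close> is an independent set with one element more
    than there are diagrams, inside the span of at most that many indicators.\<close>
  have "f \<in> funs.span Z"
  proof (rule ccontr)
    assume not: "f \<notin> funs.span Z"
    have "insert f Z \<subseteq> funs.span (ind ` ?Y)"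
      using span f class_function_central_elt young_diagrams_size by (auto simp: Z_def)
    then have "card (insert f Z) \<le> card (ind ` ?Y)"
      using funs.independent_span_bound[OF _ funs.independent_insertI[OF not indep]] finite_young_diagrams
      by blast
    also have "\<dots> \<le> card ?Y"
      by (rule card_image_le[OF finite_young_diagrams])
    also have "f \<notin> Z"
      using not funs.span_base by blast
    then have "card ?Y < card (insert f Z)"
      using fin card by simp
    finally show False by simp
  qed
  then obtain u where "f = (\<Sum>v\<in>Z. (\<lambda>x. u v * v x))"
    using funs.span_finite[OF fin] by auto
  then show ?thesis
    unfolding sum_Z by (intro exI[of _ "\<lambda>la. u (central_elt la)"])
qed

section \<open>From weights to the coefficients in irreducible characters\<close>

context
  fixes n :: nat and chi :: "(nat \<Rightarrow> nat) \<Rightarrow> complex"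
  assumes conj: "\<And>x g. x permutes {1..n} \<Longrightarrow> g permutes {1..n} \<Longrightarrow> chi (inv x \<circ> g \<circ> x) = chi g"
begin

text \<open>\<open>chi\<close> may be nonzero off the permutations, so it is cut off there to become
  a class function in the group algebra; its weights do not change.\<close>

lemma character_weight_expansion:
  assumes g: "g permutes {1..n}"
  shows "chi g = (\<Sum>la\<in>young_diagrams n. character_weight n chi la / fact n * central_elt la g)"
proof -
  let ?f = "\<lambda>g. if g permutes {1..n} then chi g else 0"
  have "class_function n ?f"
    using conj by (auto simp: class_function_def group_algebra_def conj_permutes_iff)
  then obtain c where c: "?f = (\<lambda>g. \<Sum>la\<in>young_diagrams n. c la * central_elt la g)"
    using class_function_span by blast
  have "character_weight n chi la / fact n = c la" if "la \<in> young_diagrams n" for la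
  proof -
    have "character_weight n chi la = character_weight n ?f la"
      by (rule character_weight_cong) simp
    then show ?thesis
      unfolding c character_weight_sum[OF that] by simp
  qed
  then show ?thesis
    using fun_cong[OF c, of g] g by simp
qed

lemma sum_character_weight: "(\<Sum>la\<in>young_diagrams n. character_weight n chi la) = chi id"
  unfolding character_weight_expansion[OF permutes_id]
  by (intro sum.cong) (auto simp: central_elt_id[OF young_diagrams_size])

text \<open>The irreducible characters are positive multiples of the central elements, so the
  expansion in the latter gives one in the former, and \<open>character_weight_sum\<close> recovers
  each coefficient, which resolves the description. The unknown factor \<open>s la\<close> cancels
  in the product with \<open>irr_char la id\<close>.\<close>

lemma irr_coeff_mult_irr_char:
  assumes la: "la \<in> young_diagrams n"
  shows "irr_coeff n chi la * irr_char la id = character_weight n chi la"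
proof -
  let ?Y = "young_diagrams n"
  have "\<forall>mu. \<exists>s. mu \<in> ?Y \<longrightarrow> s > 0 \<and> (\<forall>g. g permutes {1..n} \<longrightarrow> irr_char mu g = central_elt mu g / complex_of_real s)"
    using irr_char_central_elt by blast
  then obtain s where s': "\<And>mu. mu \<in> ?Y \<Longrightarrow> s mu > 0 \<and>
      (\<forall>g. g permutes {1..n} \<longrightarrow> irr_char mu g = central_elt mu g / complex_of_real (s mu))"
    by metis
  then have s: "s mu > 0" "g permutes {1..n} \<Longrightarrow> irr_char mu g = central_elt mu g / complex_of_real (s mu)"
    if "mu \<in> ?Y" for mu g
    using that by blast+
  define c where "c mu = (if mu \<in> ?Y then character_weight n chi mu / fact n * complex_of_real (s mu) else 0)" for mu
  have "irr_coeff n chi = c"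
    unfolding irr_coeff_def
  proof (rule the_equality, intro conjI allI impI)
    show "c mu = 0" if "mu \<notin> ?Y" for mu
      using that by (simp add: c_def)
    show "chi g = (\<Sum>la\<in>?Y. c la * irr_char la g)" if g: "g permutes {1..n}" for g
      unfolding character_weight_expansion[OF g]
    proof (rule sum.cong[OF refl])
      fix mu assume "mu \<in> ?Y"
      then show "character_weight n chi mu / fact n * central_elt mu g = c mu * irr_char mu g"
        using s(1)[of mu] s(2)[of mu g] g by (simp add: c_def)
    qed
  next
    fix c' assume c': "(\<forall>mu. mu \<notin> ?Y \<longrightarrow> c' mu = 0) \<and>
      (\<forall>g. g permutes {1..n} \<longrightarrow> chi g = (\<Sum>la\<in>?Y. c' la * irr_char la g))"
    show "c' = c"
    proof
      fix mu
      show "c' mu = c mu"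
      proof (cases "mu \<in> ?Y")
        case True
        have "chi g = (\<Sum>la\<in>?Y. c' la / complex_of_real (s la) * central_elt la g)" if "g permutes {1..n}" for g
          using c' that s(2) by (auto intro!: sum.cong)
        then have "character_weight n chi mu =
            character_weight n (\<lambda>g. \<Sum>la\<in>?Y. c' la / complex_of_real (s la) * central_elt la g) mu"
          by (intro character_weight_cong) blast
        then show ?thesis
          unfolding character_weight_sum[OF True] using s(1)[OF True] True by (simp add: c_def)
      next
        case False
        then show ?thesis
          using c' by (simp add: c_def)
      qed
    qed
  qed
  then show ?thesis
    using la s(1)[OF la] s(2)[OF la permutes_id] central_elt_id[OF young_diagrams_size[OF la]]
    by (simp add: c_def)
qed

lemma diagram_prob_eq:
  "la \<in> young_diagrams n \<Longrightarrow> diagram_prob n chi la = Re (character_weight n chi la / chi id)"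
  by (simp add: diagram_prob_def irr_coeff_mult_irr_char)

lemma event_prob_eq:
  "event_prob n chi E = Re ((\<Sum>la | la \<in> young_diagrams n \<and> E la. character_weight n chi la) / chi id)"
proof -
  have "event_prob n chi E = (\<Sum>la | la \<in> young_diagrams n \<and> E la. Re (character_weight n chi la / chi id))"
    unfolding event_prob_def by (intro sum.cong) (auto simp: diagram_prob_eq)
  then show ?thesis
    by (simp add: sum_divide_distrib)
qed

end

section \<open>Colourings\<close>

text \<open>Words of length \<open>n\<close> in \<open>k\<close> letters, a basis of the
  \<open>n\<close>-th tensor power of a space of dimension \<open>k\<close>. Extensionality makes
  the set finite and stable under composition with permutations.\<close>

definition colourings :: "nat \<Rightarrow> nat \<Rightarrow> (nat \<Rightarrow> nat) set" where
  "colourings n k = {1..n} \<rightarrow>\<^sub>E {..<k}"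

definition invariant_colourings :: "nat \<Rightarrow> nat \<Rightarrow> (nat \<Rightarrow> nat) \<Rightarrow> (nat \<Rightarrow> nat) set" where
  "invariant_colourings n k g = {f \<in> colourings n k. f \<circ> g = f}"

lemma finite_colourings: "finite (colourings n k)"
  by (simp add: colourings_def finite_PiE)

lemma colourings_comp:
  assumes "f \<in> colourings n k" and h: "h permutes {1..n}"
  shows "f \<circ> h \<in> colourings n k"
  using assms permutes_in_image[OF h] permutes_not_in[OF h]
  by (auto simp: colourings_def PiE_iff extensional_def)

text \<open>An invariant colouring is constant on each cycle, hence amounts to a free choice of a
  colour for every cycle.\<close>

lemma card_invariant_colourings:
  assumes g: "g permutes {1..n}"
  shows "card (invariant_colourings n k g) = k ^ num_cycles n g"
proof -
  have perm: "permutation g"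
    by (rule perm_permutation[OF g])
  let ?\<Phi> = "\<lambda>F. \<lambda>x\<in>{1..n}. F (orbit g x)"
  let ?D = "orbit g ` {1..n} \<rightarrow>\<^sub>E {..<k}"
  have "bij_betw ?\<Phi> ?D (invariant_colourings n k g)"
  proof (rule bij_betw_imageI)
    show "inj_on ?\<Phi> ?D"
    proof (rule inj_onI)
      fix F F' assume F: "F \<in> ?D" "F' \<in> ?D" "?\<Phi> F = ?\<Phi> F'"
      show "F = F'"
      proof (rule PiE_ext[OF F(1,2)])
        fix C assume "C \<in> orbit g ` {1..n}"
        then show "F C = F' C"
          using fun_cong[OF F(3)] by (auto simp: restrict_def split: if_splits) metis
      qed
    qed
    show "?\<Phi> ` ?D = invariant_colourings n k g"
    proof (intro equalityI subsetI)
      fix f assume "f \<in> ?\<Phi> ` ?D"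
      then obtain F where F: "F \<in> ?D" "f = ?\<Phi> F"
        by blast
      have "f (g x) = f x" for x
        using permutes_in_image[OF g] permutes_not_in[OF g] permutation_orbit_step[OF perm]
        by (simp add: F(2))
      moreover have "f \<in> colourings n k"
        using F by (auto simp: colourings_def)
      ultimately show "f \<in> invariant_colourings n k g"
        by (simp add: invariant_colourings_def fun_eq_iff)
    next
      fix f assume f: "f \<in> invariant_colourings n k g"
      have const: "f y = f x" if "y \<in> orbit g x" for x y
        using that f by induction (auto simp: invariant_colourings_def fun_eq_iff)
      define F where "F = (\<lambda>C\<in>orbit g ` {1..n}. f (SOME y. y \<in> C))"
      have F: "F (orbit g x) = f x" if "x \<in> {1..n}" for x
      proof -
        have "(SOME y. y \<in> orbit g x) \<in> orbit g x"
          by (rule someI_ex) (use orbit_nonempty[of g x] in blast)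
        then show ?thesis
          using const that by (simp add: F_def)
      qed
      have fc: "f \<in> {1..n} \<rightarrow>\<^sub>E {..<k}"
        using f by (simp add: invariant_colourings_def colourings_def)
      have "F \<in> ?D"
        using fc F by (auto simp: F_def PiE_iff)
      moreover have "f = ?\<Phi> F"
        using F fc by (auto simp: fun_eq_iff PiE_iff extensional_def)
      ultimately show "f \<in> ?\<Phi> ` ?D"
        by blast
    qed
  qed
  then have "card (invariant_colourings n k g) = card ?D"
    by (simp add: bij_betw_same_card)
  then show ?thesis
    by (simp add: card_PiE num_cycles_def)
qed

lemma sigma_char_colourings:
  assumes "g permutes {1..n}"
  shows "sigma_char n k g = (\<Sum>f\<in>colourings n k. if f \<circ> g = f then 1 else 0)"
proof -
  have "sigma_char n k g = of_nat (card (invariant_colourings n k g))"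
    by (simp add: sigma_char_def card_invariant_colourings[OF assms])
  also have "\<dots> = (\<Sum>f\<in>invariant_colourings n k g. 1)"
    by simp
  also have "\<dots> = (\<Sum>f\<in>colourings n k. if f \<circ> g = f then 1 else 0)"
    by (rule sum.mono_neutral_cong_left) (auto simp: invariant_colourings_def finite_colourings)
  finally show ?thesis .
qed

text \<open>Composition with \<open>x\<close> matches the invariant colourings of \<open>g\<close>
  with those of its conjugate. With two colours their number is a power of 2, which determines the
  number of cycles.\<close>

lemma num_cycles_conj:
  assumes g: "g permutes {1..n}" and x: "x permutes {1..n}"
  shows "num_cycles n (inv x \<circ> g \<circ> x) = num_cycles n g"
proof -
  have h: "inv x \<circ> g \<circ> x permutes {1..n}"
    using g x by (simp add: perms_comp_iff permutes_inv)
  have "bij_betw (\<lambda>f. f \<circ> x) (invariant_colourings n 2 g) (invariant_colourings n 2 (inv x \<circ> g \<circ> x))"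
  proof (rule bij_betw_byWitness[where f' = "\<lambda>f. f \<circ> inv x"])
    show "(\<lambda>f. f \<circ> x) ` invariant_colourings n 2 g \<subseteq> invariant_colourings n 2 (inv x \<circ> g \<circ> x)"
      using colourings_comp[OF _ x]
      by (auto simp: invariant_colourings_def fun_eq_iff permutes_inverses[OF x])
    show "(\<lambda>f. f \<circ> inv x) ` invariant_colourings n 2 (inv x \<circ> g \<circ> x) \<subseteq> invariant_colourings n 2 g"
    proof (rule image_subsetI)
      fix f assume f: "f \<in> invariant_colourings n 2 (inv x \<circ> g \<circ> x)"
      then have inv: "f \<circ> (inv x \<circ> g \<circ> x) = f"
        by (simp only: invariant_colourings_def mem_Collect_eq)
      have "f (inv x (g y)) = f (inv x y)" for y
        using fun_cong[OF inv, of "inv x y"] by (simp add: permutes_inverses[OF x])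
      then show "f \<circ> inv x \<in> invariant_colourings n 2 g"
        using colourings_comp[OF _ permutes_inv[OF x], of f] f
        by (auto simp: invariant_colourings_def fun_eq_iff)
    qed
  qed (auto simp: perm_cancel[OF x])
  then have "(2::nat) ^ num_cycles n (inv x \<circ> g \<circ> x) = 2 ^ num_cycles n g"
    using bij_betw_same_card by (metis card_invariant_colourings[OF g] card_invariant_colourings[OF h])
  then show ?thesis
    by simp
qed

lemma sigma_char_conj:
  assumes "x permutes {1..n}" "g permutes {1..n}"
  shows "sigma_char n k (inv x \<circ> g \<circ> x) = sigma_char n k g"
  by (simp add: sigma_char_def num_cycles_conj assms)

lemma tau_char_conj:
  assumes "x permutes {1..n}" "g permutes {1..n}"
  shows "tau_char n k (inv x \<circ> g \<circ> x) = tau_char n k g"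
  by (simp add: tau_char_def sigma_char_conj assms)

lemma num_cycles_id: "num_cycles n id = n"
proof -
  have "orbit id x = {x}" for x :: nat
    by (simp add: orbit_eq_singleton_iff)
  then have "orbit id ` {1..n} = (\<lambda>x. {x}) ` {1..n}"
    by simp
  then show ?thesis
    by (simp add: num_cycles_def card_image)
qed

text \<open>The weights are nonnegative because \<open>sigma_char\<close> is the character of the permutation
  action on colourings: with \<open>z\<close> proportional to \<open>z z\<close>, the weight becomes a sum of squares.\<close>

lemma character_weight_sigma_nonneg:
  assumes la: "la \<in> young_diagrams n"
  shows "\<exists>r\<ge>0. character_weight n (sigma_char n k) la = complex_of_real r"
proof -
  note size = young_diagrams_size[OF la]
  let ?F = "colourings n k"
  define z where "z h = Re (central_elt la h)" for h
  have z: "central_elt la h = complex_of_real (z h)" for h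
    using cnj_central_elt[of la h] by (simp add: z_def complex_eq_iff)
  define s where "s = (\<Sum>f\<in>?F. \<Sum>\<phi>\<in>?F. (\<Sum>h\<in>perms n. if f \<circ> h = \<phi> then z h else 0)\<^sup>2)"
  \<comment> \<open>A colouring is fixed by \<open>u \<circ> inv h\<close> exactly if its composites
    with \<open>h\<close> and \<open>u\<close> coincide. Summing over the common value \<phi>
    separates the dependence on \<open>h\<close> from that on \<open>u\<close>.\<close>
  have swap: "sigma_char n k (u \<circ> inv h) = complex_of_real
      (\<Sum>f\<in>?F. \<Sum>\<phi>\<in>?F. (if f \<circ> h = \<phi> then 1 else 0) * (if f \<circ> u = \<phi> then 1 else 0))"
    if h: "h permutes {1..n}" and u: "u permutes {1..n}" for h u
  proof -
    have "f \<circ> (u \<circ> inv h) = f \<longleftrightarrow> f \<circ> u = f \<circ> h" for f :: "nat \<Rightarrow> nat"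
    proof
      assume "f \<circ> (u \<circ> inv h) = f"
      then have "f \<circ> u \<circ> inv h \<circ> h = f \<circ> h"
        by (simp add: o_assoc)
      then show "f \<circ> u = f \<circ> h"
        by (simp add: perm_cancel(4)[OF h])
    next
      assume "f \<circ> u = f \<circ> h"
      then have "f \<circ> u \<circ> inv h = f \<circ> h \<circ> inv h"
        by simp
      then show "f \<circ> (u \<circ> inv h) = f"
        by (simp add: perm_cancel(3)[OF h] o_assoc)
    qed
    moreover have "(\<Sum>\<phi>\<in>?F. (if f \<circ> h = \<phi> then 1 else 0) * (if f \<circ> u = \<phi> then 1 else (0::real))) =
        (if f \<circ> u = f \<circ> h then 1 else 0)" if "f \<in> ?F" for f
    proof -
      have "(\<Sum>\<phi>\<in>?F. (if f \<circ> h = \<phi> then 1 else 0) * (if f \<circ> u = \<phi> then 1 else (0::real))) =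
          (\<Sum>\<phi>\<in>?F. if \<phi> = f \<circ> h then if f \<circ> u = f \<circ> h then 1 else 0 else 0)"
        by (intro sum.cong) auto
      then show ?thesis
        using colourings_comp[OF that h] by (simp add: finite_colourings)
    qed
    moreover have "u \<circ> inv h permutes {1..n}"
      using h u by (simp add: perms_comp_iff permutes_inv)
    ultimately show ?thesis
      by (simp add: sigma_char_colourings if_distrib[of complex_of_real] cong: if_cong)
  qed
  have "complex_of_real (central_scale la) * convolution n (sigma_char n k) (central_elt la) id =
      convolution n (sigma_char n k) (convolution n (central_elt la) (central_elt la)) id"
    by (simp add: central_elt_central_elt[OF la] convolution_scale_right)
  also have "\<dots> = (\<Sum>g\<in>perms n. \<Sum>h\<in>perms n. sigma_char n k g * (central_elt la h * central_elt la (g \<circ> h)))"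
    unfolding convolution_def sum_distrib_left
  proof (intro sum.cong refl)
    fix g h assume "g \<in> perms n" "h \<in> perms n"
    then have g: "g permutes {1..n}" and h: "h permutes {1..n}"
      by simp_all
    have "central_elt la (inv (g \<circ> h)) = central_elt la (g \<circ> h)"
      by (rule central_elt_inv[OF size]) (use g h permutes_compose in blast)
    then show "sigma_char n k g * (central_elt la h * central_elt la (inv h \<circ> (inv g \<circ> id))) =
        sigma_char n k g * (central_elt la h * central_elt la (g \<circ> h))"
      by (simp add: inv_comp_perm[OF g h])
  qed
  also have "\<dots> = (\<Sum>h\<in>perms n. \<Sum>g\<in>perms n. sigma_char n k g * (central_elt la h * central_elt la (g \<circ> h)))"
    by (rule sum.swap)
  also have "\<dots> = (\<Sum>h\<in>perms n. \<Sum>u\<in>perms n. sigma_char n k (u \<circ> inv h) * (central_elt la h * central_elt la u))"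
  proof (rule sum.cong[OF refl])
    fix h assume "h \<in> perms n"
    then have h: "h permutes {1..n}" by simp
    show "(\<Sum>g\<in>perms n. sigma_char n k g * (central_elt la h * central_elt la (g \<circ> h))) =
        (\<Sum>u\<in>perms n. sigma_char n k (u \<circ> inv h) * (central_elt la h * central_elt la u))"
      using sum_perms_right[OF h, of "\<lambda>u. sigma_char n k (u \<circ> inv h) * (central_elt la h * central_elt la u)"]
      by (simp add: perm_cancel(3)[OF h])
  qed
  also have "\<dots> = (\<Sum>h\<in>perms n. \<Sum>u\<in>perms n. complex_of_real (\<Sum>f\<in>?F. \<Sum>\<phi>\<in>?F.
      (if f \<circ> h = \<phi> then z h else 0) * (if f \<circ> u = \<phi> then z u else 0)))"
  proof (intro sum.cong refl)
    fix h u assume "h \<in> perms n" "u \<in> perms n"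
    then have "sigma_char n k (u \<circ> inv h) * (central_elt la h * central_elt la u) = complex_of_real
      ((\<Sum>f\<in>?F. \<Sum>\<phi>\<in>?F. (if f \<circ> h = \<phi> then 1 else 0) * (if f \<circ> u = \<phi> then 1 else 0)) * (z h * z u))"
      by (simp only: swap mem_Collect_eq z of_real_mult)
    also have "\<dots> = complex_of_real (\<Sum>f\<in>?F. \<Sum>\<phi>\<in>?F.
      (if f \<circ> h = \<phi> then z h else 0) * (if f \<circ> u = \<phi> then z u else 0))"
      unfolding sum_distrib_right by (intro arg_cong[where f = complex_of_real] sum.cong refl) auto
    finally show "sigma_char n k (u \<circ> inv h) * (central_elt la h * central_elt la u) = complex_of_real
      (\<Sum>f\<in>?F. \<Sum>\<phi>\<in>?F. (if f \<circ> h = \<phi> then z h else 0) * (if f \<circ> u = \<phi> then z u else 0))" .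
  qed
  also have "\<dots> = complex_of_real (\<Sum>h\<in>perms n. \<Sum>u\<in>perms n. \<Sum>f\<in>?F. \<Sum>\<phi>\<in>?F.
      (if f \<circ> h = \<phi> then z h else 0) * (if f \<circ> u = \<phi> then z u else 0))"
    by (simp only: of_real_sum)
  also have "(\<Sum>h\<in>perms n. \<Sum>u\<in>perms n. \<Sum>f\<in>?F. \<Sum>\<phi>\<in>?F.
      (if f \<circ> h = \<phi> then z h else 0) * (if f \<circ> u = \<phi> then z u else 0)) =
    (\<Sum>h\<in>perms n. \<Sum>f\<in>?F. \<Sum>\<phi>\<in>?F. \<Sum>u\<in>perms n.
      (if f \<circ> h = \<phi> then z h else 0) * (if f \<circ> u = \<phi> then z u else 0))"
    by (subst sum.swap, subst sum.swap) (rule refl)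
  also have "\<dots> = (\<Sum>f\<in>?F. \<Sum>\<phi>\<in>?F. \<Sum>h\<in>perms n. \<Sum>u\<in>perms n.
      (if f \<circ> h = \<phi> then z h else 0) * (if f \<circ> u = \<phi> then z u else 0))"
    by (subst sum.swap, subst sum.swap) (rule refl)
  also have "\<dots> = s"
    by (simp add: s_def power2_eq_square sum_product)
  finally have "convolution n (sigma_char n k) (central_elt la) id = complex_of_real s / complex_of_real (central_scale la)"
    using central_scale_pos[OF la] by (metis nonzero_mult_div_cancel_left of_real_eq_0_iff less_irrefl)
  \<comment> \<open>One factor \<open>central_scale la\<close> stems from replacing \<open>z\<close>
    by \<open>z z\<close>, the other from the definition of the weight.\<close>
  then have "character_weight n (sigma_char n k) la = complex_of_real (s / (central_scale la)\<^sup>2)"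
    by (simp add: character_weight_def power2_eq_square)
  moreover have "s \<ge> 0"
    by (simp add: s_def sum_nonneg)
  ultimately show ?thesis
    by (intro exI[of _ "s / (central_scale la)\<^sup>2"]) simp
qed

section \<open>The sign character and the symmetry of \<open>tau_char\<close>\<close>

text \<open>The new permutation fixes \<open>x\<close> and closes up the rest of its cycle. Its
  invariant 2-colourings are those of \<open>g\<close> with the colour of \<open>x\<close> made
  free, so their number doubles.\<close>

lemma num_cycles_split:
  assumes g: "g permutes {1..n}" and x: "g x \<noteq> x"
  shows "num_cycles n (transpose x (g x) \<circ> g) = Suc (num_cycles n g)"
proof -
  let ?g = "transpose x (g x) \<circ> g"
  have xn: "x \<in> {1..n}" "g x \<in> {1..n}"
    using permutes_not_in[OF g, of x] permutes_in_image[OF g] x by blast+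
  have g': "?g permutes {1..n}"
    using permutes_compose[OF g permutes_swap_id[OF xn]] .
  have inj: "g y = g z \<longleftrightarrow> y = z" for y z
    using permutes_inj[OF g] by (simp add: inj_eq)
  have step: "?g y = (if y = x then x else if g y = x then g x else g y)" for y
    by (auto simp: transpose_def inj x)
  have "bij_betw (\<lambda>(f, c). f(x := c)) (invariant_colourings n 2 g \<times> {..<2}) (invariant_colourings n 2 ?g)"
  proof (rule bij_betw_byWitness[where f' = "\<lambda>f. (f(x := f (g x)), f x)"])
    show "\<forall>a\<in>invariant_colourings n 2 g \<times> {..<2}.
        (\<lambda>f. (f(x := f (g x)), f x)) ((\<lambda>(f, c). f(x := c)) a) = a"
    proof
      fix a assume "a \<in> invariant_colourings n 2 g \<times> {..<2::nat}"
      then obtain f c where a: "a = (f, c)" "f \<circ> g = f"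
        by (auto simp: invariant_colourings_def)
      have "f (g x) = f x"
        using fun_cong[OF a(2), of x] by simp
      then show "(\<lambda>f. (f(x := f (g x)), f x)) ((\<lambda>(f, c). f(x := c)) a) = a"
        using x by (auto simp: a(1) fun_eq_iff)
    qed
    show "\<forall>f\<in>invariant_colourings n 2 ?g. (\<lambda>(f, c). f(x := c)) (f(x := f (g x)), f x) = f"
      by auto
    show "(\<lambda>(f, c). f(x := c)) ` (invariant_colourings n 2 g \<times> {..<2}) \<subseteq> invariant_colourings n 2 ?g"
    proof (rule image_subsetI)
      fix a assume "a \<in> invariant_colourings n 2 g \<times> {..<2::nat}"
      then obtain f c where a: "a = (f, c)" "f \<circ> g = f" "f \<in> colourings n 2" "c < 2"
        by (auto simp: invariant_colourings_def)
      have fg: "f (g y) = f y" for y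
        using fun_cong[OF a(2), of y] by simp
      have "(f(x := c)) (?g y) = (f(x := c)) y" for y
        unfolding step using fg[of y] fg[of x] x by auto
      moreover have "f(x := c) \<in> colourings n 2"
        using a(3,4) xn by (auto simp: colourings_def PiE_iff extensional_def)
      ultimately show "(\<lambda>(f, c). f(x := c)) a \<in> invariant_colourings n 2 ?g"
        by (simp add: a(1) invariant_colourings_def fun_eq_iff)
    qed
    show "(\<lambda>f. (f(x := f (g x)), f x)) ` invariant_colourings n 2 ?g \<subseteq> invariant_colourings n 2 g \<times> {..<2}"
    proof (rule image_subsetI)
      fix f assume "f \<in> invariant_colourings n 2 ?g"
      then have f: "f \<circ> ?g = f" "f \<in> colourings n 2"
        by (simp_all only: invariant_colourings_def mem_Collect_eq)
      have fg: "f (if y = x then x else if g y = x then g x else g y) = f y" for y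
        using fun_cong[OF f(1), of y] unfolding step[symmetric] by simp
      have "(f(x := f (g x))) (g y) = (f(x := f (g x))) y" for y
        using fg[of y] x by (auto split: if_splits)
      moreover have "f(x := f (g x)) \<in> colourings n 2" "f x < 2"
        using f(2) xn by (auto simp: colourings_def PiE_iff extensional_def)
      ultimately show "(f(x := f (g x)), f x) \<in> invariant_colourings n 2 g \<times> {..<2}"
        by (simp add: invariant_colourings_def fun_eq_iff)
    qed
  qed
  then have "card (invariant_colourings n 2 ?g) = card (invariant_colourings n 2 g \<times> {..<2::nat})"
    by (simp only: bij_betw_same_card)
  then have "(2::nat) ^ num_cycles n ?g = 2 ^ Suc (num_cycles n g)"
    by (simp only: card_cartesian_product card_invariant_colourings[OF g] card_invariant_colourings[OF g']) simp
  then show ?thesis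
    by (simp only: power_inject_exp)
qed

text \<open>Splitting off a moved point reverses the sign and adds one cycle, so the left-hand side
  is unchanged while fewer points are moved; the identity, with \<open>n\<close> cycles, is the base
  case.\<close>

lemma sign_num_cycles:
  assumes "g permutes {1..n}"
  shows "sign g * (-1) ^ num_cycles n g = (-1) ^ n"
  using assms
proof (induction "card {x. g x \<noteq> x}" arbitrary: g rule: less_induct)
  case less
  show ?case
  proof (cases "g = id")
    case True
    then show ?thesis
      by (simp only: num_cycles_id sign_id mult_1)
  next
    case False
    then obtain x where x: "g x \<noteq> x"
      by (auto simp: fun_eq_iff)
    let ?t = "transpose x (g x)"
    have xn: "x \<in> {1..n}" "g x \<in> {1..n}"
      using permutes_not_in[OF less.prems, of x] permutes_in_image[OF less.prems] x by blast+
    have t: "?t permutes {1..n}"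
      by (rule permutes_swap_id[OF xn])
    have fin: "finite {x. g x \<noteq> x}"
      by (rule finite_subset[of _ "{1..n}"]) (use permutes_not_in[OF less.prems] in blast, simp)
    have inj: "g y = g x \<longleftrightarrow> y = x" for y
      using permutes_inj[OF less.prems] by (simp add: inj_eq)
    have "y \<in> {x. g x \<noteq> x}" if "(?t \<circ> g) y \<noteq> y" for y
      using that x inj[of y] by (auto simp: transpose_def split: if_splits)
    moreover have "(?t \<circ> g) x = x"
      by simp
    ultimately have "{y. (?t \<circ> g) y \<noteq> y} \<subset> {x. g x \<noteq> x}"
      using x by blast
    then have "card {y. (?t \<circ> g) y \<noteq> y} < card {x. g x \<noteq> x}"
      by (rule psubset_card_mono[OF fin])
    then have "sign (?t \<circ> g) * (-1) ^ num_cycles n (?t \<circ> g) = (-1) ^ n"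
      by (rule less.hyps) (rule permutes_compose[OF less.prems t])
    moreover have "sign (?t \<circ> g) = - sign g"
      using x by (simp add: sign_compose[OF perm_permutation[OF t] perm_permutation[OF less.prems]] sign_swap_id)
    ultimately show ?thesis
      by (simp add: num_cycles_split[OF less.prems x])
  qed
qed

text \<open>The sum is the backward difference of order \<open>N\<close> of the power of degree
  \<open>l\<close>, taken at \<open>x\<close>. Pascal's rule reduces the order by one and replaces
  the power by its first difference, a polynomial of smaller degree.\<close>

lemma sum_alternating_choose_power_eq_0:
  fixes x :: "'a::comm_ring_1"
  assumes "l < N"
  shows "(\<Sum>j\<le>N. (-1) ^ j * of_nat (N choose j) * (x - of_nat j) ^ l) = 0"
  using assms
proof (induction N arbitrary: x l)
  case (Suc N)
  let ?s = "\<lambda>N x l. \<Sum>j\<le>N. (-1) ^ j * of_nat (N choose j) * (x - of_nat j :: 'a) ^ l"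
  have "?s (Suc N) x l = x ^ l + (\<Sum>j\<le>N. (-1) ^ Suc j * of_nat (Suc N choose Suc j) * (x - of_nat (Suc j)) ^ l)"
    by (subst sum.atMost_Suc_shift) simp
  also have "(\<Sum>j\<le>N. (-1) ^ Suc j * of_nat (Suc N choose Suc j) * (x - of_nat (Suc j)) ^ l) =
      - ?s N (x - 1) l + (\<Sum>j\<le>N. (-1) ^ Suc j * of_nat (N choose Suc j) * (x - of_nat (Suc j)) ^ l)"
    unfolding sum_negf[symmetric] sum.distrib[symmetric] by (intro sum.cong) (auto simp: algebra_simps)
  also have "x ^ l + (- ?s N (x - 1) l + (\<Sum>j\<le>N. (-1) ^ Suc j * of_nat (N choose Suc j) * (x - of_nat (Suc j)) ^ l)) =
      - ?s N (x - 1) l + (\<Sum>j\<le>Suc N. (-1) ^ j * of_nat (N choose j) * (x - of_nat j) ^ l)"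
    by (subst sum.atMost_Suc_shift) simp
  also have "(\<Sum>j\<le>Suc N. (-1) ^ j * of_nat (N choose j) * (x - of_nat j) ^ l) = ?s N x l"
    by (simp add: binomial_eq_0)
  also have "- ?s N (x - 1) l + ?s N x l =
      (\<Sum>j\<le>N. (-1) ^ j * of_nat (N choose j) * ((x - of_nat j) ^ l - (x - 1 - of_nat j) ^ l))"
    unfolding sum_negf[symmetric] sum.distrib[symmetric] by (intro sum.cong) (auto simp: algebra_simps)
  also have "\<dots> = (\<Sum>j\<le>N. \<Sum>i<l. of_nat (l choose i) * ((-1) ^ j * of_nat (N choose j) * (x - 1 - of_nat j) ^ i))"
  proof (rule sum.cong[OF refl])
    fix j
    have "(x - of_nat j) ^ l = ((x - 1 - of_nat j) + 1) ^ l"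
      by simp
    also have "\<dots> = (\<Sum>i\<le>l. of_nat (l choose i) * (x - 1 - of_nat j) ^ i)"
      by (subst binomial_ring) simp
    also have "\<dots> = (\<Sum>i<l. of_nat (l choose i) * (x - 1 - of_nat j) ^ i) + (x - 1 - of_nat j) ^ l"
      by (simp add: lessThan_Suc_atMost[symmetric])
    finally show "(-1) ^ j * of_nat (N choose j) * ((x - of_nat j) ^ l - (x - 1 - of_nat j) ^ l) =
        (\<Sum>i<l. of_nat (l choose i) * ((-1) ^ j * of_nat (N choose j) * (x - 1 - of_nat j) ^ i))"
      by (simp add: sum_distrib_left mult_ac)
  qed
  also have "\<dots> = (\<Sum>i<l. of_nat (l choose i) * ?s N (x - 1) i)"
    by (subst sum.swap) (simp add: sum_distrib_left)
  also have "\<dots> = 0"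
    using Suc.prems by (intro sum.neutral ballI) (simp add: Suc.IH)
  finally show ?case .
qed simp

text \<open>The exponent, the number of cycles, is at most \<open>n\<close>, so the alternating sum
  over all \<open>j\<close> up to \<open>n + 1\<close> vanishes. Its terms with \<open>j < k\<close>
  form \<open>tau_char n k\<close>, the term \<open>j = k\<close> is zero because the exponent is
  positive, and reversing the order of the others gives the sum for \<open>n + 1 - k\<close>; the
  signs combine to \<open>sign g\<close>.\<close>

lemma tau_char_symmetry:
  assumes k: "1 \<le> k" "k \<le> n" and g: "g permutes {1..n}"
  shows "tau_char n k g = of_int (sign g) * tau_char n (n + 1 - k) g"
proof -
  let ?l = "num_cycles n g"
  let ?t = "\<lambda>j. (-1) ^ j * of_nat ((n + 1) choose j) * (of_nat k - of_nat j :: complex) ^ ?l"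
  have l: "?l \<le> n" "?l > 0"
    using card_image_le[of "{1..n}" "orbit g"] k by (auto simp: num_cycles_def card_gt_0_iff)
  have sgn: "of_int (sign g) * (-1) ^ ?l = ((-1) ^ n :: complex)"
    using arg_cong[OF sign_num_cycles[OF g], of "of_int :: int \<Rightarrow> complex"] by simp
  have "(\<Sum>j\<le>n + 1. ?t j) = 0"
    using sum_alternating_choose_power_eq_0[of ?l "n + 1" "of_nat k :: complex"] l by simp
  moreover have "{..n + 1} = {..<k} \<union> insert k {k<..n + 1}"
    using k by auto
  then have "(\<Sum>j\<le>n + 1. ?t j) = (\<Sum>j<k. ?t j) + (?t k + (\<Sum>j\<in>{k<..n + 1}. ?t j))"
    by (simp only:) (subst sum.union_disjoint; auto)
  moreover have "?t k = 0"
    using l by simp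
  ultimately have "(\<Sum>j<k. ?t j) = - (\<Sum>j\<in>{k<..n + 1}. ?t j)"
    by (metis (no_types, lifting) add_0 eq_neg_iff_add_eq_0)
  also have "(\<Sum>j\<in>{k<..n + 1}. ?t j) = (\<Sum>i<n + 1 - k. ?t (n + 1 - i))"
    by (rule sum.reindex_bij_witness[where i = "\<lambda>i. n + 1 - i" and j = "\<lambda>j. n + 1 - j"]) auto
  also have "- \<dots> = (\<Sum>i<n + 1 - k. of_int (sign g) * ((-1) ^ i * of_nat ((n + 1) choose i) *
      of_nat (n + 1 - k - i) ^ ?l))"
    unfolding sum_negf[symmetric]
  proof (rule sum.cong[OF refl])
    fix i assume i: "i \<in> {..<n + 1 - k}"
    have "of_nat k - of_nat (n + 1 - i) = (-1 :: complex) * of_nat (n + 1 - k - i)"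
      using i k by (simp add: of_nat_diff)
    then have "(of_nat k - of_nat (n + 1 - i) :: complex) ^ ?l = (-1) ^ ?l * of_nat (n + 1 - k - i) ^ ?l"
      by (simp only: power_mult_distrib)
    moreover have "(n + 1) choose (n + 1 - i) = (n + 1) choose i"
      using i k by (intro binomial_symmetric[symmetric]) auto
    moreover have "- ((-1) ^ (n + 1 - i)) = ((-1) ^ n * (-1) ^ i :: complex)"
      using i k by (auto simp: minus_one_power_iff)
    ultimately have "- ?t (n + 1 - i) = ((-1) ^ n * (-1) ^ i) * of_nat ((n + 1) choose i) *
        ((-1) ^ ?l * of_nat (n + 1 - k - i) ^ ?l)"
      by (metis (no_types, lifting) mult_minus_left)
    also have "\<dots> = of_int (sign g) * ((-1) ^ i * of_nat ((n + 1) choose i) * of_nat (n + 1 - k - i) ^ ?l)"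
      by (simp add: sgn[symmetric] flip: power_mult_distrib)
    finally show "- ?t (n + 1 - i) = \<dots>" .
  qed
  also have "\<dots> = of_int (sign g) * tau_char n (n + 1 - k) g"
    by (simp add: tau_char_def sigma_char_def sum_distrib_left)
  also have "(\<Sum>j<k. ?t j) = tau_char n k g"
    unfolding tau_char_def sigma_char_def by (intro sum.cong) (auto simp: of_nat_diff)
  finally show ?thesis .
qed

section \<open>Conjugate diagrams\<close>

definition conjugate :: "nat list \<Rightarrow> nat list" where
  "conjugate la = map (\<lambda>j. col_length la (Suc j)) [0..<row_length la 1]"

lemma boxes_conjugate_iff:
  assumes la: "la \<in> young_diagrams n"
  shows "(j, i) \<in> boxes (conjugate la) \<longleftrightarrow> (i, j) \<in> boxes la"
proof -
  have "(i, j) \<in> boxes la \<longleftrightarrow> 1 \<le> i \<and> i \<le> col_length la j"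
    using column_eq[OF la, of j] by (auto simp: set_eq_iff)
  moreover have "1 \<le> j \<and> j \<le> row_length la 1" if "(i, j) \<in> boxes la"
    using boxes_up[OF la that, of 1] that boxes_row_length[of 1 j la] boxes_iff[of i j la] by auto
  ultimately show ?thesis
    unfolding boxes_iff[of j i "conjugate la"] unfolding conjugate_def by (cases j) auto
qed

lemma boxes_conjugate:
  assumes "la \<in> young_diagrams n"
  shows "boxes (conjugate la) = prod.swap ` boxes la"
proof (rule set_eqI)
  fix p show "p \<in> boxes (conjugate la) \<longleftrightarrow> p \<in> prod.swap ` boxes la"
    by (cases p) (simp only: pair_in_swap_image boxes_conjugate_iff[OF assms])
qed

lemma conjugate_in:
  assumes la: "la \<in> young_diagrams n"
  shows "conjugate la \<in> young_diagrams n"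
proof -
  have mono: "col_length la (Suc j) \<le> col_length la (Suc i)" if "i \<le> j" for i j
  proof -
    have "{a. (a, Suc j) \<in> boxes la} \<subseteq> {a. (a, Suc i) \<in> boxes la}"
      using that by (auto simp: boxes_iff)
    moreover have "finite {a. (a, Suc i) \<in> boxes la}"
      by (simp add: column_eq[OF la])
    ultimately show ?thesis
      unfolding col_length_def by (intro card_mono)
  qed
  have "sorted_wrt (\<ge>) (conjugate la)"
    unfolding conjugate_def by (auto simp: sorted_wrt_iff_nth_less intro!: mono)
  moreover have "col_length la (Suc j) \<noteq> 0" if "j < row_length la 1" for j
  proof -
    have "(1, Suc j) \<in> boxes la"
      using that by (simp add: boxes_row_length)
    then show ?thesis
      using column_eq[OF la, of "Suc j"] by (auto simp: set_eq_iff)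
  qed
  then have "0 \<notin> set (conjugate la)"
    by (fastforce simp: conjugate_def)
  moreover have "sum_list (conjugate la) = n"
    using card_boxes[of "conjugate la"] card_boxes[of la] young_diagrams_size[OF la]
    by (simp add: boxes_conjugate[OF la] card_image)
  ultimately show ?thesis
    by (simp add: young_diagrams_def)
qed

lemma conjugate_conjugate:
  assumes "la \<in> young_diagrams n"
  shows "conjugate (conjugate la) = la"
proof (rule boxes_eqD)
  show "boxes (conjugate (conjugate la)) = boxes la"
    by (simp add: boxes_conjugate[OF conjugate_in[OF assms]] boxes_conjugate[OF assms] image_image)
qed (rule conjugate_in[OF conjugate_in[OF assms]] assms)+

lemma sign_square: "sign p * sign p = (1 :: int)"
  by (simp add: sign_def)

lemma sign_mult_inv:
  assumes "g permutes {1..n::nat}"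
  shows "of_int (sign g) * (c * (of_int (sign (inv g)) * d)) = (c * d :: complex)"
  using sign_mult_self[of g] by (simp add: sign_inverse[OF perm_permutation[OF assms]] mult_ac(2,3))

text \<open>Exchanging the side coordinates \<open>u\<close> and \<open>v\<close> negates
  \<open>v - u\<close> and keeps \<open>u + v\<close>.\<close>

lemma box_square_swap: "(x, y) \<in> box_square j i \<longleftrightarrow> (- x, y) \<in> box_square i j"
proof -
  have *: "(- x, y) \<in> box_square i j" if "(x, y) \<in> box_square j i" for x y i j
  proof -
    obtain u v where "x = v - u" "y = u + v" "real j - 1 \<le> u" "u \<le> real j" "real i - 1 \<le> v" "v \<le> real i"
      using \<open>(x, y) \<in> box_square j i\<close> by (auto simp: box_square_def)
    then show ?thesis
      unfolding box_square_def mem_Collect_eq by (intro exI[of _ v] exI[of _ u]) simp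
  qed
  show ?thesis
    using *[of x y j i] *[of "- x" y i j] by auto
qed

lemma profile_conjugate:
  assumes la: "la \<in> young_diagrams n"
  shows "profile (conjugate la) x = profile la (- x)"
proof -
  have "(\<exists>(i, j)\<in>boxes (conjugate la). (x, y) \<in> box_square i j) \<longleftrightarrow>
      (\<exists>(i, j)\<in>boxes la. (- x, y) \<in> box_square i j)" for y
    by (simp add: boxes_conjugate[OF la] case_prod_beta box_square_swap[of x y "snd p" "fst p" for p])
  then show ?thesis
    by (simp add: profile_def)
qed

section \<open>The symmetrizer and the central element of the conjugate diagram\<close>

context
  fixes la n
  assumes la: "la \<in> young_diagrams n"
begin

private lemma conj_size: "sum_list la = n" "sum_list (conjugate la) = n"
  using la conjugate_in[OF la] by (simp_all add: young_diagrams_size)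

text \<open>The row-wise filling of the conjugate diagram need not be the transpose of the row-wise
  filling of \<open>la\<close>; \<open>flip\<close> is the relabelling of entries between the two.
  Hence symmetrizers are compared only up to conjugation by it.\<close>

private definition flip :: "nat \<Rightarrow> nat" where
  "flip x = (if x \<in> {1..n} then tableau (conjugate la) (col_of la x) (row_of la x) else x)"

private lemma flip_box: "x \<in> {1..n} \<Longrightarrow> (col_of la x, row_of la x) \<in> boxes (conjugate la)"
  using row_col_in_boxes[of x la] by (simp add: boxes_conjugate_iff[OF la] conj_size)

private lemma flip_props:
  assumes "x \<in> {1..n}"
  shows "flip x \<in> {1..n}" "row_of (conjugate la) (flip x) = col_of la x" "col_of (conjugate la) (flip x) = row_of la x"
  using row_col_tableau[OF flip_box[OF assms]] assms by (simp_all add: flip_def conj_size)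

private lemma flip_perm: "flip permutes {1..n}"
proof -
  have "inj_on flip {1..n}"
  proof (rule inj_onI)
    fix x y assume xy: "x \<in> {1..n}" "y \<in> {1..n}" "flip x = flip y"
    then have "tableau la (row_of la x) (col_of la x) = tableau la (row_of la y) (col_of la y)"
      using flip_props[of x] flip_props[of y] by simp
    then show "x = y"
      by (simp only: tableau_row_col[of _ la, unfolded conj_size, OF xy(1)]
          tableau_row_col[of _ la, unfolded conj_size, OF xy(2)])
  qed
  moreover have "flip ` {1..n} \<subseteq> {1..n}"
    using flip_props(1) by blast
  ultimately have "bij_betw flip {1..n} {1..n}"
    by (simp add: bij_betw_def endo_inj_surj)
  then show ?thesis
    by (rule bij_imp_permutes) (auto simp: flip_def)
qed

private lemma inv_flip_in: "x \<in> {1..n} \<Longrightarrow> inv flip x \<in> {1..n}"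
  using permutes_in_image[OF permutes_inv[OF flip_perm]] by blast

private lemma inv_flip_props:
  assumes "x \<in> {1..n}"
  shows "row_of (conjugate la) x = col_of la (inv flip x)" "col_of (conjugate la) x = row_of la (inv flip x)"
  using flip_props(2,3)[OF inv_flip_in[OF assms]] by (simp_all add: permutes_inverses[OF flip_perm])

private lemma flip_conj_perm: "flip \<circ> p \<circ> inv flip permutes {1..n} \<longleftrightarrow> p permutes {1..n}"
  using flip_perm by (simp add: perms_comp_iff permutes_inv)

private lemma row_group_conjugate: "flip \<circ> p \<circ> inv flip \<in> row_group (conjugate la) \<longleftrightarrow> p \<in> column_group la"
proof (cases "p permutes {1..n}")
  case True
  have p_in: "p x \<in> {1..n}" if "x \<in> {1..n}" for x
    using permutes_in_image[OF True] that by blast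
  have "(\<forall>x\<in>{1..n}. row_of (conjugate la) (flip (p (inv flip x))) = row_of (conjugate la) x) \<longleftrightarrow>
      (\<forall>x\<in>{1..n}. col_of la (p (inv flip x)) = col_of la (inv flip x))"
    by (rule ball_cong[OF refl]) (simp only: flip_props inv_flip_props p_in inv_flip_in permutes_inverses[OF flip_perm])
  also have "\<dots> \<longleftrightarrow> (\<forall>x\<in>{1..n}. col_of la (p x) = col_of la x)"
    using inv_flip_in flip_props(1) permutes_inverses[OF flip_perm] by metis
  finally show ?thesis
    using True unfolding row_group_stabilizer column_group_stabilizer colour_stabilizer_def conj_size
    by (simp add: flip_conj_perm)
next
  case False
  then show ?thesis
    unfolding row_group_stabilizer column_group_stabilizer colour_stabilizer_def conj_size
    by (simp add: flip_conj_perm)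
qed

private lemma column_group_conjugate: "flip \<circ> p \<circ> inv flip \<in> column_group (conjugate la) \<longleftrightarrow> p \<in> row_group la"
proof (cases "p permutes {1..n}")
  case True
  have p_in: "p x \<in> {1..n}" if "x \<in> {1..n}" for x
    using permutes_in_image[OF True] that by blast
  have "(\<forall>x\<in>{1..n}. col_of (conjugate la) (flip (p (inv flip x))) = col_of (conjugate la) x) \<longleftrightarrow>
      (\<forall>x\<in>{1..n}. row_of la (p (inv flip x)) = row_of la (inv flip x))"
    by (rule ball_cong[OF refl]) (simp only: flip_props inv_flip_props p_in inv_flip_in permutes_inverses[OF flip_perm])
  also have "\<dots> \<longleftrightarrow> (\<forall>x\<in>{1..n}. row_of la (p x) = row_of la x)"
    using inv_flip_in flip_props(1) permutes_inverses[OF flip_perm] by metis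
  finally show ?thesis
    using True unfolding row_group_stabilizer column_group_stabilizer colour_stabilizer_def conj_size
    by (simp add: flip_conj_perm)
next
  case False
  then show ?thesis
    unfolding row_group_stabilizer column_group_stabilizer colour_stabilizer_def conj_size
    by (simp add: flip_conj_perm)
qed

text \<open>In the conjugate diagram the signs sit on the row group of \<open>la\<close>. The signs
  of the two factors of \<open>g\<close> multiply to \<open>sign g\<close>, so extracting it moves
  them to the column group, with the column factor now on the left.\<close>

private lemma young_symmetrizer_conjugate:
  assumes g: "g permutes {1..n}"
  shows "young_symmetrizer (conjugate la) (flip \<circ> g \<circ> inv flip) =
    of_int (sign g) * convolution n (col_alt la) (row_sym la) g"
proof -
  let ?R = "row_sym (conjugate la)" and ?C = "col_alt (conjugate la)"
  have "young_symmetrizer (conjugate la) (flip \<circ> g \<circ> inv flip) =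
      (\<Sum>h\<in>perms n. ?R h * ?C (inv h \<circ> (flip \<circ> g \<circ> inv flip)))"
    by (simp add: young_symmetrizer_convolution[OF conj_size(2)] convolution_def)
  also have "\<dots> = (\<Sum>h\<in>perms n. ?R (flip \<circ> h) * ?C (inv (flip \<circ> h) \<circ> (flip \<circ> g \<circ> inv flip)))"
    by (rule sum_perms_left[OF flip_perm, symmetric])
  also have "\<dots> = (\<Sum>h\<in>perms n. ?R (flip \<circ> (h \<circ> inv flip)) * ?C (inv (flip \<circ> (h \<circ> inv flip)) \<circ> (flip \<circ> g \<circ> inv flip)))"
    by (rule sum_perms_right[OF permutes_inv[OF flip_perm], symmetric])
  also have "\<dots> = (\<Sum>h\<in>perms n. of_int (sign g) * (col_alt la h * row_sym la (inv h \<circ> g)))"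
  proof (rule sum.cong[OF refl])
    fix h assume "h \<in> perms n"
    then have h: "h permutes {1..n}" by simp
    have "inv (flip \<circ> (h \<circ> inv flip)) = flip \<circ> inv h \<circ> inv flip"
      using h flip_perm
      by (simp add: inv_comp_perm[of _ "{1..n}"] permutes_inv permutes_compose perm_cancel o_assoc)
    then have eq: "inv (flip \<circ> (h \<circ> inv flip)) \<circ> (flip \<circ> g \<circ> inv flip) = flip \<circ> (inv h \<circ> g) \<circ> inv flip"
      by (simp add: fun_eq_iff permutes_inverses[OF flip_perm])
    have hg: "inv h \<circ> g permutes {1..n}"
      using h g by (simp add: perms_comp_iff permutes_inv)
    have R: "?R (flip \<circ> (h \<circ> inv flip)) = (if h \<in> column_group la then 1 else 0)"
      using row_group_conjugate[of h] by (simp add: row_sym_def o_assoc)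
    have "sign (flip \<circ> (inv h \<circ> g) \<circ> inv flip) = sign (inv h \<circ> g) * (sign flip * sign flip)"
      using perm_permutation[OF flip_perm] perm_permutation[OF permutes_inv[OF flip_perm]] perm_permutation[OF hg]
      by (simp add: sign_compose permutation_compose sign_inverse)
    also have "\<dots> = sign g * sign h"
      using perm_permutation[OF g] perm_permutation[OF h] perm_permutation[OF permutes_inv[OF h]]
      by (simp add: sign_compose sign_inverse sign_square mult.commute)
    finally have C: "?C (flip \<circ> (inv h \<circ> g) \<circ> inv flip) =
        (if inv h \<circ> g \<in> row_group la then of_int (sign g) * of_int (sign h) else 0)"
      using column_group_conjugate[of "inv h \<circ> g"] by (simp add: col_alt_def)
    show "?R (flip \<circ> (h \<circ> inv flip)) * ?C (inv (flip \<circ> (h \<circ> inv flip)) \<circ> (flip \<circ> g \<circ> inv flip)) =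
        of_int (sign g) * (col_alt la h * row_sym la (inv h \<circ> g))"
      unfolding eq R C by (simp add: col_alt_def row_sym_def)
  qed
  also have "\<dots> = of_int (sign g) * convolution n (col_alt la) (row_sym la) g"
    by (simp add: convolution_def sum_distrib_left)
  finally show ?thesis .
qed

lemma sign_conj:
  assumes "x permutes {1..n}" "g permutes {1..n}"
  shows "sign (inv x \<circ> g \<circ> x) = sign g"
proof -
  have "sign (inv x \<circ> g \<circ> x) = sign g * (sign x * sign x)"
    using perm_permutation[OF assms(1)] perm_permutation[OF permutes_inv[OF assms(1)]] perm_permutation[OF assms(2)]
    by (simp add: sign_compose permutation_compose sign_inverse)
  then show ?thesis
    by (simp add: sign_square)
qed

text \<open>Summing over all conjugates removes \<open>flip\<close>, and the trace property restores
  the order of the row and the column factor.\<close>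

lemma central_elt_conjugate:
  assumes g: "g permutes {1..n}"
  shows "central_elt (conjugate la) g = of_int (sign g) * central_elt la g"
proof -
  have "central_elt (conjugate la) g = (\<Sum>x\<in>perms n. young_symmetrizer (conjugate la) (inv x \<circ> g \<circ> x))"
    by (simp add: central_elt_def class_sum_def conj_size)
  also have "\<dots> = (\<Sum>x\<in>perms n. young_symmetrizer (conjugate la) (inv (x \<circ> inv flip) \<circ> g \<circ> (x \<circ> inv flip)))"
    by (rule sum_perms_right[OF permutes_inv[OF flip_perm], symmetric])
  also have "\<dots> = (\<Sum>x\<in>perms n. of_int (sign g) * convolution n (col_alt la) (row_sym la) (inv x \<circ> g \<circ> x))"
  proof (rule sum.cong[OF refl])
    fix x assume "x \<in> perms n"
    then have x: "x permutes {1..n}" by simp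
    have "inv (x \<circ> inv flip) \<circ> g \<circ> (x \<circ> inv flip) = flip \<circ> (inv x \<circ> g \<circ> x) \<circ> inv flip"
      by (simp add: inv_comp_perm[OF x permutes_inv[OF flip_perm]] perm_cancel[OF flip_perm] o_assoc)
    then show "young_symmetrizer (conjugate la) (inv (x \<circ> inv flip) \<circ> g \<circ> (x \<circ> inv flip)) =
        of_int (sign g) * convolution n (col_alt la) (row_sym la) (inv x \<circ> g \<circ> x)"
      using young_symmetrizer_conjugate[of "inv x \<circ> g \<circ> x"] g conj_permutes_iff[OF x]
      by (simp only: sign_conj[OF x g])
  qed
  also have "\<dots> = of_int (sign g) * class_sum n (convolution n (col_alt la) (row_sym la)) g"
    by (simp add: class_sum_def sum_distrib_left)
  also have "class_sum n (convolution n (col_alt la) (row_sym la)) = central_elt la"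
    unfolding class_sum_commute[OF col_alt_in[OF conj_size(1)] row_sym_in[OF conj_size(1)]]
    by (simp add: central_elt_def conj_size young_symmetrizer_convolution[OF conj_size(1)])
  finally show ?thesis .
qed

lemma central_scale_conjugate: "central_scale (conjugate la) = central_scale la"
proof -
  have "convolution n (central_elt (conjugate la)) (central_elt (conjugate la)) id =
      convolution n (central_elt la) (central_elt la) id"
    unfolding convolution_def
    by (intro sum.cong) (auto simp: central_elt_conjugate permutes_inv mult.assoc sign_mult_inv)
  then show ?thesis
    by (simp add: central_scale_def conj_size)
qed

text \<open>The signs at \<open>g\<close> and at \<open>inv g\<close> cancel in the convolution at
  the identity.\<close>

lemma character_weight_conjugate:
  assumes "\<And>g. g permutes {1..n} \<Longrightarrow> chi' g = of_int (sign g) * chi g"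
  shows "character_weight n chi' (conjugate la) = character_weight n chi la"
proof -
  have "convolution n chi' (central_elt (conjugate la)) id = convolution n chi (central_elt la) id"
    unfolding convolution_def
    by (intro sum.cong) (auto simp: assms central_elt_conjugate permutes_inv mult.assoc sign_mult_inv)
  then show ?thesis
    by (simp add: character_weight_def central_scale_conjugate)
qed

end

section \<open>Comparison of the two families of measures\<close>

lemma event_prob_sign:
  assumes chi: "\<And>x g. x permutes {1..n} \<Longrightarrow> g permutes {1..n} \<Longrightarrow> chi (inv x \<circ> g \<circ> x) = chi g"
    and chi': "\<And>x g. x permutes {1..n} \<Longrightarrow> g permutes {1..n} \<Longrightarrow> chi' (inv x \<circ> g \<circ> x) = chi' g"
    and sgn: "\<And>g. g permutes {1..n} \<Longrightarrow> chi' g = of_int (sign g) * chi g"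
  shows "event_prob n chi' E = event_prob n chi (\<lambda>la. E (conjugate la))"
proof -
  have "bij_betw conjugate {la. la \<in> young_diagrams n \<and> E (conjugate la)} {la. la \<in> young_diagrams n \<and> E la}"
    by (rule bij_betw_byWitness[where f' = conjugate]) (auto simp: conjugate_in conjugate_conjugate)
  then have "(\<Sum>la | la \<in> young_diagrams n \<and> E la. character_weight n chi' la) =
      (\<Sum>la | la \<in> young_diagrams n \<and> E (conjugate la). character_weight n chi' (conjugate la))"
    by (rule sum.reindex_bij_betw[symmetric])
  also have "\<dots> = (\<Sum>la | la \<in> young_diagrams n \<and> E (conjugate la). character_weight n chi la)"
    by (intro sum.cong refl character_weight_conjugate sgn) auto
  moreover have "chi' id = chi id"
    using sgn[OF permutes_id] sign_id by (metis mult_1 of_int_1)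
  ultimately show ?thesis
    by (simp only: event_prob_eq[OF chi] event_prob_eq[OF chi'])
qed

text \<open>The event probability before normalisation; unlike the probability it is linear in the
  character, which allows term-by-term treatment of \<open>tau_char\<close>.\<close>

definition event_weight :: "nat \<Rightarrow> ((nat \<Rightarrow> nat) \<Rightarrow> complex) \<Rightarrow> (nat list \<Rightarrow> bool) \<Rightarrow> real" where
  "event_weight n chi E = Re (\<Sum>la | la \<in> young_diagrams n \<and> E la. character_weight n chi la)"

lemma sigma_char_id: "sigma_char n k id = complex_of_real (real k ^ n)"
  using num_cycles_id[of n] by (simp add: sigma_char_def)

lemma event_prob_sigma:
  "event_prob n (sigma_char n k) E = event_weight n (sigma_char n k) E / real k ^ n"
  by (simp only: event_prob_eq[of n "sigma_char n k", OF sigma_char_conj] sigma_char_id event_weight_def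
      Re_divide_of_real)

lemma event_weight_sigma_bounds:
  "0 \<le> event_weight n (sigma_char n k) E" "event_weight n (sigma_char n k) E \<le> real k ^ n"
proof -
  have nonneg: "0 \<le> Re (character_weight n (sigma_char n k) la)" if "la \<in> young_diagrams n" for la
    using character_weight_sigma_nonneg[OF that, of k] by auto
  then show "0 \<le> event_weight n (sigma_char n k) E"
    by (auto simp: event_weight_def intro!: sum_nonneg)
  have "event_weight n (sigma_char n k) E \<le> (\<Sum>la\<in>young_diagrams n. Re (character_weight n (sigma_char n k) la))"
    unfolding event_weight_def Re_sum using nonneg finite_young_diagrams by (intro sum_mono2) auto
  also have "\<dots> = real k ^ n"
    by (simp only: Re_sum[symmetric] sum_character_weight[of n "sigma_char n k", OF sigma_char_conj]
        sigma_char_id Re_complex_of_real)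
  finally show "event_weight n (sigma_char n k) E \<le> real k ^ n" .
qed

text \<open>The combination that defines \<open>tau_char\<close>, for real sequences. Taken of event
  weights and of the values at the identity, it gives numerator and denominator of a probability, so
  one estimate serves both.\<close>

definition alternating_sum :: "nat \<Rightarrow> nat \<Rightarrow> (nat \<Rightarrow> real) \<Rightarrow> real" where
  "alternating_sum n k s = (\<Sum>j<k. (-1) ^ j * real ((n + 1) choose j) * s (k - j))"

lemma tau_char_id: "tau_char n k id = complex_of_real (alternating_sum n k (\<lambda>i. real i ^ n))"
  by (simp add: tau_char_def alternating_sum_def sigma_char_id)

lemma character_weight_tau:
  "character_weight n (tau_char n k) la =
    (\<Sum>j<k. (-1) ^ j * of_nat ((n + 1) choose j) * character_weight n (sigma_char n (k - j)) la)"
proof -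
  have "tau_char n k = (\<lambda>g. \<Sum>j<k. (-1) ^ j * of_nat ((n + 1) choose j) * sigma_char n (k - j) g)"
    by (simp add: tau_char_def fun_eq_iff)
  then show ?thesis
    by (simp add: character_weight_def convolution_sum_left convolution_scale_left sum_divide_distrib)
qed

lemma event_weight_tau:
  "event_weight n (tau_char n k) E = alternating_sum n k (\<lambda>i. event_weight n (sigma_char n i) E)"
proof -
  have "(\<Sum>la | la \<in> young_diagrams n \<and> E la. character_weight n (tau_char n k) la) =
      (\<Sum>j<k. complex_of_real ((-1) ^ j * real ((n + 1) choose j)) *
        (\<Sum>la | la \<in> young_diagrams n \<and> E la. character_weight n (sigma_char n (k - j)) la))"
    unfolding character_weight_tau by (subst sum.swap) (simp add: sum_distrib_left)
  moreover have "Re (complex_of_real r * z) = r * Re z" for r z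
    by simp
  ultimately show ?thesis
    by (simp only: event_weight_def alternating_sum_def Re_sum)
qed

lemma event_prob_tau:
  "event_prob n (tau_char n k) E = event_weight n (tau_char n k) E / alternating_sum n k (\<lambda>i. real i ^ n)"
  by (simp only: event_prob_eq[of n "tau_char n k", OF tau_char_conj] tau_char_id event_weight_def
      Re_divide_of_real)

text \<open>Since \<open>(k - j)^n \<le> k^n exp (- j n / k)\<close>, the terms with \<open>j > 0\<close> are dominated by a
  geometric series with ratio \<open>(n + 1) exp (- n / k)\<close>.\<close>

lemma alternating_sum_approx:
  assumes k: "k \<ge> 1" and q: "q = (real n + 1) * exp (- real n / real k)" "q \<le> 1 / 4"
    and s: "\<And>i. \<bar>s i\<bar> \<le> real i ^ n"
  shows "\<bar>alternating_sum n k s - s k\<bar> \<le> 2 * q * real k ^ n"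
proof -
  have q0: "q > 0"
    unfolding q(1) by (intro mult_pos_pos) auto
  let ?t = "\<lambda>j. (-1) ^ j * real ((n + 1) choose j) * s (k - j)"
  have term_le: "\<bar>?t j\<bar> \<le> q ^ j * real k ^ n" if "j < k" for j
  proof -
    have "real (k - j) = real k * (1 + - (real j / real k))"
      using that by (simp add: field_simps of_nat_diff)
    also have "\<dots> \<le> real k * exp (- (real j / real k))"
      using exp_ge_add_one_self[of "- (real j / real k)"] by (intro mult_left_mono) auto
    finally have "real (k - j) ^ n \<le> (real k * exp (- (real j / real k))) ^ n"
      by (intro power_mono) auto
    also have "\<dots> = real k ^ n * exp (- real n / real k) ^ j"
      by (simp add: power_mult_distrib exp_of_nat_mult[symmetric] mult.commute)
    finally have pow: "real (k - j) ^ n \<le> real k ^ n * exp (- real n / real k) ^ j" .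
    have "(n + 1) choose j \<le> (n + 1) ^ j"
      using binomial_le_pow[of j "n + 1"] by (cases "j \<le> n + 1") (auto simp: binomial_eq_0)
    then have choose: "real ((n + 1) choose j) \<le> (real n + 1) ^ j"
      by (metis of_nat_1 of_nat_add of_nat_le_iff of_nat_power)
    have "\<bar>?t j\<bar> = real ((n + 1) choose j) * \<bar>s (k - j)\<bar>"
      by (simp add: abs_mult power_abs)
    also have "\<dots> \<le> (real n + 1) ^ j * (real k ^ n * exp (- real n / real k) ^ j)"
      using choose order_trans[OF s pow] by (intro mult_mono) auto
    also have "\<dots> = q ^ j * real k ^ n"
      by (simp add: q(1) power_mult_distrib)
    finally show ?thesis .
  qed
  obtain m where m: "k = Suc m"
    using k by (cases k) auto
  have "alternating_sum n k s = s k + (\<Sum>i<m. ?t (Suc i))"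
    unfolding alternating_sum_def m by (subst sum.lessThan_Suc_shift) simp
  then have "\<bar>alternating_sum n k s - s k\<bar> = \<bar>\<Sum>i<m. ?t (Suc i)\<bar>"
    by simp
  also have "\<dots> \<le> (\<Sum>i<m. q ^ Suc i * real k ^ n)"
    by (intro order_trans[OF sum_abs] sum_mono term_le) (simp add: m)
  also have "\<dots> = q * real k ^ n * (\<Sum>i<m. q ^ i)"
    by (simp add: sum_distrib_left mult_ac)
  also have "\<dots> \<le> q * real k ^ n * 2"
  proof (rule mult_left_mono)
    have "(\<Sum>i<m. q ^ i) = (1 - q ^ m) / (1 - q)"
      using q(2) by (simp add: sum_gp_strict)
    also have "\<dots> \<le> 1 / (1 - q)"
      using q(2) q0 by (intro divide_right_mono) auto
    also have "\<dots> \<le> 2"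
      using q(2) by (simp add: field_simps)
    finally show "(\<Sum>i<m. q ^ i) \<le> 2" .
  qed (use q0 in auto)
  finally show ?thesis
    by (simp add: mult_ac)
qed

text \<open>Numerator and denominator each differ from their leading term by at most
  \<open>2 * q * real k ^ n\<close>. The bound 1/4 on \<open>q\<close> keeps the denominator above
  half of \<open>real k ^ n\<close>, which doubles the remaining terms.\<close>

lemma event_prob_tau_le:
  assumes k: "k \<ge> 1" and q: "q = (real n + 1) * exp (- real n / real k)" "q \<le> 1 / 4"
  shows "\<bar>event_prob n (tau_char n k) E\<bar> \<le> 2 * event_prob n (sigma_char n k) E + 4 * q"
proof -
  let ?S = "event_weight n (sigma_char n k) E" and ?T = "event_weight n (tau_char n k) E"
  let ?A = "alternating_sum n k (\<lambda>i. real i ^ n)"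
  have pos: "real k ^ n > 0"
    using k by simp
  have "\<bar>?T - ?S\<bar> \<le> 2 * q * real k ^ n"
    unfolding event_weight_tau
    by (rule alternating_sum_approx[OF assms]) (use event_weight_sigma_bounds in \<open>simp add: abs_le_iff\<close>)
  then have T: "\<bar>?T\<bar> \<le> ?S + 2 * q * real k ^ n"
    using event_weight_sigma_bounds(1)[of n k E] by linarith
  have "\<bar>?A - real k ^ n\<bar> \<le> 2 * q * real k ^ n"
    by (rule alternating_sum_approx[OF assms]) simp
  moreover have "2 * q * real k ^ n \<le> 1 / 2 * real k ^ n"
    using q(2) pos by (intro mult_right_mono) auto
  ultimately have A: "?A \<ge> real k ^ n / 2"
    by linarith
  then have A_pos: "?A > 0"
    using pos by linarith
  have "\<bar>event_prob n (tau_char n k) E\<bar> = \<bar>?T\<bar> / ?A"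
    by (simp only: event_prob_tau abs_divide abs_of_pos[OF A_pos])
  also have "\<dots> \<le> (?S + 2 * q * real k ^ n) / (real k ^ n / 2)"
    using T A pos by (intro frac_le) auto
  also have "\<dots> = 2 * event_prob n (sigma_char n k) E + 4 * q"
    using pos by (simp add: event_prob_sigma field_simps)
  finally show ?thesis .
qed

lemma null_comparison:
  fixes f g :: "nat \<Rightarrow> real"
  assumes "\<forall>\<^sub>F i in sequentially. \<bar>f i\<bar> \<le> g i" "g \<longlonglongrightarrow> 0"
  shows "f \<longlonglongrightarrow> 0"
  using assms(1) by (intro tendsto_0_le[OF assms(2), of f 1]) (auto elim!: eventually_mono)

text \<open>Eventually \<open>k \<le> 2 * w * sqrt n\<close>, so a quarter of \<open>n / k\<close>
  is at least \<open>sqrt n / (8 * w)\<close>. The fourth power of \<open>exp y > y\<close> then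
  bounds \<open>exp (n / k)\<close> below by \<open>n ^ 2 / (8 * w) ^ 4\<close>, which beats
  \<open>n + 1 \<le> 2 * n\<close> by a factor of order \<open>n\<close>.\<close>

lemma ratio_tendsto_0:
  fixes n k :: "nat \<Rightarrow> nat"
  assumes w: "w > 0" and k: "\<And>i. 1 \<le> k i" and n: "filterlim n at_top sequentially"
    and lim: "(\<lambda>i. real (k i) / sqrt (real (n i))) \<longlonglongrightarrow> w"
  shows "(\<lambda>i. (real (n i) + 1) * exp (- real (n i) / real (k i))) \<longlonglongrightarrow> 0"
proof (rule null_comparison)
  have "\<forall>\<^sub>F i in sequentially. real (k i) / sqrt (real (n i)) < 2 * w"
    using order_tendstoD(2)[OF lim] w by simp
  moreover have "\<forall>\<^sub>F i in sequentially. n i \<ge> 1"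
    using n by (simp add: filterlim_at_top)
  ultimately show "\<forall>\<^sub>F i in sequentially. \<bar>(real (n i) + 1) * exp (- real (n i) / real (k i))\<bar> \<le>
      2 * (8 * w) ^ 4 * inverse (real (n i))"
  proof eventually_elim
    case (elim i)
    let ?n = "real (n i)" and ?k = "real (k i)"
    have n1: "?n \<ge> 1"
      using elim(2) by simp
    have k0: "?k > 0"
      using k[of i] by simp
    have "?k \<le> 2 * w * sqrt ?n"
      using elim(1) n1 by (simp add: divide_less_eq)
    then have "?k * sqrt ?n \<le> 2 * w * sqrt ?n * sqrt ?n"
      by (intro mult_right_mono) auto
    then have "sqrt ?n / (8 * w) \<le> ?n / ?k / 4"
      using w k0 by (simp add: field_simps)
    also have "\<dots> \<le> exp (?n / ?k / 4)"
      using exp_ge_add_one_self[of "?n / ?k / 4"] by linarith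
    finally have "(sqrt ?n / (8 * w)) ^ 4 \<le> exp (?n / ?k / 4) ^ 4"
      using w by (intro power_mono) auto
    also have "\<dots> = exp (?n / ?k)"
      by (simp add: exp_of_nat_mult[symmetric])
    finally have "?n ^ 2 \<le> (8 * w) ^ 4 * exp (?n / ?k)"
      using w by (simp add: power_divide field_simps power4_eq_xxxx power2_eq_square)
    then have "?n ^ 2 * exp (- ?n / ?k) \<le> (8 * w) ^ 4"
      by (simp add: exp_minus field_simps)
    then have "?n * exp (- ?n / ?k) \<le> (8 * w) ^ 4 * inverse ?n"
      using n1 by (simp add: field_simps power2_eq_square)
    moreover have "(?n + 1) * exp (- ?n / ?k) \<le> 2 * (?n * exp (- ?n / ?k))"
      using n1 by (simp add: field_simps)
    ultimately have "(?n + 1) * exp (- ?n / ?k) \<le> 2 * (8 * w) ^ 4 * inverse ?n"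
      by linarith
    moreover have "(?n + 1) * exp (- ?n / ?k) \<ge> 0"
      by (intro mult_nonneg_nonneg) auto
    ultimately show ?case
      by (simp only: abs_of_nonneg)
  qed
  have "filterlim (\<lambda>i. real (n i)) at_top sequentially"
    by (rule filterlim_compose[OF filterlim_real_sequentially n])
  then have "(\<lambda>i. inverse (real (n i))) \<longlonglongrightarrow> 0"
    by (rule tendsto_inverse_0_at_top)
  then show "(\<lambda>i. 2 * (8 * w) ^ 4 * inverse (real (n i))) \<longlonglongrightarrow> 0"
    by (rule tendsto_mult_right_zero)
qed

lemma deviation_prob_tau_tendsto:
  fixes n k :: "nat \<Rightarrow> nat"
  assumes w: "w > 0" and g: "biane_limit w g" and k: "\<And>i. 1 \<le> k i"
    and n: "filterlim n at_top sequentially" and klim: "filterlim k at_top sequentially"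
    and lim: "(\<lambda>i. real (k i) / sqrt (real (n i))) \<longlonglongrightarrow> w" and "\<epsilon> > 0"
  shows "(\<lambda>i. deviation_prob (n i) (tau_char (n i) (k i)) g \<epsilon>) \<longlonglongrightarrow> 0"
proof (rule null_comparison)
  let ?q = "\<lambda>i. (real (n i) + 1) * exp (- real (n i) / real (k i))"
  let ?s = "\<lambda>i. deviation_prob (n i) (sigma_char (n i) (k i)) g \<epsilon>"
  have q: "?q \<longlonglongrightarrow> 0"
    by (rule ratio_tendsto_0[OF w k n lim])
  then have "\<forall>\<^sub>F i in sequentially. ?q i < 1 / 4"
    by (rule order_tendstoD) simp
  then show "\<forall>\<^sub>F i in sequentially. \<bar>deviation_prob (n i) (tau_char (n i) (k i)) g \<epsilon>\<bar> \<le> 2 * ?s i + 4 * ?q i"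
    by eventually_elim
      (simp only: deviation_prob_def event_prob_tau_le[OF k refl less_imp_le])
  have "?s \<longlonglongrightarrow> 0"
    using g n klim lim \<open>\<epsilon> > 0\<close> unfolding biane_limit_def by blast
  then have "(\<lambda>i. 2 * ?s i + 4 * ?q i) \<longlonglongrightarrow> 2 * 0 + 4 * 0"
    by (intro tendsto_intros q)
  then show "(\<lambda>i. 2 * ?s i + 4 * ?q i) \<longlonglongrightarrow> 0"
    by simp
qed

text \<open>The sign passes from the character to conjugation of diagrams, which reflects profiles.
  The supremum runs over the whole line, so replacing \<open>x\<close> by \<open>- x\<close> leaves
  it unchanged.\<close>

lemma deviation_prob_tau_reflect:
  assumes k: "1 \<le> k" "k \<le> n"
  shows "deviation_prob n (tau_char n k) (\<lambda>x. g (- x)) \<epsilon> = deviation_prob n (tau_char n (n + 1 - k)) g \<epsilon>"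
proof -
  define F where "F la x = ereal \<bar>profile la (x * sqrt (real n)) / sqrt (real n) - g x\<bar>" for la x
  have "(SUP x. ereal \<bar>profile (conjugate la) (x * sqrt (real n)) / sqrt (real n) - g (- x)\<bar>) = (SUP x. F la x)"
    if "la \<in> young_diagrams n" for la
  proof -
    have "ereal \<bar>profile (conjugate la) (x * sqrt (real n)) / sqrt (real n) - g (- x)\<bar> = F la (- x)" for x
      by (simp add: F_def profile_conjugate[OF that])
    moreover have "range (\<lambda>x. F la (- x)) = range (F la)"
      using image_comp[of "F la" uminus UNIV] surj_uminus[where 'a = real] by (simp add: comp_def)
    ultimately show ?thesis
      by simp
  qed
  then have "{la. la \<in> young_diagrams n \<and> (SUP x. ereal \<bar>profile (conjugate la) (x * sqrt (real n)) / sqrt (real n) - g (- x)\<bar>) > ereal \<epsilon>} =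
      {la. la \<in> young_diagrams n \<and> (SUP x. F la x) > ereal \<epsilon>}"
    by auto
  then show ?thesis
    unfolding deviation_prob_def
    by (subst event_prob_sign[of n "tau_char n (n + 1 - k)", OF tau_char_conj tau_char_conj tau_char_symmetry[OF k]])
      (simp_all only: event_prob_def F_def)
qed

theorem theorem5p2:
  fixes w :: real and g :: "real \<Rightarrow> real"
  assumes "w > 0" and "biane_limit w g"
  shows "(\<forall>n k :: nat \<Rightarrow> nat.
            (\<forall>i. 1 \<le> k i \<and> k i \<le> n i) \<longrightarrow>
            filterlim n at_top sequentially \<longrightarrow> filterlim k at_top sequentially \<longrightarrow>
            (\<lambda>i. real (k i) / sqrt (real (n i))) \<longlonglongrightarrow> w \<longrightarrow>
            (\<forall>\<epsilon>>0. (\<lambda>i. deviation_prob (n i) (tau_char (n i) (k i)) g \<epsilon>) \<longlonglongrightarrow> 0)) \<and>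
         (\<forall>n k :: nat \<Rightarrow> nat.
            (\<forall>i. 1 \<le> k i \<and> k i \<le> n i) \<longrightarrow>
            filterlim n at_top sequentially \<longrightarrow> filterlim k at_top sequentially \<longrightarrow>
            (\<lambda>i. (real (n i) - real (k i)) / sqrt (real (n i))) \<longlonglongrightarrow> w \<longrightarrow>
            (\<forall>\<epsilon>>0. (\<lambda>i. deviation_prob (n i) (tau_char (n i) (k i)) (\<lambda>x. g (- x)) \<epsilon>) \<longlonglongrightarrow> 0))"
proof (intro conjI allI impI)
  fix n k :: "nat \<Rightarrow> nat" and \<epsilon> :: real
  assume "\<forall>i. 1 \<le> k i \<and> k i \<le> n i" "filterlim n at_top sequentially" "filterlim k at_top sequentially"
    "(\<lambda>i. real (k i) / sqrt (real (n i))) \<longlonglongrightarrow> w" "\<epsilon> > 0"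
  then show "(\<lambda>i. deviation_prob (n i) (tau_char (n i) (k i)) g \<epsilon>) \<longlonglongrightarrow> 0"
    by (intro deviation_prob_tau_tendsto[OF assms]) auto
next
  fix n k :: "nat \<Rightarrow> nat" and \<epsilon> :: real
  assume k: "\<forall>i. 1 \<le> k i \<and> k i \<le> n i" and n: "filterlim n at_top sequentially"
    and lim: "(\<lambda>i. (real (n i) - real (k i)) / sqrt (real (n i))) \<longlonglongrightarrow> w" and "\<epsilon> > 0"
  define k' where "k' i = n i + 1 - k i" for i
  have sqrt_n: "filterlim (\<lambda>i. sqrt (real (n i))) at_top sequentially"
    by (intro filterlim_compose[OF sqrt_at_top] filterlim_compose[OF filterlim_real_sequentially n])
  have k'_eq: "real (k' i) / sqrt (real (n i)) =
      (real (n i) - real (k i)) / sqrt (real (n i)) + inverse (sqrt (real (n i)))" for i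
    using k[rule_format, of i] by (simp add: k'_def of_nat_diff field_simps)
  have k'_lim: "(\<lambda>i. real (k' i) / sqrt (real (n i))) \<longlonglongrightarrow> w"
    unfolding k'_eq using tendsto_add[OF lim tendsto_inverse_0_at_top[OF sqrt_n]] by simp
  \<comment> \<open>\<open>biane_limit\<close> also asks that the number of colours tend to
    infinity. For \<open>k'\<close> this follows from its ratio to \<open>sqrt n\<close> having the
    positive limit \<open>w\<close>.\<close>
  have "filterlim (\<lambda>i. real (k' i) / sqrt (real (n i)) * sqrt (real (n i))) at_top sequentially"
    by (rule filterlim_tendsto_pos_mult_at_top[OF k'_lim \<open>w > 0\<close> sqrt_n])
  moreover have "real (k' i) / sqrt (real (n i)) * sqrt (real (n i)) = real (k' i)" for i
    using k[rule_format, of i] by simp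
  ultimately have "filterlim (\<lambda>i. real (k' i)) at_top sequentially"
    by simp
  then have "filterlim k' at_top sequentially"
    by (simp add: filterlim_sequentially_iff_filterlim_real)
  moreover have "1 \<le> k' i" for i
    using k[rule_format, of i] unfolding k'_def by linarith
  ultimately have "(\<lambda>i. deviation_prob (n i) (tau_char (n i) (k' i)) g \<epsilon>) \<longlonglongrightarrow> 0"
    by (intro deviation_prob_tau_tendsto[OF assms _ n _ k'_lim \<open>\<epsilon> > 0\<close>])
  then show "(\<lambda>i. deviation_prob (n i) (tau_char (n i) (k i)) (\<lambda>x. g (- x)) \<epsilon>) \<longlonglongrightarrow> 0"
    using k by (simp add: deviation_prob_tau_reflect k'_def)
qed

end
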